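(* Let $a$ and $b$ be binary strings of length less than $n$, and let $s$ and $k$ be numbers such that $\mathrm{KS}^s(a\mid b)<k$. Then there exists a binary string $p$ such that (1) $\mathrm{KS}^{O(s)+\mathrm{poly}(n)}(a\mid p,b)=O(\log\log s+\log n)$; (2) $\mathrm{KS}^s(p)\le k+O(\log n)$; (3) $\mathrm{KS}^{O(s)+\mathrm{poly}(n)}(p\mid a)=O(\log\log s+\log n)$, where all constants in the $O$- and $\mathrm{poly}$-notations depend only on the choice of the optimal description method (and not on $n,k,s,a,b,p$).
   Context: Fix a two-argument Turing machine $\mathcal{U}$ that is optimal for space-bounded complexity: for every machine $\mathcal{V}$ there is a constant $c$ with $\mathrm{KS}^{s}_{\mathcal{U}}(x\mid y)\le\mathrm{KS}^{cs}_{\mathcal{V}}(x\mid y)+c$ for all $x,y,s$. $\mathrm{KS}^s(x\mid y)=\mathrm{KS}^s_{\mathcal{U}}(x\mid y)$ is the length of a shortest program $p$ such that $\mathcal{U}(p,y)=x$ and this computation uses at most $s$ memory cells; $\mathrm{KS}^s(x)=\mathrm{KS}^s(x\mid\text{empty string})$, and $\mathrm{KS}^s(x\mid p,b)$ uses the (encoded) pair $(p,b)$ as condition. Statements about this complexity are understood up to a constant additive term in complexities and a constant multiplicative factor in space bounds. *)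

theory Defs
  imports Complex_Main "HOL-Library.Extended_Nat" "HOL-Library.Extended_Real"
    "HOL-Computational_Algebra.Polynomial"
begin

type_synonym bitstring = "bool list"

section \<open>Two-argument Turing machines\<close>

text \<open>
  Machines have two read-only two-way input tapes (program and condition), finitely many
  work tapes over a finite alphabet, and an append-only output tape.  Only the cells of the
  work tapes count as memory.  States, work symbols and work tapes are numbered from 0;
  state 0 is initial, symbol 0 is the blank, and the machine halts when its transition
  function returns \<^term>\<open>None\<close>.
\<close>

datatype dir = MoveLeft | Stay | MoveRight

datatype insym = LeftMarker | Bit bool | RightMarker

record action =
  next_state :: nat
  prog_dir :: dir
  cond_dir :: dir
  work_acts :: "(nat \<times> dir) list"
  emit :: "bool option"

record tm =
  num_states :: nat
  num_symbols :: nat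
  num_tapes :: nat
  trans :: "nat \<Rightarrow> insym \<Rightarrow> insym \<Rightarrow> nat list \<Rightarrow> action option"

text \<open>
  At least one work tape is required: otherwise some machines would use no memory at all,
  and a multiplicative constant in the space bound could not absorb the cost of simulating
  them.
\<close>

definition turing_machine :: "tm \<Rightarrow> bool" where
  "turing_machine M \<longleftrightarrow>
     num_states M \<ge> 1 \<and> num_symbols M \<ge> 1 \<and> num_tapes M \<ge> 1 \<and>
     (\<forall>q u v ws act.
        q < num_states M \<longrightarrow> length ws = num_tapes M \<longrightarrow> set ws \<subseteq> {..<num_symbols M} \<longrightarrow>
        trans M q u v ws = Some act \<longrightarrow>
        next_state act < num_states M \<and> length (work_acts act) = num_tapes M \<and>
        (\<forall>(w, d) \<in> set (work_acts act). w < num_symbols M))"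

record config =
  cur_state :: nat
  prog_pos :: nat
  cond_pos :: nat
  tape :: "nat \<Rightarrow> int \<Rightarrow> nat"
  head :: "nat \<Rightarrow> int"
  out_tape :: bitstring

definition init_config :: config where
  "init_config = \<lparr>cur_state = 0, prog_pos = 1, cond_pos = 1,
     tape = (\<lambda>i z. 0), head = (\<lambda>i. 0), out_tape = []\<rparr>"

text \<open>
  An input \<^term>\<open>x\<close> occupies positions 1 to \<^term>\<open>length x\<close>, with end markers at positions 0 and
  \<^term>\<open>length x + 1\<close>.  Input heads cannot leave this range, so that their positions
  cannot serve as unbounded counters.
\<close>

definition input_sym :: "bitstring \<Rightarrow> nat \<Rightarrow> insym" where
  "input_sym x i =
     (if i = 0 then LeftMarker else if i \<le> length x then Bit (x ! (i - 1)) else RightMarker)"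

fun move_input :: "bitstring \<Rightarrow> dir \<Rightarrow> nat \<Rightarrow> nat" where
  "move_input x MoveLeft i = i - 1"
| "move_input x Stay i = i"
| "move_input x MoveRight i = min (i + 1) (length x + 1)"

fun move_work :: "dir \<Rightarrow> int \<Rightarrow> int" where
  "move_work MoveLeft z = z - 1"
| "move_work Stay z = z"
| "move_work MoveRight z = z + 1"

definition next_action :: "tm \<Rightarrow> bitstring \<Rightarrow> bitstring \<Rightarrow> config \<Rightarrow> action option" where
  "next_action M p y c =
     trans M (cur_state c) (input_sym p (prog_pos c)) (input_sym y (cond_pos c))
       (map (\<lambda>i. tape c i (head c i)) [0..<num_tapes M])"

definition halted :: "tm \<Rightarrow> bitstring \<Rightarrow> bitstring \<Rightarrow> config \<Rightarrow> bool" where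
  "halted M p y c \<longleftrightarrow> next_action M p y c = None"

definition perform :: "tm \<Rightarrow> bitstring \<Rightarrow> bitstring \<Rightarrow> action \<Rightarrow> config \<Rightarrow> config" where
  "perform M p y act c =
     \<lparr>cur_state = next_state act,
      prog_pos = move_input p (prog_dir act) (prog_pos c),
      cond_pos = move_input y (cond_dir act) (cond_pos c),
      tape = (\<lambda>i. if i < num_tapes M
                  then (tape c i)(head c i := fst (work_acts act ! i)) else tape c i),
      head = (\<lambda>i. if i < num_tapes M
                  then move_work (snd (work_acts act ! i)) (head c i) else head c i),
      out_tape = (case emit act of None \<Rightarrow> out_tape c | Some b \<Rightarrow> out_tape c @ [b])\<rparr>"

definition step :: "tm \<Rightarrow> bitstring \<Rightarrow> bitstring \<Rightarrow> config \<Rightarrow> config" where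
  "step M p y c = (case next_action M p y c of None \<Rightarrow> c | Some act \<Rightarrow> perform M p y act c)"

definition config_at :: "tm \<Rightarrow> bitstring \<Rightarrow> bitstring \<Rightarrow> nat \<Rightarrow> config" where
  "config_at M p y t = (step M p y ^^ t) init_config"

definition visited_cells :: "tm \<Rightarrow> bitstring \<Rightarrow> bitstring \<Rightarrow> nat \<Rightarrow> (nat \<times> int) set" where
  "visited_cells M p y t =
     {(i, head (config_at M p y t') i) | i t'. i < num_tapes M \<and> t' \<le> t}"

definition computes_in_space ::
    "tm \<Rightarrow> bitstring \<Rightarrow> bitstring \<Rightarrow> bitstring \<Rightarrow> nat \<Rightarrow> bool" where
  "computes_in_space M p y x s \<longleftrightarrow>
     (\<exists>t. halted M p y (config_at M p y t) \<and> out_tape (config_at M p y t) = x \<and>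
          card (visited_cells M p y t) \<le> s)"


section \<open>Space-bounded Kolmogorov complexity\<close>

text \<open>The value is \<^term>\<open>\<infinity>\<close> if no program produces \<^term>\<open>x\<close> within the space bound.\<close>

definition KS :: "tm \<Rightarrow> nat \<Rightarrow> bitstring \<Rightarrow> bitstring \<Rightarrow> enat" where
  "KS M s x y = (INF p \<in> {p. computes_in_space M p y x s}. enat (length p))"

definition KS_plain :: "tm \<Rightarrow> nat \<Rightarrow> bitstring \<Rightarrow> enat" where
  "KS_plain M s x = KS M s x []"

text \<open>
  The constant factor in the space bound is on the side of the optimal machine, which pays for
  the simulation.  On the other side it would make the notion degenerate: every machine
  would qualify with \<^term>\<open>c = 0\<close>.
\<close>

definition optimal :: "tm \<Rightarrow> bool" where
  "optimal U \<longleftrightarrow> turing_machine U \<and>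
     (\<forall>V. turing_machine V \<longrightarrow>
        (\<exists>c::nat. \<forall>x y s. KS U (c * s) x y \<le> KS V s x y + enat c))"

definition encode_pair :: "bitstring \<Rightarrow> bitstring \<Rightarrow> bitstring" where
  "encode_pair p b = concat (map (\<lambda>u. [u, u]) p) @ [False, True] @ b"

text \<open>The maximum gives the iterated logarithm the value 0 for the arguments 0 and 1.\<close>

definition loglog :: "nat \<Rightarrow> real" where
  "loglog s = log 2 (log 2 (real (max 2 s)))"

end

theory Submission
  imports Defs
begin

text \<open>
  Let \<open>O(q, b)\<close> be the output of \<open>U\<close> on \<open>(q, b)\<close>, computed with a cut-off on memory and, by the
  pigeonhole principle, on time.  The strings of small complexity given \<open>b\<close> are among the
  fewer than \<open>2^k\<close> values \<open>O(q, b)\<close> with \<open>|q| < k\<close>.  A random hash function into \<open>k + O(1)\<close> bits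
  separates a given one of them from all the others with probability at least \<open>1/2\<close>, so a
  sequence of \<open>n + k + 1\<close> hash functions contains with positive probability, for all \<open>b\<close> and \<open>q\<close>
  simultaneously, one that isolates \<open>O(q, b)\<close>.  Such a sequence has polynomial length; the first one
  is found by exhaustive search in space \<open>O(s) + poly(n)\<close> and need not be part of any
  description.  The string \<open>p\<close> is the value of \<open>a\<close> under the isolating function.  The descriptions
  consist of the index of that function, \<open>n\<close>, \<open>k\<close>, and the exponent of a power of two close to \<open>s\<close>,
  which accounts for the term \<open>log log s\<close>.

  All searches are bounded recursions on numbers with polynomially bounded values (the class
  \<open>E\<^sup>2\<close> of Grzegorczyk) and are compiled to Turing machines through programs on stacks.
\<close>

section \<open>Stack programs and their compilation\<close>

text \<open>Condition (3) computes \<open>p\<close> from \<open>a\<close> without \<open>b\<close>,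
  so the hash functions cannot be chosen to suit \<open>b\<close>. This is why one seed has to serve
  all \<open>b\<close> and all programs at once; only the index of a function inside it, O(log n)
  bits, is paid for. The space bound must also be reconstructed from few bits: rounding it up to a
  power of two costs a constant factor and leaves an exponent of about log s to describe. As
  \<open>k\<close> may be far larger than \<open>n\<close>, it is first capped at \<open>n\<close>
  plus a constant, using the program that prints its own text. Linear space comes from the sizes of
  numbers. A cut-off \<open>N = 2 ^ E\<close> with E = O(s) + poly(n) exceeds all tape contents,
  encoded input positions and seeds, and a program with a fixed number of binary registers whose
  values are polynomial in \<open>N\<close> occupies O(E) cells, however long it runs. The
  simulation makes no halting test: a halted configuration is a fixed point of the step function,
  which is iterated as often as there are configuration codes.\<close>

type_synonym test = "insym \<Rightarrow> insym \<Rightarrow> bool option \<Rightarrow> bool"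

datatype com =
    Push nat bool
  | Write nat bool
  | Pop nat
  | MoveP dir
  | MoveC dir
  | Emit bool
  | Seq com com
  | Branch nat test com com
  | While nat test com

definition top_of :: "bool list \<Rightarrow> bool option" where
  "top_of xs = (if xs = [] then None else Some (hd xs))"

type_synonym stacks = "nat \<Rightarrow> bool list"
type_synonym astate = "stacks \<times> nat \<times> nat \<times> bool list"

text \<open>\<open>L\<close> bounds the height of every stack and will become the space bound, so
  only \<open>Push\<close> is restricted by it. \<open>Write\<close> has no rule: it occurs only as
  the second half of a \<open>Push\<close>, in the control state of the machine.\<close>

inductive exec :: "nat \<Rightarrow> bitstring \<Rightarrow> bitstring \<Rightarrow> com \<Rightarrow> astate \<Rightarrow> astate \<Rightarrow> bool"
  for L :: nat and p y :: bitstring where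
  Push: "length (f r) < L \<Longrightarrow> exec L p y (Push r b) (f, i, j, z) (f(r := b # f r), i, j, z)"
| Pop: "f r \<noteq> [] \<Longrightarrow> exec L p y (Pop r) (f, i, j, z) (f(r := tl (f r)), i, j, z)"
| MoveP: "exec L p y (MoveP d) (f, i, j, z) (f, move_input p d i, j, z)"
| MoveC: "exec L p y (MoveC d) (f, i, j, z) (f, i, move_input y d j, z)"
| Emit: "exec L p y (Emit b) (f, i, j, z) (f, i, j, z @ [b])"
| Seq: "exec L p y a s1 s2 \<Longrightarrow> exec L p y b s2 s3 \<Longrightarrow> exec L p y (Seq a b) s1 s3"
| IfT: "t (input_sym p i) (input_sym y j) (top_of (f r)) \<Longrightarrow> exec L p y a (f, i, j, z) s \<Longrightarrow>
        exec L p y (Branch r t a b) (f, i, j, z) s"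
| IfF: "\<not> t (input_sym p i) (input_sym y j) (top_of (f r)) \<Longrightarrow> exec L p y b (f, i, j, z) s \<Longrightarrow>
        exec L p y (Branch r t a b) (f, i, j, z) s"
| WhileT: "t (input_sym p i) (input_sym y j) (top_of (f r)) \<Longrightarrow> exec L p y a (f, i, j, z) s \<Longrightarrow>
        exec L p y (While r t a) s s' \<Longrightarrow> exec L p y (While r t a) (f, i, j, z) s'"
| WhileF: "\<not> t (input_sym p i) (input_sym y j) (top_of (f r)) \<Longrightarrow>
        exec L p y (While r t a) (f, i, j, z) (f, i, j, z)"

text \<open>Commands that name no stack demand \<open>0 < m\<close> because \<open>delta\<close>
  lets them act on tape 0 without changing it.\<close>

fun wf_com :: "nat \<Rightarrow> com \<Rightarrow> bool" where
  "wf_com m (Push r b) \<longleftrightarrow> r < m"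
| "wf_com m (Write r b) \<longleftrightarrow> r < m"
| "wf_com m (Pop r) \<longleftrightarrow> r < m"
| "wf_com m (MoveP d) \<longleftrightarrow> 0 < m"
| "wf_com m (MoveC d) \<longleftrightarrow> 0 < m"
| "wf_com m (Emit b) \<longleftrightarrow> 0 < m"
| "wf_com m (Seq a b) \<longleftrightarrow> wf_com m a \<and> wf_com m b"
| "wf_com m (Branch r t a b) \<longleftrightarrow> r < m \<and> wf_com m a \<and> wf_com m b"
| "wf_com m (While r t a) \<longleftrightarrow> r < m \<and> wf_com m a"

lemma wf_com_pos: "wf_com m c \<Longrightarrow> 0 < m"
  by (induction c) auto

lemma wf_com_mono: "wf_com m c \<Longrightarrow> m \<le> m' \<Longrightarrow> wf_com m' c"
  by (induction c) auto

fun regs :: "com \<Rightarrow> nat" where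
  "regs (Push r b) = Suc r"
| "regs (Write r b) = Suc r"
| "regs (Pop r) = Suc r"
| "regs (MoveP d) = 1"
| "regs (MoveC d) = 1"
| "regs (Emit b) = 1"
| "regs (Seq a b) = max (regs a) (regs b)"
| "regs (Branch r t a b) = max (Suc r) (max (regs a) (regs b))"
| "regs (While r t a) = max (Suc r) (regs a)"

lemma wf_com_regs: "wf_com (regs c) c"
  by (induction c) (auto elim: wf_com_mono)

text \<open>The blank 0 is reserved for cell 0 of each tape, where it marks the bottom;
  \<open>read_sym\<close> reads it as an empty stack.\<close>

definition sym_of :: "bool \<Rightarrow> nat" where
  "sym_of b = (if b then 2 else 1)"

definition read_sym :: "nat \<Rightarrow> bool option" where
  "read_sym w = (if w = 0 then None else Some (w = 2))"

text \<open>
  The control state of the compiled machine is the list of commands still to be executed.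
  A push takes two steps, because a machine writes before it moves.
\<close>

fun delta :: "com \<Rightarrow> com list \<Rightarrow> insym \<Rightarrow> insym \<Rightarrow> (nat \<Rightarrow> nat) \<Rightarrow>
    com list \<times> nat \<times> nat option \<times> dir \<times> dir \<times> dir \<times> bool option" where
  "delta (Push r b) K u v ws = (Write r b # K, r, None, MoveRight, Stay, Stay, None)"
| "delta (Write r b) K u v ws = (K, r, Some (sym_of b), Stay, Stay, Stay, None)"
| "delta (Pop r) K u v ws = (K, r, None, MoveLeft, Stay, Stay, None)"
| "delta (MoveP d) K u v ws = (K, 0, None, Stay, d, Stay, None)"
| "delta (MoveC d) K u v ws = (K, 0, None, Stay, Stay, d, None)"
| "delta (Emit b) K u v ws = (K, 0, None, Stay, Stay, Stay, Some b)"
| "delta (Seq a b) K u v ws = (a # b # K, 0, None, Stay, Stay, Stay, None)"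
| "delta (Branch r t a b) K u v ws =
     ((if t u v (read_sym (ws r)) then a else b) # K, 0, None, Stay, Stay, Stay, None)"
| "delta (While r t a) K u v ws =
     (if t u v (read_sym (ws r)) then a # While r t a # K else K, 0, None, Stay, Stay, Stay, None)"

text \<open>The control states that can occur while \<open>c\<close> runs in front of
  \<open>K\<close>, before control returns to \<open>K\<close>. A loop puts itself behind its body,
  so the body sees only one continuation and the set stays finite.\<close>

fun conts :: "com \<Rightarrow> com list \<Rightarrow> com list set" where
  "conts (Push r b) K = {Push r b # K, Write r b # K}"
| "conts (Seq a b) K = insert (Seq a b # K) (conts a (b # K) \<union> conts b K)"
| "conts (Branch r t a b) K = insert (Branch r t a b # K) (conts a K \<union> conts b K)"
| "conts (While r t a) K = insert (While r t a # K) (conts a (While r t a # K))"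
| "conts c K = {c # K}"

lemma conts_self: "c # K \<in> conts c K"
  by (cases c) auto

lemma finite_conts: "finite (conts c K)"
  by (induction c K rule: conts.induct) auto

lemma conts_delta:
  "c' # K' \<in> conts c K \<Longrightarrow> fst (delta c' K' u v ws) \<in> insert K (conts c K)"
  by (induction c K rule: conts.induct)
    (auto simp: conts_self split: if_splits)

lemma conts_wf:
  "X \<in> conts c K \<Longrightarrow> wf_com m c \<Longrightarrow> list_all (wf_com m) K \<Longrightarrow> list_all (wf_com m) X"
  by (induction c K rule: conts.induct) (auto dest: wf_com_pos)

lemma delta_tape:
  assumes "wf_com m c" "delta c K u v ws = (K', r, w, d, pd, cd, em)"
  shows "r < m" and "\<And>x. w = Some x \<Longrightarrow> x < 3"
  using assms wf_com_pos[of m c] by (cases c; auto simp: sym_of_def split: if_splits)+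

definition index_of :: "com list list \<Rightarrow> com list \<Rightarrow> nat" where
  "index_of xs K = (SOME q. q < length xs \<and> xs ! q = K)"

lemma index_of:
  assumes "K \<in> set xs" shows "index_of xs K < length xs" "xs ! index_of xs K = K"
proof -
  have "\<exists>q. q < length xs \<and> xs ! q = K" using assms by (auto simp: in_set_conv_nth)
  from someI_ex[OF this] show "index_of xs K < length xs" "xs ! index_of xs K = K"
    by (auto simp: index_of_def)
qed

definition mk_action :: "com list list \<Rightarrow> nat list \<Rightarrow>
    com list \<times> nat \<times> nat option \<times> dir \<times> dir \<times> dir \<times> bool option \<Rightarrow> action" where
  "mk_action xs ws D = (case D of (K, r, w, d, pd, cd, em) \<Rightarrow>
     \<lparr>next_state = index_of xs K, prog_dir = pd, cond_dir = cd,
      work_acts = map (\<lambda>i. if i = r then (case w of None \<Rightarrow> ws ! i | Some x \<Rightarrow> x, d)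
                            else (ws ! i, Stay)) [0..<length ws],
      emit = em\<rparr>)"

definition machine :: "nat \<Rightarrow> com list list \<Rightarrow> tm" where
  "machine m xs = \<lparr>num_states = length xs, num_symbols = 3, num_tapes = m,
     trans = (\<lambda>q u v ws. case xs ! q of [] \<Rightarrow> None
        | c # K \<Rightarrow> Some (mk_action xs ws (delta c K u v (\<lambda>i. if i < length ws then ws ! i else 0))))\<rparr>"

definition closed_conts :: "nat \<Rightarrow> com list list \<Rightarrow> bool" where
  "closed_conts m xs \<longleftrightarrow> 0 < m \<and> xs \<noteq> [] \<and> (\<forall>X \<in> set xs. list_all (wf_com m) X) \<and>
     (\<forall>c K u v ws. c # K \<in> set xs \<longrightarrow> fst (delta c K u v ws) \<in> set xs)"

lemma closed_contsD:
  assumes "closed_conts m xs" "c # K \<in> set xs"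
  shows "wf_com m c" "fst (delta c K u v ws) \<in> set xs"
  using assms unfolding closed_conts_def by (fastforce, blast)

lemma turing_machine_machine:
  assumes "closed_conts m xs"
  shows "turing_machine (machine m xs)"
  unfolding turing_machine_def
proof (intro conjI allI impI)
  show "1 \<le> num_states (machine m xs)" "1 \<le> num_symbols (machine m xs)"
    "1 \<le> num_tapes (machine m xs)"
    using assms by (auto simp: machine_def closed_conts_def Suc_le_eq)
  fix q u v ws act
  assume q: "q < num_states (machine m xs)" and ws: "length ws = num_tapes (machine m xs)"
    "set ws \<subseteq> {..<num_symbols (machine m xs)}"
    and act: "trans (machine m xs) q u v ws = Some act"
  from act obtain c K where cK: "xs ! q = c # K"
    and act': "act = mk_action xs ws (delta c K u v (\<lambda>i. if i < length ws then ws ! i else 0))"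
    by (auto simp: machine_def split: list.splits)
  obtain K' r w d pd cd em where D: "delta c K u v (\<lambda>i. if i < length ws then ws ! i else 0) = (K', r, w, d, pd, cd, em)"
    by (cases "delta c K u v (\<lambda>i. if i < length ws then ws ! i else 0)" rule: prod_cases7)
  have act2: "act = mk_action xs ws (K', r, w, d, pd, cd, em)" using act' D by simp
  have mem: "c # K \<in> set xs" using q cK by (auto simp: machine_def in_set_conv_nth)
  have "fst (delta c K u v (\<lambda>i. if i < length ws then ws ! i else 0)) \<in> set xs"
    by (rule closed_contsD(2)[OF assms mem])
  then have "K' \<in> set xs" unfolding D by simp
  then show "next_state act < num_states (machine m xs)"
    using index_of by (simp add: act2 mk_action_def machine_def)
  show "length (work_acts act) = num_tapes (machine m xs)"
    using ws by (simp add: act2 mk_action_def machine_def)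
  have wfc: "wf_com m c" using closed_contsD(1)[OF assms mem] .
  have "ws ! i < 3" if "i < length ws" for i
    using ws(2) that by (auto simp: machine_def dest!: nth_mem)
  then show "\<forall>(w, d) \<in> set (work_acts act). w < num_symbols (machine m xs)"
    using delta_tape(2)[OF wfc D] by (auto simp: act2 mk_action_def machine_def split: option.splits)
qed

text \<open>The stack grows to the right with its top under the head. Cells beyond the head are left
  open: \<open>Pop\<close> leaves old symbols there, and a later \<open>Push\<close> overwrites
  them.\<close>

definition rel :: "nat \<Rightarrow> com list list \<Rightarrow> com list \<Rightarrow> astate \<Rightarrow> config \<Rightarrow> bool" where
  "rel m xs X s cfg = (case s of (f, i, j, z) \<Rightarrow>
     cur_state cfg < length xs \<and> xs ! cur_state cfg = X \<and>
     prog_pos cfg = i \<and> cond_pos cfg = j \<and> out_tape cfg = z \<and>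
     (\<forall>r<m. head cfg r = int (length (f r)) \<and> tape cfg r 0 = 0 \<and>
        (\<forall>l<length (f r). tape cfg r (int (Suc l)) = sym_of (rev (f r) ! l))))"

lemma rel_top:
  assumes "rel m xs X (f, i, j, z) cfg" "r < m"
  shows "read_sym (if r < m then tape cfg r (head cfg r) else 0) = top_of (f r)"
proof (cases "f r")
  case Nil
  then show ?thesis using assms by (simp add: rel_def top_of_def read_sym_def)
next
  case (Cons b bs)
  then have "tape cfg r (int (Suc (length bs))) = sym_of b" "head cfg r = int (Suc (length bs))"
    using assms by (auto simp: rel_def nth_append)
  then show ?thesis using Cons assms(2) by (simp add: top_of_def read_sym_def sym_of_def)
qed

lemma rel_step:
  assumes cl: "closed_conts m xs" and R: "rel m xs (c # K) (f, i, j, z) cfg"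
    and D: "delta c K (input_sym p i) (input_sym y j) (\<lambda>r. if r < m then tape cfg r (head cfg r) else 0) =
      (K', r, w, d, pd, cd, em)"
  shows "step (machine m xs) p y cfg =
    \<lparr>cur_state = index_of xs K', prog_pos = move_input p pd i, cond_pos = move_input y cd j,
     tape = (\<lambda>t. if t = r then (tape cfg r)(head cfg r :=
        (case w of None \<Rightarrow> tape cfg r (head cfg r) | Some x \<Rightarrow> x)) else tape cfg t),
     head = (\<lambda>t. if t = r then move_work d (head cfg r) else head cfg t),
     out_tape = (case em of None \<Rightarrow> z | Some b \<Rightarrow> z @ [b])\<rparr>"
    and "index_of xs K' < length xs" "xs ! index_of xs K' = K'" "r < m"
proof -
  let ?ws = "map (\<lambda>t. tape cfg t (head cfg t)) [0..<m]"
  have eq: "(\<lambda>t. if t < length ?ws then ?ws ! t else 0) = (\<lambda>r. if r < m then tape cfg r (head cfg r) else 0)"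
    by (auto simp: fun_eq_iff)
  have mem: "c # K \<in> set xs" using R by (auto simp: rel_def in_set_conv_nth)
  have "fst (delta c K (input_sym p i) (input_sym y j) (\<lambda>r. if r < m then tape cfg r (head cfg r) else 0)) \<in> set xs"
    by (rule closed_contsD(2)[OF cl mem])
  then have K': "K' \<in> set xs" unfolding D by simp
  show "index_of xs K' < length xs" "xs ! index_of xs K' = K'" using index_of[OF K'] by auto
  have wfc: "wf_com m c" using closed_contsD(1)[OF cl mem] .
  show r: "r < m" using delta_tape(1)[OF wfc D] .
  have R': "xs ! cur_state cfg = c # K" "prog_pos cfg = i" "cond_pos cfg = j" "out_tape cfg = z"
    using R by (auto simp: rel_def)
  have na: "next_action (machine m xs) p y cfg = Some (mk_action xs ?ws (K', r, w, d, pd, cd, em))"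
    by (simp add: next_action_def machine_def R' eq[simplified] D)
  show "step (machine m xs) p y cfg =
    \<lparr>cur_state = index_of xs K', prog_pos = move_input p pd i, cond_pos = move_input y cd j,
     tape = (\<lambda>t. if t = r then (tape cfg r)(head cfg r :=
        (case w of None \<Rightarrow> tape cfg r (head cfg r) | Some x \<Rightarrow> x)) else tape cfg t),
     head = (\<lambda>t. if t = r then move_work d (head cfg r) else head cfg t),
     out_tape = (case em of None \<Rightarrow> z | Some b \<Rightarrow> z @ [b])\<rparr>"
    using r unfolding step_def na option.case perform_def mk_action_def prod.case
    by (auto simp: R'(2-4) machine_def fun_eq_iff split: option.split)
qed

text \<open>The space measure counts every cell visited on the way, so head positions are recorded
  at all intermediate times.\<close>

definition reach :: "tm \<Rightarrow> nat \<Rightarrow> bitstring \<Rightarrow> bitstring \<Rightarrow> config \<Rightarrow> config \<Rightarrow> bool" where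
  "reach M L p y cfg cfg' \<longleftrightarrow> (\<exists>t. (step M p y ^^ t) cfg = cfg' \<and>
     (\<forall>t'\<le>t. \<forall>r<num_tapes M. head ((step M p y ^^ t') cfg) r \<in> {0..int L}))"

lemma reach_trans: "reach M L p y a b \<Longrightarrow> reach M L p y b c \<Longrightarrow> reach M L p y a c"
  unfolding reach_def
proof (elim exE conjE)
  fix t u
  assume t: "(step M p y ^^ t) a = b" "\<forall>t'\<le>t. \<forall>r<num_tapes M. head ((step M p y ^^ t') a) r \<in> {0..int L}"
    and u: "(step M p y ^^ u) b = c" "\<forall>t'\<le>u. \<forall>r<num_tapes M. head ((step M p y ^^ t') b) r \<in> {0..int L}"
  show "\<exists>t. (step M p y ^^ t) a = c \<and> (\<forall>t'\<le>t. \<forall>r<num_tapes M. head ((step M p y ^^ t') a) r \<in> {0..int L})"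
  proof (intro exI[of _ "u + t"] conjI allI impI)
    show "(step M p y ^^ (u + t)) a = c" by (simp add: funpow_add t u)
    fix t' r assume t': "t' \<le> u + t" and r: "r < num_tapes M"
    show "head ((step M p y ^^ t') a) r \<in> {0..int L}"
    proof (cases "t' \<le> t")
      case True then show ?thesis using t(2) r by blast
    next
      case False
      then have "t' = (t' - t) + t" by simp
      then have "(step M p y ^^ t') a = (step M p y ^^ (t' - t)) b"
        by (metis funpow_add comp_apply t(1))
      then show ?thesis using u(2) r t' False by (metis le_diff_conv)
    qed
  qed
qed

lemma reach_step:
  assumes "\<forall>r<num_tapes M. head cfg r \<in> {0..int L}"
    and "\<forall>r<num_tapes M. head (step M p y cfg) r \<in> {0..int L}"
  shows "reach M L p y cfg (step M p y cfg)"
  unfolding reach_def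
  by (rule exI[of _ 1]) (use assms in \<open>auto simp: le_Suc_eq\<close>)

lemma rel_head:
  assumes "rel m xs X (f, i, j, z) cfg" "\<And>r. length (f r) \<le> L"
  shows "\<forall>r<num_tapes (machine m xs). head cfg r \<in> {0..int L}"
  using assms by (auto simp: rel_def machine_def)

lemma exec_lengths:
  "exec L p y c s s' \<Longrightarrow> (\<And>r. length (fst s r) \<le> L) \<Longrightarrow> length (fst s' r) \<le> L"
  by (induction arbitrary: r rule: exec.induct) (auto simp: le_diff_conv intro: le_SucI)


lemma rel_reach:
  assumes R: "rel m xs X (f, i, j, z) cfg" and len: "\<And>r. length (f r) \<le> L"
    and st: "rel m xs X' (f', i', j', z') (step (machine m xs) p y cfg)"
    and len': "\<And>r. length (f' r) \<le> L"
  shows "reach (machine m xs) L p y cfg (step (machine m xs) p y cfg)"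
  by (rule reach_step[OF rel_head[OF R len] rel_head[OF st len']])

lemma rel_plain:
  assumes cl: "closed_conts m xs" and R: "rel m xs (c # K) (f, i, j, z) cfg"
    and len: "\<And>r. length (f r) \<le> L"
    and D: "\<And>ws. ws = (\<lambda>r. if r < m then tape cfg r (head cfg r) else 0) \<Longrightarrow>
      delta c K (input_sym p i) (input_sym y j) ws = (K', 0, None, Stay, pd, cd, em)"
  shows "\<exists>cfg'. reach (machine m xs) L p y cfg cfg' \<and>
     rel m xs K' (f, move_input p pd i, move_input y cd j,
       case em of None \<Rightarrow> z | Some b \<Rightarrow> z @ [b]) cfg'"
proof -
  note S = rel_step[OF cl R D[OF refl]]
  have "rel m xs K' (f, move_input p pd i, move_input y cd j,
       case em of None \<Rightarrow> z | Some b \<Rightarrow> z @ [b]) (step (machine m xs) p y cfg)"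
    using R S(2-4) unfolding S(1) by (auto simp: rel_def)
  from rel_reach[OF R len this len] this show ?thesis by blast
qed

text \<open>Both machine steps are treated together, since between them the head stands on a cell
  with stale contents and the configuration need not represent any stack.\<close>

lemma rel_push:
  assumes cl: "closed_conts m xs" and R: "rel m xs (Push r b # K) (f, i, j, z) cfg"
    and len: "\<And>r. length (f r) \<le> L" and r: "length (f r) < L"
  shows "\<exists>cfg'. reach (machine m xs) L p y cfg cfg' \<and>
     rel m xs K (f(r := b # f r), i, j, z) cfg'"
proof -
  let ?M = "machine m xs"
  define c1 where "c1 = step ?M p y cfg"
  have D: "delta (Push r b) K u v ws = (Write r b # K, r, None, MoveRight, Stay, Stay, None)" for u v ws
    by simp
  note S = rel_step[OF cl R D]
  have rm: "r < m" by (rule S(4))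
  have c1: "c1 = cfg\<lparr>cur_state := index_of xs (Write r b # K), head := (head cfg)(r := head cfg r + 1)\<rparr>"
    unfolding c1_def S(1) using R by (intro config.equality) (auto simp: rel_def fun_eq_iff)
  define c2 where "c2 = step ?M p y c1"
  have R1: "cur_state c1 < length xs" "xs ! cur_state c1 = Write r b # K" using S(2,3) by (auto simp: c1)
  then have mem: "Write r b # K \<in> set xs" by (metis nth_mem)
  have D2: "fst (delta (Write r b) K LeftMarker LeftMarker (\<lambda>_. 0)) \<in> set xs"
    by (rule closed_contsD(2)[OF cl mem])
  then have K: "K \<in> set xs" by simp
  have na: "next_action ?M p y c1 = Some (mk_action xs (map (\<lambda>t. tape c1 t (head c1 t)) [0..<m])
      (K, r, Some (sym_of b), Stay, Stay, Stay, None))"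
    using R1 by (simp add: next_action_def machine_def)
  have c2: "c2 = c1\<lparr>cur_state := index_of xs K, tape := (tape c1)(r := (tape c1 r)(head c1 r := sym_of b))\<rparr>"
    unfolding c2_def step_def na option.case perform_def mk_action_def prod.case
    by (rule config.equality) (auto simp: machine_def rm fun_eq_iff)
  have R2: "rel m xs K (f(r := b # f r), i, j, z) c2"
    using R index_of[OF K] by (auto simp: rel_def c2 c1 nth_append)
  have H1: "\<forall>t<num_tapes ?M. head c1 t \<in> {0..int L}"
    using rel_head[OF R len] R r unfolding c1 by (auto simp: rel_def machine_def)
  have "reach ?M L p y cfg c1"
    unfolding c1_def
  proof (rule reach_step[OF rel_head[OF R len]])
    show "\<forall>t<num_tapes ?M. head (step ?M p y cfg) t \<in> {0..int L}"
      unfolding c1_def[symmetric] by (rule H1)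
  qed
  moreover have "reach ?M L p y c1 c2"
    unfolding c2_def
  proof (rule reach_step)
    show "\<forall>t<num_tapes ?M. head c1 t \<in> {0..int L}" by (rule H1)
    show "\<forall>t<num_tapes ?M. head (step ?M p y c1) t \<in> {0..int L}"
      unfolding c2_def[symmetric] using H1 by (simp add: c2)
  qed
  ultimately show ?thesis using R2 reach_trans by blast
qed

lemma rel_pop:
  assumes cl: "closed_conts m xs" and R: "rel m xs (Pop r # K) (f, i, j, z) cfg"
    and len: "\<And>r. length (f r) \<le> L" and r: "f r \<noteq> []"
  shows "\<exists>cfg'. reach (machine m xs) L p y cfg cfg' \<and>
     rel m xs K (f(r := tl (f r)), i, j, z) cfg'"
proof -
  have D: "delta (Pop r) K u v ws = (K, r, None, MoveLeft, Stay, Stay, None)" for u v ws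
    by simp
  note S = rel_step[OF cl R D]
  obtain b bs where f: "f r = b # bs" using r by (cases "f r") auto
  have "rel m xs K (f(r := tl (f r)), i, j, z) (step (machine m xs) p y cfg)"
    unfolding S(1) using R S(2-4) f by (auto simp: rel_def nth_append)
  moreover have "length ((f(r := tl (f r))) r') \<le> L" for r' using len[of r'] by (auto simp: le_diff_conv)
  ultimately show ?thesis using rel_reach[OF R len] by blast
qed

text \<open>The continuation \<open>K\<close> is arbitrary in the induction, so that the rest of a
  sequence or the next round of a loop can stand behind the current command.\<close>

lemma exec_reach:
  assumes cl: "closed_conts m xs" and wf: "wf_com m c"
  shows "exec L p y c s s' \<Longrightarrow> wf_com m c \<Longrightarrow> rel m xs (c # K) s cfg \<Longrightarrow> (\<And>r. length (fst s r) \<le> L) \<Longrightarrow>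
    \<exists>cfg'. reach (machine m xs) L p y cfg cfg' \<and> rel m xs K s' cfg'"
proof (induction arbitrary: K cfg rule: exec.induct)
  case (Push f r b i j z)
  show ?case using rel_push[OF cl Push.prems(2) _ Push.hyps] Push.prems(3) by simp
next
  case (Pop f r i j z)
  show ?case using rel_pop[OF cl Pop.prems(2) _ Pop.hyps] Pop.prems(3) by simp
next
  case (MoveP d f i j z)
  show ?case using rel_plain[OF cl MoveP.prems(2), of L p y K d Stay None] MoveP.prems(3) by simp
next
  case (MoveC d f i j z)
  show ?case using rel_plain[OF cl MoveC.prems(2), of L p y K Stay d None] MoveC.prems(3) by simp
next
  case (Emit b f i j z)
  show ?case using rel_plain[OF cl Emit.prems(2), of L p y K Stay Stay "Some b"] Emit.prems(3) by simp
next
  case (Seq a s1 s2 b s3)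
  obtain f i j z where s1: "s1 = (f, i, j, z)" by (cases s1)
  obtain c1 where c1: "reach (machine m xs) L p y cfg c1" "rel m xs (a # b # K) s1 c1"
    using rel_plain[OF cl Seq.prems(2)[unfolded s1], of L p y "a # b # K" Stay Stay None] Seq.prems(3)
    by (auto simp: s1)
  obtain c2 where c2: "reach (machine m xs) L p y c1 c2" "rel m xs (b # K) s2 c2"
    using Seq.IH(1)[OF _ c1(2) Seq.prems(3)] Seq.prems(1) by auto
  have "\<And>r. length (fst s2 r) \<le> L" using exec_lengths[OF Seq.hyps(1) Seq.prems(3)] .
  then obtain c3 where c3: "reach (machine m xs) L p y c2 c3" "rel m xs K s3 c3"
    using Seq.IH(2)[OF _ c2(2)] Seq.prems(1) by auto
  show ?case using c1 c2 c3 reach_trans by meson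
next
  case (IfT t i j f r a z s b)
  have "r < m" using IfT.prems(1) by simp
  note top = rel_top[OF IfT.prems(2) this]
  obtain c1 where c1: "reach (machine m xs) L p y cfg c1" "rel m xs (a # K) (f, i, j, z) c1"
    using rel_plain[OF cl IfT.prems(2), of L p y "a # K" Stay Stay None] IfT.prems(3) top IfT.hyps(1) by auto
  show ?case using IfT.IH[OF _ c1(2)] IfT.prems(1,3) c1(1) reach_trans by (meson wf_com.simps(8))
next
  case (IfF t i j f r b z s a)
  have "r < m" using IfF.prems(1) by simp
  note top = rel_top[OF IfF.prems(2) this]
  obtain c1 where c1: "reach (machine m xs) L p y cfg c1" "rel m xs (b # K) (f, i, j, z) c1"
    using rel_plain[OF cl IfF.prems(2), of L p y "b # K" Stay Stay None] IfF.prems(3) top IfF.hyps(1) by auto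
  show ?case using IfF.IH[OF _ c1(2)] IfF.prems(1,3) c1(1) reach_trans by (meson wf_com.simps(8))
next
  case (WhileT t i j f r a z s s')
  have "r < m" using WhileT.prems(1) by simp
  note top = rel_top[OF WhileT.prems(2) this]
  obtain c1 where c1: "reach (machine m xs) L p y cfg c1"
      "rel m xs (a # While r t a # K) (f, i, j, z) c1"
    using rel_plain[OF cl WhileT.prems(2), of L p y "a # While r t a # K" Stay Stay None] WhileT.prems(3)
      top WhileT.hyps(1) by auto
  obtain c2 where c2: "reach (machine m xs) L p y c1 c2" "rel m xs (While r t a # K) s c2"
    using WhileT.IH(1)[OF _ c1(2)] WhileT.prems(1,3) by auto
  have "\<And>r. length (fst s r) \<le> L" using exec_lengths[OF WhileT.hyps(2) WhileT.prems(3)] .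
  then obtain c3 where c3: "reach (machine m xs) L p y c2 c3" "rel m xs K s' c3"
    using WhileT.IH(2)[OF WhileT.prems(1) c2(2)] by auto
  show ?case using c1 c2 c3 reach_trans by meson
next
  case (WhileF t i j f r a z)
  have "r < m" using WhileF.prems(1) by simp
  note top = rel_top[OF WhileF.prems(2) this]
  show ?case
    using rel_plain[OF cl WhileF.prems(2), of L p y K Stay Stay None] WhileF.prems(3) top WhileF.hyps(1) by auto
qed

lemma exists_closed_conts:
  assumes "wf_com m c"
  shows "\<exists>xs. closed_conts m ([c] # xs) \<and> [] \<in> set ([c] # xs)"
proof -
  have "finite (insert [] (conts c []))" by (simp add: finite_conts)
  then obtain xs where xs: "set xs = insert [] (conts c [])" using finite_list by blast
  have eq: "set ([c] # xs) = insert [] (conts c [])" using conts_self[of c "[]"] by (auto simp: xs)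
  have "closed_conts m ([c] # xs)"
    unfolding closed_conts_def eq
    using assms wf_com_pos conts_wf[of _ c "[]" m] conts_delta[of _ _ c "[]"] by auto
  then show ?thesis using eq by blast
qed

text \<open>\<open>[c]\<close> heads the list because machines start in state 0. It may occur again
  further on, which is harmless: \<open>rel\<close> asks only that the current state points to the
  right continuation.\<close>

definition compiled :: "nat \<Rightarrow> com \<Rightarrow> tm" where
  "compiled m c = machine m ([c] # (SOME xs. closed_conts m ([c] # xs) \<and> [] \<in> set ([c] # xs)))"

definition start :: astate where "start = (\<lambda>_. [], 1, 1, [])"

theorem compiled:
  assumes wf: "wf_com m c"
  shows "turing_machine (compiled m c)"
    and "exec L p y c start (f, i, j, x) \<Longrightarrow> computes_in_space (compiled m c) p y x (m * (L + 1))"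
proof -
  define ys where "ys = [c] # (SOME xs. closed_conts m ([c] # xs) \<and> [] \<in> set ([c] # xs))"
  have M: "compiled m c = machine m ys" by (simp add: compiled_def ys_def)
  have ys: "closed_conts m ys" "[] \<in> set ys"
    using someI_ex[OF exists_closed_conts[OF wf]] by (auto simp: ys_def)
  show "turing_machine (compiled m c)" unfolding M by (rule turing_machine_machine[OF ys(1)])
  assume ex: "exec L p y c start (f, i, j, x)"
  have "rel m ys [c] start init_config"
    by (simp add: rel_def start_def init_config_def ys_def)
  from exec_reach[OF ys(1) wf ex wf this] obtain cfg' where
    cfg': "reach (machine m ys) L p y init_config cfg'" "rel m ys [] (f, i, j, x) cfg'"
    by (auto simp: start_def)
  then obtain t where t: "config_at (machine m ys) p y t = cfg'"
    "\<forall>t'\<le>t. \<forall>r<m. head (config_at (machine m ys) p y t') r \<in> {0..int L}"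
    by (auto simp: reach_def config_at_def machine_def)
  have "halted (machine m ys) p y cfg'"
    using cfg'(2) by (simp add: halted_def next_action_def machine_def rel_def)
  moreover have "out_tape cfg' = x" using cfg'(2) by (simp add: rel_def)
  moreover have "card (visited_cells (machine m ys) p y t) \<le> m * (L + 1)"
  proof -
    have "visited_cells (machine m ys) p y t \<subseteq> {..<m} \<times> {0..int L}"
      using t(2) by (auto simp: visited_cells_def machine_def)
    then have "card (visited_cells (machine m ys) p y t) \<le> card ({..<m} \<times> {0..int L})"
      by (intro card_mono) auto
    then show ?thesis by (simp add: card_cartesian_product nat_add_distrib)
  qed
  ultimately show "computes_in_space (compiled m c) p y x (m * (L + 1))"
    unfolding computes_in_space_def M using t(1) by blast
qed

section \<open>Binary counters on stacks\<close>

fun bits :: "nat \<Rightarrow> bool list" where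
  "bits n = (if n = 0 then [] else odd n # bits (n div 2))"

declare bits.simps [simp del]

lemma bits_0 [simp]: "bits 0 = []"
  by (simp add: bits.simps)

lemma bits_eq_Nil [simp]: "bits n = [] \<longleftrightarrow> n = 0"
  by (subst bits.simps) auto

lemma bits_even: "0 < n \<Longrightarrow> bits (2 * n) = False # bits n"
  by (subst bits.simps) auto

lemma bits_odd: "bits (Suc (2 * n)) = True # bits n"
  by (subst bits.simps) auto

lemma tl_bits: "tl (bits n) = bits (n div 2)"
  by (subst bits.simps) auto

lemma length_bits: "n < 2 ^ L \<Longrightarrow> length (bits n) \<le> L"
proof (induction L arbitrary: n)
  case (Suc L)
  then have "length (bits (n div 2)) \<le> L" by auto
  then show ?case by (subst bits.simps) auto
qed auto

text \<open>Carry propagation, least significant bit first: a maximal block of ones, then a rest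
  that is empty or starts with a zero. As the top digit is never zero, such a zero is followed by
  further bits (\<open>vs \<noteq> []\<close>); this tells the decrement whether to put the zero
  back.\<close>

lemma bits_Suc:
  "\<exists>t us. bits n = replicate t True @ us \<and> (us = [] \<or> (\<exists>vs. us = False # vs \<and> vs \<noteq> [])) \<and>
     bits (Suc n) = replicate t False @ True # tl us"
proof (induction n rule: less_induct)
  case (less n)
  show ?case
  proof (cases "even n")
    case True
    then obtain m where m: "n = 2 * m" by blast
    show ?thesis
    proof (cases "m = 0")
      case True
      then show ?thesis using bits_odd[of 0] by (intro exI[of _ 0] exI[of _ "[]"]) (simp add: m)
    next
      case False
      then show ?thesis using bits_odd[of m] bits_even[of m]
        by (intro exI[of _ 0] exI[of _ "False # bits m"]) (simp add: m)
    qed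
  next
    case False
    then obtain m where m: "n = Suc (2 * m)" by (metis oddE Suc_eq_plus1)
    obtain t us where t: "bits m = replicate t True @ us"
      "us = [] \<or> (\<exists>vs. us = False # vs \<and> vs \<noteq> [])"
      "bits (Suc m) = replicate t False @ True # tl us" using less.IH[of m] m by auto
    have "bits (Suc n) = False # bits (Suc m)" using bits_even[of "Suc m"] by (simp add: m)
    then show ?thesis using t bits_odd[of m]
      by (intro exI[of _ "Suc t"] exI[of _ us]) (simp add: m)
  qed
qed

definition Skip :: com where "Skip = MoveP Stay"

lemma exec_Skip: "exec L p y Skip s s"
  by (cases s) (metis Skip_def exec.MoveP move_input.simps(2))

definition nonempty :: test where "nonempty u v x \<longleftrightarrow> x \<noteq> None"

abbreviation top_eq :: "bool \<Rightarrow> test" where "top_eq b \<equiv> (\<lambda>u v x. x = Some b)"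

lemma top_of_Cons [simp]: "top_of (x # xs) = Some x" and top_of_Nil [simp]: "top_of [] = None"
  by (simp_all add: top_of_def)

lemma top_of_eq_None [simp]: "top_of xs = None \<longleftrightarrow> xs = []"
  by (simp add: top_of_def)

lemma nonempty_top_of [simp]: "nonempty u v (top_of xs) \<longleftrightarrow> xs \<noteq> []"
  by (simp add: nonempty_def top_of_def)

lemma nonempty_simps [simp]: "\<not> nonempty u v None" "nonempty u v (Some b)"
  by (simp_all add: nonempty_def)

lemma exec_push: "s' = (f(r := b # f r), i, j, z) \<Longrightarrow> length (f r) < L \<Longrightarrow> exec L p y (Push r b) (f, i, j, z) s'"
  using exec.Push by simp

lemma exec_pop: "f r = b # bs \<Longrightarrow> s' = (f(r := bs), i, j, z) \<Longrightarrow> exec L p y (Pop r) (f, i, j, z) s'"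
  using exec.Pop[of f r] by simp

text \<open>Stack 0 counts the removed block in unary; \<open>exec_fill\<close> later puts back a
  block of the same length with the bits flipped.\<close>

lemma exec_strip:
  assumes "r \<noteq> 0" "us = [] \<or> hd us \<noteq> b"
  shows "f r = replicate t b @ us \<Longrightarrow> length (f 0) + t \<le> L \<Longrightarrow>
    exec L p y (While r (top_eq b) (Seq (Pop r) (Push 0 True))) (f, i, j, z)
      (f(r := us, 0 := replicate t True @ f 0), i, j, z)"
proof (induction t arbitrary: f)
  case 0
  then have eq: "(f(r := us, 0 := replicate 0 True @ f 0)) = f" by auto
  show ?case unfolding eq by (rule exec.WhileF) (use assms 0 in \<open>cases us; auto\<close>)
next
  case (Suc t)
  let ?f = "f(r := replicate t b @ us, 0 := True # f 0)"
  have A: "exec L p y (Seq (Pop r) (Push 0 True)) (f, i, j, z) (?f, i, j, z)"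
    by (rule exec.Seq[OF exec_pop[OF _ refl] exec_push]) (use Suc.prems assms in auto)
  have B: "exec L p y (While r (top_eq b) (Seq (Pop r) (Push 0 True))) (?f, i, j, z)
      (?f(r := us, 0 := replicate t True @ ?f 0), i, j, z)"
    by (rule Suc.IH) (use Suc.prems assms in auto)
  have eq: "?f(r := us, 0 := replicate t True @ ?f 0) = f(r := us, 0 := replicate (Suc t) True @ f 0)"
    using assms by (auto simp: fun_eq_iff replicate_app_Cons_same)
  show ?case by (rule exec.WhileT[OF _ A B[unfolded eq]]) (use Suc.prems in simp)
qed

lemma exec_fill:
  assumes "r \<noteq> 0"
  shows "f 0 = replicate t True \<Longrightarrow> length (f r) + t \<le> L \<Longrightarrow>
    exec L p y (While 0 nonempty (Seq (Pop 0) (Push r b))) (f, i, j, z)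
      (f(0 := [], r := replicate t b @ f r), i, j, z)"
proof (induction t arbitrary: f)
  case 0
  then have eq: "(f(0 := [], r := replicate 0 b @ f r)) = f" by auto
  show ?case unfolding eq by (rule exec.WhileF) (use 0 in auto)
next
  case (Suc t)
  let ?f = "f(0 := replicate t True, r := b # f r)"
  have A: "exec L p y (Seq (Pop 0) (Push r b)) (f, i, j, z) (?f, i, j, z)"
    by (rule exec.Seq[OF exec_pop[OF _ refl] exec_push]) (use Suc.prems assms in auto)
  have B: "exec L p y (While 0 nonempty (Seq (Pop 0) (Push r b))) (?f, i, j, z)
      (?f(0 := [], r := replicate t b @ ?f r), i, j, z)"
    by (rule Suc.IH) (use Suc.prems assms in auto)
  have eq: "?f(0 := [], r := replicate t b @ ?f r) = f(0 := [], r := replicate (Suc t) b @ f r)"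
    using assms by (auto simp: fun_eq_iff replicate_app_Cons_same)
  show ?case by (rule exec.WhileT[OF _ A B[unfolded eq]]) (use Suc.prems in simp)
qed

definition Inc :: "nat \<Rightarrow> com" where
  "Inc r = Seq (While r (top_eq True) (Seq (Pop r) (Push 0 True)))
     (Seq (Branch r nonempty (Seq (Pop r) (Push r True)) (Push r True))
       (While 0 nonempty (Seq (Pop 0) (Push r False))))"

definition Dec :: "nat \<Rightarrow> com" where
  "Dec r = Seq (While r (top_eq False) (Seq (Pop r) (Push 0 True)))
     (Seq (Pop r)
       (Seq (Branch r nonempty (Push r False) Skip)
         (While 0 nonempty (Seq (Pop 0) (Push r True)))))"

lemma exec_Inc:
  assumes r: "r \<noteq> 0" and f: "f 0 = []" "f r = bits n" and L: "length (bits (Suc n)) \<le> L"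
  shows "exec L p y (Inc r) (f, i, j, z) (f(r := bits (Suc n)), i, j, z)"
proof -
  obtain t us where t: "bits n = replicate t True @ us"
    "us = [] \<or> (\<exists>vs. us = False # vs \<and> vs \<noteq> [])"
    "bits (Suc n) = replicate t False @ True # tl us" using bits_Suc by blast
  let ?f1 = "f(r := us, 0 := replicate t True)"
  let ?f2 = "f(r := True # tl us, 0 := replicate t True)"
  have 1: "exec L p y (While r (top_eq True) (Seq (Pop r) (Push 0 True))) (f, i, j, z) (?f1, i, j, z)"
    using exec_strip[of r us True f t L p y i j z] r f t L by auto
  have 2: "exec L p y (Branch r nonempty (Seq (Pop r) (Push r True)) (Push r True)) (?f1, i, j, z) (?f2, i, j, z)"
  proof (cases us)
    case Nil
    show ?thesis
      by (rule exec.IfF) (use Nil r t L in \<open>auto intro!: exec_push simp: fun_eq_iff\<close>)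
  next
    case (Cons u vs)
    show ?thesis
      by (rule exec.IfT, use Cons r in simp, rule exec.Seq[OF exec_pop[OF _ refl] exec_push])
        (use Cons r t L in \<open>auto simp: fun_eq_iff\<close>)
  qed
  have 3: "exec L p y (While 0 nonempty (Seq (Pop 0) (Push r False))) (?f2, i, j, z) (?f2(0 := [], r := replicate t False @ ?f2 r), i, j, z)"
    by (rule exec_fill) (use r t L in auto)
  have eq: "?f2(0 := [], r := replicate t False @ ?f2 r) = f(r := bits (Suc n))"
    using r f t by (auto simp: fun_eq_iff)
  show ?thesis unfolding Inc_def using exec.Seq[OF 1 exec.Seq[OF 2 3]] unfolding eq .
qed

lemma exec_Dec:
  assumes r: "r \<noteq> 0" and f: "f 0 = []" "f r = bits (Suc n)" and L: "length (bits (Suc n)) \<le> L"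
  shows "exec L p y (Dec r) (f, i, j, z) (f(r := bits n), i, j, z)"
proof -
  obtain t us where t: "bits n = replicate t True @ us"
    "us = [] \<or> (\<exists>vs. us = False # vs \<and> vs \<noteq> [])"
    "bits (Suc n) = replicate t False @ True # tl us" using bits_Suc by blast
  let ?f1 = "f(r := True # tl us, 0 := replicate t True)"
  let ?f2 = "f(r := tl us, 0 := replicate t True)"
  let ?f3 = "f(r := us, 0 := replicate t True)"
  have 1: "exec L p y (While r (top_eq False) (Seq (Pop r) (Push 0 True))) (f, i, j, z) (?f1, i, j, z)"
    using exec_strip[of r "True # tl us" False f t L p y i j z] r f t L by auto
  have 2: "exec L p y (Pop r) (?f1, i, j, z) (?f2, i, j, z)"
    by (rule exec_pop) (use r in \<open>auto simp: fun_eq_iff\<close>)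
  \<comment> \<open>If more significant bits remain, the removed one becomes a zero; otherwise the
    number gets one digit shorter.\<close>
  have 3: "exec L p y (Branch r nonempty (Push r False) Skip) (?f2, i, j, z) (?f3, i, j, z)"
  proof (cases us)
    case Nil
    have eq: "?f2 = ?f3" using Nil by simp
    show ?thesis unfolding eq by (rule exec.IfF[OF _ exec_Skip]) (use Nil r in simp)
  next
    case (Cons u vs)
    show ?thesis
      by (rule exec.IfT) (use Cons r t L in \<open>auto intro!: exec_push simp: fun_eq_iff\<close>)
  qed
  have 4: "exec L p y (While 0 nonempty (Seq (Pop 0) (Push r True))) (?f3, i, j, z) (?f3(0 := [], r := replicate t True @ ?f3 r), i, j, z)"
    by (rule exec_fill) (use r t L in \<open>auto simp: le_diff_conv\<close>)
  have eq: "?f3(0 := [], r := replicate t True @ ?f3 r) = f(r := bits n)"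
    using r f t by (auto simp: fun_eq_iff)
  show ?thesis unfolding Dec_def using exec.Seq[OF 1 exec.Seq[OF 2 exec.Seq[OF 3 4]]] unfolding eq .
qed

section \<open>Register programs\<close>

text \<open>Numbers replace stacks from here on. The quantifiers over inputs, head positions and
  output say that register programs depend on none of these and leave them alone.\<close>

definition runs :: "nat \<Rightarrow> com \<Rightarrow> (nat \<Rightarrow> nat) \<Rightarrow> (nat \<Rightarrow> nat) \<Rightarrow> bool" where
  "runs L c \<rho> \<rho>' \<longleftrightarrow> (\<forall>p y i j z. exec L p y c (bits \<circ> \<rho>, i, j, z) (bits \<circ> \<rho>', i, j, z))"

lemma runs_Skip: "runs L Skip \<rho> \<rho>"
  by (simp add: runs_def exec_Skip)

lemma runs_Seq: "runs L a \<rho> \<rho>' \<Longrightarrow> runs L b \<rho>' \<rho>'' \<Longrightarrow> runs L (Seq a b) \<rho> \<rho>''"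
  unfolding runs_def using exec.Seq by blast

lemma runs_IfT: "\<rho> r \<noteq> 0 \<Longrightarrow> runs L a \<rho> \<rho>' \<Longrightarrow> runs L (Branch r nonempty a b) \<rho> \<rho>'"
  unfolding runs_def by (auto intro!: exec.IfT)

lemma runs_IfF: "\<rho> r = 0 \<Longrightarrow> runs L b \<rho> \<rho>' \<Longrightarrow> runs L (Branch r nonempty a b) \<rho> \<rho>'"
  unfolding runs_def by (auto intro!: exec.IfF)

lemma runs_WhileT: "\<rho> r \<noteq> 0 \<Longrightarrow> runs L a \<rho> \<rho>' \<Longrightarrow> runs L (While r nonempty a) \<rho>' \<rho>'' \<Longrightarrow>
    runs L (While r nonempty a) \<rho> \<rho>''"
  unfolding runs_def
proof (intro allI)
  fix p y i j z
  assume "\<rho> r \<noteq> 0" and A: "\<forall>p y i j z. exec L p y a (bits \<circ> \<rho>, i, j, z) (bits \<circ> \<rho>', i, j, z)"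
    "\<forall>p y i j z. exec L p y (While r nonempty a) (bits \<circ> \<rho>', i, j, z) (bits \<circ> \<rho>'', i, j, z)"
  show "exec L p y (While r nonempty a) (bits \<circ> \<rho>, i, j, z) (bits \<circ> \<rho>'', i, j, z)"
    by (rule exec.WhileT[OF _ A(1)[rule_format] A(2)[rule_format]]) (use \<open>\<rho> r \<noteq> 0\<close> in simp)
qed

lemma runs_WhileF: "\<rho> r = 0 \<Longrightarrow> runs L (While r nonempty a) \<rho> \<rho>"
  unfolding runs_def by (auto intro!: exec.WhileF)

lemma runs_Inc:
  assumes "r \<noteq> 0" "\<rho> 0 = 0" "Suc (\<rho> r) < 2 ^ L"
  shows "runs L (Inc r) \<rho> (\<rho>(r := Suc (\<rho> r)))"
  unfolding runs_def
proof (intro allI)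
  fix p y i j z
  show "exec L p y (Inc r) (bits \<circ> \<rho>, i, j, z) (bits \<circ> \<rho>(r := Suc (\<rho> r)), i, j, z)"
    using exec_Inc[of r "bits \<circ> \<rho>" "\<rho> r"] length_bits[OF assms(3)] assms by (simp add: fun_upd_comp)
qed

lemma runs_Dec:
  assumes "r \<noteq> 0" "\<rho> 0 = 0" "\<rho> r = Suc n" "Suc n < 2 ^ L"
  shows "runs L (Dec r) \<rho> (\<rho>(r := n))"
  unfolding runs_def
proof (intro allI)
  fix p y i j z
  show "exec L p y (Dec r) (bits \<circ> \<rho>, i, j, z) (bits \<circ> \<rho>(r := n), i, j, z)"
    using exec_Dec[of r "bits \<circ> \<rho>" n] length_bits[OF assms(4)] assms by (simp add: fun_upd_comp)
qed

definition Clear :: "nat \<Rightarrow> com" where "Clear r = While r nonempty (Pop r)"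

lemma runs_Clear: "runs L (Clear r) \<rho> (\<rho>(r := 0))"
proof (induction "\<rho> r" arbitrary: \<rho> rule: less_induct)
  case less
  show ?case
  proof (cases "\<rho> r = 0")
    case True
    then have eq: "\<rho>(r := 0) = \<rho>" by auto
    show ?thesis unfolding eq Clear_def by (rule runs_WhileF) (rule True)
  next
    case False
    have "runs L (Pop r) \<rho> (\<rho>(r := \<rho> r div 2))"
      using False unfolding runs_def
      by (auto simp: fun_upd_comp tl_bits intro!: exec.Pop[of "bits \<circ> \<rho>" r, simplified, unfolded tl_bits])
    moreover have "runs L (Clear r) (\<rho>(r := \<rho> r div 2)) (\<rho>(r := 0))"
      using less[of "\<rho>(r := \<rho> r div 2)"] False by simp
    ultimately show ?thesis unfolding Clear_def using runs_WhileT[of \<rho> r, OF False] by blast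
  qed
qed

definition Move :: "nat \<Rightarrow> nat \<Rightarrow> com" where
  "Move r s = While r nonempty (Seq (Dec r) (Inc s))"

lemma runs_Move:
  assumes "r \<noteq> 0" "s \<noteq> 0" "r \<noteq> s"
  shows "\<rho> 0 = 0 \<Longrightarrow> \<rho> s + \<rho> r < 2 ^ L \<Longrightarrow> runs L (Move r s) \<rho> (\<rho>(r := 0, s := \<rho> s + \<rho> r))"
proof (induction "\<rho> r" arbitrary: \<rho>)
  case 0
  then have eq: "\<rho>(r := 0, s := \<rho> s + \<rho> r) = \<rho>" by auto
  show ?case unfolding eq Move_def by (rule runs_WhileF) (use 0 in simp)
next
  case (Suc n)
  have "runs L (Dec r) \<rho> (\<rho>(r := n))" using runs_Dec[of r \<rho> n L] Suc assms by simp
  moreover have "runs L (Inc s) (\<rho>(r := n)) (\<rho>(r := n, s := Suc (\<rho> s)))"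
    using runs_Inc[of s "\<rho>(r := n)" L] Suc assms by simp
  ultimately have 1: "runs L (Seq (Dec r) (Inc s)) \<rho> (\<rho>(r := n, s := Suc (\<rho> s)))"
    by (rule runs_Seq)
  let ?\<rho> = "\<rho>(r := n, s := Suc (\<rho> s))"
  have 2: "runs L (Move r s) ?\<rho> (?\<rho>(r := 0, s := ?\<rho> s + ?\<rho> r))"
    by (rule Suc.hyps(1)) (use Suc assms in auto)
  have eq: "?\<rho>(r := 0, s := ?\<rho> s + ?\<rho> r) = \<rho>(r := 0, s := \<rho> s + \<rho> r)"
    using Suc.hyps(2) assms by (auto simp: fun_eq_iff)
  show ?case using runs_WhileT[of \<rho> r, OF _ 1] 2 Suc.hyps(2) unfolding eq Move_def by simp
qed

definition Copy :: "nat \<Rightarrow> nat \<Rightarrow> nat \<Rightarrow> com" where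
  "Copy r s t = Seq (While r nonempty (Seq (Dec r) (Seq (Inc s) (Inc t)))) (Move t r)"

lemma runs_Copy:
  assumes "r \<noteq> 0" "s \<noteq> 0" "t \<noteq> 0" "r \<noteq> s" "r \<noteq> t" "s \<noteq> t"
    and "\<rho> 0 = 0" "\<rho> s = 0" "\<rho> t = 0" "\<rho> r < 2 ^ L"
  shows "runs L (Copy r s t) \<rho> (\<rho>(s := \<rho> r))"
proof -
  let ?W = "While r nonempty (Seq (Dec r) (Seq (Inc s) (Inc t)))"
  have "\<sigma> 0 = 0 \<Longrightarrow> \<sigma> s + \<sigma> r < 2 ^ L \<Longrightarrow> \<sigma> t + \<sigma> r < 2 ^ L \<Longrightarrow>
     runs L ?W \<sigma> (\<sigma>(r := 0, s := \<sigma> s + \<sigma> r, t := \<sigma> t + \<sigma> r))" for \<sigma>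
  proof (induction "\<sigma> r" arbitrary: \<sigma>)
    case 0
    then have eq: "\<sigma>(r := 0, s := \<sigma> s + \<sigma> r, t := \<sigma> t + \<sigma> r) = \<sigma>" by auto
    show ?case unfolding eq by (rule runs_WhileF) (use 0 in simp)
  next
    case (Suc n)
    let ?\<sigma> = "\<sigma>(r := n, s := Suc (\<sigma> s), t := Suc (\<sigma> t))"
    have "runs L (Dec r) \<sigma> (\<sigma>(r := n))" using runs_Dec[of r \<sigma> n L] Suc assms by simp
    moreover have "runs L (Inc s) (\<sigma>(r := n)) (\<sigma>(r := n, s := Suc (\<sigma> s)))"
      using runs_Inc[of s "\<sigma>(r := n)" L] Suc assms by simp
    moreover have "runs L (Inc t) (\<sigma>(r := n, s := Suc (\<sigma> s))) ?\<sigma>"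
      using runs_Inc[of t "\<sigma>(r := n, s := Suc (\<sigma> s))" L] Suc assms by simp
    ultimately have 1: "runs L (Seq (Dec r) (Seq (Inc s) (Inc t))) \<sigma> ?\<sigma>"
      by (meson runs_Seq)
    have 2: "runs L ?W ?\<sigma> (?\<sigma>(r := 0, s := ?\<sigma> s + ?\<sigma> r, t := ?\<sigma> t + ?\<sigma> r))"
      by (rule Suc.hyps(1)) (use Suc assms in auto)
    have eq: "?\<sigma>(r := 0, s := ?\<sigma> s + ?\<sigma> r, t := ?\<sigma> t + ?\<sigma> r) = \<sigma>(r := 0, s := \<sigma> s + \<sigma> r, t := \<sigma> t + \<sigma> r)"
      using Suc.hyps(2) assms by (auto simp: fun_eq_iff)
    show ?case using runs_WhileT[of \<sigma> r, OF _ 1] 2 Suc.hyps(2) unfolding eq by simp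
  qed
  from this[of \<rho>] have 1: "runs L ?W \<rho> (\<rho>(r := 0, s := \<rho> r, t := \<rho> r))" (is "runs L _ _ ?\<rho>")
    using assms by simp
  have 2: "runs L (Move t r) ?\<rho> (?\<rho>(t := 0, r := ?\<rho> r + ?\<rho> t))"
    by (rule runs_Move) (use assms in auto)
  have eq: "?\<rho>(t := 0, r := ?\<rho> r + ?\<rho> t) = \<rho>(s := \<rho> r)" using assms by (auto simp: fun_eq_iff)
  show ?thesis using runs_Seq[OF 1 2] unfolding eq Copy_def .
qed

section \<open>Expressions\<close>

text \<open>
  Variables are de Bruijn indices.  \<open>For e b s\<close> iterates \<open>s\<close> with the loop counter running
  downwards; the accumulator is variable 0 and the counter is variable 1 of \<open>s\<close>.
\<close>

datatype ex = Var nat | Zero | Succ ex | Pred ex | Cond ex ex ex | LetIn ex ex | For ex ex ex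

text \<open>Missing arguments count as 0. Every expression thus denotes a total function on
  environments of any length, and closure properties need no arities.\<close>

definition nth0 :: "nat list \<Rightarrow> nat \<Rightarrow> nat" (infixl "$" 100) where
  "xs $ i = (if i < length xs then xs ! i else 0)"

fun loop :: "(nat \<Rightarrow> nat \<Rightarrow> nat) \<Rightarrow> nat \<Rightarrow> nat \<Rightarrow> nat" where
  "loop f 0 a = a"
| "loop f (Suc n) a = loop f n (f n a)"

fun okloop :: "(nat \<Rightarrow> nat \<Rightarrow> bool) \<Rightarrow> (nat \<Rightarrow> nat \<Rightarrow> nat) \<Rightarrow> nat \<Rightarrow> nat \<Rightarrow> bool" where
  "okloop P f 0 a \<longleftrightarrow> True"
| "okloop P f (Suc n) a \<longleftrightarrow> P n a \<and> okloop P f n (f n a)"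

fun eval :: "ex \<Rightarrow> nat list \<Rightarrow> nat" where
  "eval (Var i) env = env $ i"
| "eval Zero env = 0"
| "eval (Succ e) env = Suc (eval e env)"
| "eval (Pred e) env = eval e env - 1"
| "eval (Cond e a b) env = (if eval e env \<noteq> 0 then eval a env else eval b env)"
| "eval (LetIn e b) env = eval b (eval e env # env)"
| "eval (For e b s) env =
     loop (\<lambda>r acc. eval s (acc # r # env)) (eval e env) (eval b (eval e env # env))"

text \<open>\<open>ok B e env\<close>: if the entries of \<open>env\<close> are at most \<open>B\<close>, then so are all values arising in the
  evaluation of \<open>e\<close>.\<close>

fun ok :: "nat \<Rightarrow> ex \<Rightarrow> nat list \<Rightarrow> bool" where
  "ok B (Var i) env \<longleftrightarrow> True"
| "ok B Zero env \<longleftrightarrow> True"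
| "ok B (Succ e) env \<longleftrightarrow> ok B e env \<and> eval e env < B"
| "ok B (Pred e) env \<longleftrightarrow> ok B e env"
| "ok B (Cond e a b) env \<longleftrightarrow> ok B e env \<and> (if eval e env \<noteq> 0 then ok B a env else ok B b env)"
| "ok B (LetIn e b) env \<longleftrightarrow> ok B e env \<and> ok B b (eval e env # env)"
| "ok B (For e b s) env \<longleftrightarrow> ok B e env \<and> ok B b (eval e env # env) \<and>
     okloop (\<lambda>r acc. ok B s (acc # r # env)) (\<lambda>r acc. eval s (acc # r # env))
       (eval e env) (eval b (eval e env # env))"

lemma nth0_le: "(\<And>v. v \<in> set env \<Longrightarrow> v \<le> B) \<Longrightarrow> env $ i \<le> B"
  by (simp add: nth0_def)

lemma ok_le: "ok B e env \<Longrightarrow> (\<And>v. v \<in> set env \<Longrightarrow> v \<le> B) \<Longrightarrow> eval e env \<le> B"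
proof (induction e arbitrary: env)
  case (Var i)
  then show ?case by (simp add: nth0_le)
next
  case (Pred e)
  then show ?case by (metis eval.simps(4) ok.simps(4) diff_le_self le_trans)
next
  case (Cond e a b)
  then show ?case by (auto split: if_splits)
next
  case (LetIn e b)
  show ?case using LetIn.prems LetIn.IH(1)[of env] LetIn.IH(2)[of "eval e env # env"] by auto
next
  case (For e b s)
  have n: "eval e env \<le> B" using For by auto
  have "m \<le> B \<Longrightarrow> a \<le> B \<Longrightarrow> okloop (\<lambda>r acc. ok B s (acc # r # env)) (\<lambda>r acc. eval s (acc # r # env)) m a \<Longrightarrow>
    loop (\<lambda>r acc. eval s (acc # r # env)) m a \<le> B" for m a
  proof (induction m arbitrary: a)
    case (Suc m)
    have "eval s (a # m # env) \<le> B" by (rule For.IH(3)) (use Suc.prems For.prems in auto)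
    then show ?case using Suc by simp
  qed simp
  moreover have "eval b (eval e env # env) \<le> B" using For.prems For.IH(2)[of "eval e env # env"] n by auto
  ultimately show ?case using For.prems n by simp
qed auto

text \<open>At depth \<open>d\<close> the environment occupies registers 1 to \<open>d\<close>, with
  variable \<open>i\<close> in register \<open>d - i\<close>; the result goes to
  \<open>Suc d\<close>, and everything above that is zero before and after. The bound of a loop
  already occupies \<open>Suc d\<close> when the initial value is computed, which is why that
  expression sees it as variable 0 in \<open>eval\<close>.\<close>

fun compile_ex :: "ex \<Rightarrow> nat \<Rightarrow> com" where
  "compile_ex (Var i) d = (if i < d then Copy (d - i) (Suc d) (Suc (Suc d)) else Skip)"
| "compile_ex Zero d = Skip"
| "compile_ex (Succ e) d = Seq (compile_ex e d) (Inc (Suc d))"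
| "compile_ex (Pred e) d = Seq (compile_ex e d) (Branch (Suc d) nonempty (Dec (Suc d)) Skip)"
| "compile_ex (Cond e a b) d = Seq (compile_ex e d)
     (Branch (Suc d) nonempty (Seq (Clear (Suc d)) (compile_ex a d)) (compile_ex b d))"
| "compile_ex (LetIn e b) d = Seq (compile_ex e d) (Seq (compile_ex b (Suc d))
     (Seq (Clear (Suc d)) (Move (Suc (Suc d)) (Suc d))))"
| "compile_ex (For e b s) d = Seq (compile_ex e d) (Seq (compile_ex b (Suc d)) (Seq
     (While (Suc d) nonempty (Seq (Dec (Suc d)) (Seq (compile_ex s (Suc (Suc d)))
        (Seq (Clear (Suc (Suc d))) (Move (Suc (Suc (Suc d))) (Suc (Suc d)))))))
     (Move (Suc (Suc d)) (Suc d))))"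

fun env_of :: "(nat \<Rightarrow> nat) \<Rightarrow> nat \<Rightarrow> nat list" where
  "env_of \<rho> 0 = []"
| "env_of \<rho> (Suc d) = \<rho> (Suc d) # env_of \<rho> d"

lemma env_of_upd [simp]: "d < r \<Longrightarrow> env_of (\<rho>(r := v)) d = env_of \<rho> d"
  by (induction d) auto

lemma env_of_if [simp]: "d < r \<Longrightarrow> env_of (\<lambda>a. if a = r then v else \<rho> a) d = env_of \<rho> d"
  by (induction d) auto

lemma length_env_of [simp]: "length (env_of \<rho> d) = d"
  by (induction d) auto

lemma nth_env_of: "i < d \<Longrightarrow> env_of \<rho> d ! i = \<rho> (d - i)"
  by (induction d arbitrary: i) (auto simp: nth_Cons split: nat.split)

lemma set_env_of_le: "(\<And>r. \<rho> r \<le> B) \<Longrightarrow> v \<in> set (env_of \<rho> d) \<Longrightarrow> v \<le> B"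
  by (induction d) auto

text \<open>The link between values and space: numbers up to \<open>B\<close> fit on stacks of
  height \<open>L\<close> as soon as \<open>B < 2 ^ L\<close>, whatever the number of steps.\<close>

lemma runs_comp:
  assumes B: "B < 2 ^ L"
  shows "\<rho> 0 = 0 \<Longrightarrow> (\<And>r. r > d \<Longrightarrow> \<rho> r = 0) \<Longrightarrow> (\<And>r. \<rho> r \<le> B) \<Longrightarrow> ok B e (env_of \<rho> d) \<Longrightarrow>
    runs L (compile_ex e d) \<rho> (\<rho>(Suc d := eval e (env_of \<rho> d)))"
proof (induction e arbitrary: \<rho> d)
  case (Var i)
  show ?case
  proof (cases "i < d")
    case True
    have "d - i \<noteq> Suc d" "d - i \<noteq> Suc (Suc d)" by linarith+
    moreover have "\<rho> (d - i) < 2 ^ L" using Var.prems(3)[of "d - i"] B by simp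
    ultimately have R: "runs L (Copy (d - i) (Suc d) (Suc (Suc d))) \<rho> (\<rho>(Suc d := \<rho> (d - i)))"
      by (intro runs_Copy) (use True Var.prems(1,2) in auto)
    have "eval (Var i) (env_of \<rho> d) = \<rho> (d - i)" using True by (simp add: nth0_def nth_env_of)
    moreover have "compile_ex (Var i) d = Copy (d - i) (Suc d) (Suc (Suc d))" using True by simp
    ultimately show ?thesis using R by (simp only:)
  next
    case False
    have "\<rho>(Suc d := 0) = \<rho>" using Var.prems(2)[of "Suc d"] by auto
    then show ?thesis using False runs_Skip by (simp add: nth0_def)
  qed
next
  case Zero
  have "\<rho>(Suc d := 0) = \<rho>" using Zero.prems(2)[of "Suc d"] by auto
  then show ?case using runs_Skip by simp
next
  case (Succ e)
  let ?v = "eval e (env_of \<rho> d)"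
  have 1: "runs L (compile_ex e d) \<rho> (\<rho>(Suc d := ?v))" by (rule Succ.IH) (use Succ.prems in auto)
  have 2: "runs L (Inc (Suc d)) (\<rho>(Suc d := ?v)) (\<rho>(Suc d := Suc ?v))"
    using runs_Inc[of "Suc d" "\<rho>(Suc d := ?v)" L] Succ.prems B by simp
  show ?case unfolding compile_ex.simps eval.simps by (rule runs_Seq[OF 1 2])
next
  case (Pred e)
  let ?v = "eval e (env_of \<rho> d)"
  have 1: "runs L (compile_ex e d) \<rho> (\<rho>(Suc d := ?v))" by (rule Pred.IH) (use Pred.prems in auto)
  have v: "?v \<le> B" using ok_le[of B e] set_env_of_le[OF Pred.prems(3)] Pred.prems(4) by simp
  have 2: "runs L (Branch (Suc d) nonempty (Dec (Suc d)) Skip) (\<rho>(Suc d := ?v)) (\<rho>(Suc d := ?v - 1))"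
  proof (cases ?v)
    case 0
    then show ?thesis using runs_Skip by (intro runs_IfF) auto
  next
    case (Suc n)
    then show ?thesis using runs_Dec[of "Suc d" "\<rho>(Suc d := ?v)" n L] v B Pred.prems(1)
      by (intro runs_IfT) auto
  qed
  show ?case unfolding compile_ex.simps eval.simps by (rule runs_Seq[OF 1 2])
next
  case (Cond e a b)
  let ?v = "eval e (env_of \<rho> d)"
  have 1: "runs L (compile_ex e d) \<rho> (\<rho>(Suc d := ?v))" by (rule Cond.IH(1)) (use Cond.prems in auto)
  have z: "\<rho>(Suc d := 0) = \<rho>" "\<rho> (Suc d) = 0" using Cond.prems(2)[of "Suc d"] by auto
  have 2: "runs L (Branch (Suc d) nonempty (Seq (Clear (Suc d)) (compile_ex a d)) (compile_ex b d)) (\<rho>(Suc d := ?v))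
     (\<rho>(Suc d := eval (Cond e a b) (env_of \<rho> d)))"
  proof (cases "?v = 0")
    case True
    have "runs L (compile_ex b d) \<rho> (\<rho>(Suc d := eval b (env_of \<rho> d)))"
      by (rule Cond.IH(3)) (use Cond.prems True in auto)
    then show ?thesis using True z by (intro runs_IfF) auto
  next
    case False
    have "runs L (compile_ex a d) \<rho> (\<rho>(Suc d := eval a (env_of \<rho> d)))"
      by (rule Cond.IH(2)) (use Cond.prems False in auto)
    then show ?thesis using False z runs_Clear[of L "Suc d" "\<rho>(Suc d := ?v)"]
      by (intro runs_IfT) (auto intro: runs_Seq)
  qed
  show ?case unfolding compile_ex.simps by (rule runs_Seq[OF 1 2])
next
  case (LetIn e b)
  let ?v = "eval e (env_of \<rho> d)"
  let ?\<rho>1 = "\<rho>(Suc d := ?v)"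
  let ?w = "eval b (?v # env_of \<rho> d)"
  have v: "?v \<le> B" using ok_le[of B e] set_env_of_le[OF LetIn.prems(3)] LetIn.prems(4) by simp
  have w: "?w \<le> B" by (rule ok_le[of B b]) (use set_env_of_le[of \<rho>, OF LetIn.prems(3)] LetIn.prems(4) v in auto)
  have 1: "runs L (compile_ex e d) \<rho> ?\<rho>1" by (rule LetIn.IH(1)) (use LetIn.prems in auto)
  have "runs L (compile_ex b (Suc d)) ?\<rho>1 (?\<rho>1(Suc (Suc d) := eval b (env_of ?\<rho>1 (Suc d))))"
    by (rule LetIn.IH(2)[of ?\<rho>1]) (use LetIn.prems v in auto)
  then have 2: "runs L (compile_ex b (Suc d)) ?\<rho>1 (?\<rho>1(Suc (Suc d) := ?w))" by simp
  have 3: "runs L (Clear (Suc d)) (?\<rho>1(Suc (Suc d) := ?w)) (\<rho>(Suc d := 0, Suc (Suc d) := ?w))"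
    using runs_Clear[of L "Suc d" "?\<rho>1(Suc (Suc d) := ?w)"] by (simp add: fun_upd_twist)
  have 4: "runs L (Move (Suc (Suc d)) (Suc d)) (\<rho>(Suc d := 0, Suc (Suc d) := ?w)) (\<rho>(Suc d := ?w))"
  proof -
    have "(\<rho>(Suc d := 0, Suc (Suc d) := ?w))(Suc (Suc d) := 0, Suc d := 0 + ?w) = \<rho>(Suc d := ?w)"
      using LetIn.prems(2)[of "Suc (Suc d)"] by (auto simp: fun_eq_iff)
    then show ?thesis
      using runs_Move[of "Suc (Suc d)" "Suc d" "\<rho>(Suc d := 0, Suc (Suc d) := ?w)" L] w B LetIn.prems(1) by simp
  qed
  show ?case unfolding compile_ex.simps eval.simps by (rule runs_Seq[OF 1 runs_Seq[OF 2 runs_Seq[OF 3 4]]])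
next
  case (For e b s)
  let ?v = "eval e (env_of \<rho> d)"
  let ?\<rho>1 = "\<rho>(Suc d := ?v)"
  let ?w = "eval b (?v # env_of \<rho> d)"
  let ?f = "\<lambda>r acc. eval s (acc # r # env_of \<rho> d)"
  let ?P = "\<lambda>r acc. ok B s (acc # r # env_of \<rho> d)"
  let ?S = "\<lambda>n a. \<rho>(Suc d := n, Suc (Suc d) := a)"
  let ?body = "Seq (Dec (Suc d)) (Seq (compile_ex s (Suc (Suc d)))
        (Seq (Clear (Suc (Suc d))) (Move (Suc (Suc (Suc d))) (Suc (Suc d)))))"
  have v: "?v \<le> B" using ok_le[of B e] set_env_of_le[OF For.prems(3)] For.prems(4) by simp
  have w: "?w \<le> B" by (rule ok_le[of B b]) (use set_env_of_le[of \<rho>, OF For.prems(3)] For.prems(4) v in auto)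
  have 1: "runs L (compile_ex e d) \<rho> ?\<rho>1" by (rule For.IH(1)) (use For.prems in auto)
  have "runs L (compile_ex b (Suc d)) ?\<rho>1 (?\<rho>1(Suc (Suc d) := eval b (env_of ?\<rho>1 (Suc d))))"
    by (rule For.IH(2)[of ?\<rho>1]) (use For.prems v in auto)
  then have 2: "runs L (compile_ex b (Suc d)) ?\<rho>1 (?S ?v ?w)" by simp
  \<comment> \<open>Loop invariant: counter in \<open>Suc d\<close>, accumulator in the next
    register. The new accumulator is built one register higher and moved down.\<close>
  have 3: "n \<le> B \<Longrightarrow> a \<le> B \<Longrightarrow> okloop ?P ?f n a \<Longrightarrow>
    runs L (While (Suc d) nonempty ?body) (?S n a) (?S 0 (loop ?f n a)) \<and> loop ?f n a \<le> B" for n a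
  proof (induction n arbitrary: a)
    case 0
    then show ?case by (auto intro: runs_WhileF)
  next
    case (Suc n)
    let ?a = "?f n a"
    have okn: "ok B s (a # n # env_of \<rho> d)" using Suc.prems(3) by simp
    have a: "?a \<le> B" by (rule ok_le[OF okn]) (use set_env_of_le[of \<rho>, OF For.prems(3)] Suc.prems in auto)
    have b1: "runs L (Dec (Suc d)) (?S (Suc n) a) (?S n a)"
      using runs_Dec[of "Suc d" "?S (Suc n) a" n L] Suc.prems B For.prems(1) by (simp add: fun_upd_twist)
    have "runs L (compile_ex s (Suc (Suc d))) (?S n a) ((?S n a)(Suc (Suc (Suc d)) := eval s (env_of (?S n a) (Suc (Suc d)))))"
      by (rule For.IH(3)[of "?S n a"]) (use For.prems Suc.prems okn in auto)
    then have b2: "runs L (compile_ex s (Suc (Suc d))) (?S n a) ((?S n a)(Suc (Suc (Suc d)) := ?a))" by simp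
    have b3: "runs L (Clear (Suc (Suc d))) ((?S n a)(Suc (Suc (Suc d)) := ?a)) ((?S n 0)(Suc (Suc (Suc d)) := ?a))"
      using runs_Clear[of L "Suc (Suc d)" "(?S n a)(Suc (Suc (Suc d)) := ?a)"] by (simp add: fun_upd_twist)
    have b4: "runs L (Move (Suc (Suc (Suc d))) (Suc (Suc d))) ((?S n 0)(Suc (Suc (Suc d)) := ?a)) (?S n ?a)"
    proof -
      have "((?S n 0)(Suc (Suc (Suc d)) := ?a))(Suc (Suc (Suc d)) := 0, Suc (Suc d) := 0 + ?a) = ?S n ?a"
        using For.prems(2)[of "Suc (Suc (Suc d))"] by (auto simp: fun_eq_iff)
      then show ?thesis
        using runs_Move[of "Suc (Suc (Suc d))" "Suc (Suc d)" "(?S n 0)(Suc (Suc (Suc d)) := ?a)" L]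
          a B For.prems(1) by simp
    qed
    have C: "runs L ?body (?S (Suc n) a) (?S n ?a)" using runs_Seq[OF b1 runs_Seq[OF b2 runs_Seq[OF b3 b4]]] .
    have D: "runs L (While (Suc d) nonempty ?body) (?S n ?a) (?S 0 (loop ?f n ?a)) \<and> loop ?f n ?a \<le> B"
      by (rule Suc.IH) (use Suc.prems a in auto)
    show ?case unfolding loop.simps
      by (rule conjI[OF runs_WhileT[OF _ C conjunct1[OF D]] conjunct2[OF D]]) simp
  qed
  let ?x = "loop ?f ?v ?w"
  have x: "runs L (While (Suc d) nonempty ?body) (?S ?v ?w) (?S 0 ?x)" "?x \<le> B"
    using 3[of ?v ?w] v w For.prems(4) by auto
  have 4: "runs L (Move (Suc (Suc d)) (Suc d)) (?S 0 ?x) (\<rho>(Suc d := ?x))"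
  proof -
    have "(?S 0 ?x)(Suc (Suc d) := 0, Suc d := 0 + ?x) = \<rho>(Suc d := ?x)"
      using For.prems(2)[of "Suc (Suc d)"] by (auto simp: fun_eq_iff)
    then show ?thesis
      using runs_Move[of "Suc (Suc d)" "Suc d" "?S 0 ?x" L] x B For.prems(1) by simp
  qed
  show ?case unfolding compile_ex.simps eval.simps by (rule runs_Seq[OF 1 runs_Seq[OF 2 runs_Seq[OF x(1) 4]]])
qed


section \<open>Input and output\<close>

text \<open>The leading one preserves the length, so that strings correspond bijectively to positive
  numbers, and \<open>bits\<close> gives back the string followed by an end marker.\<close>

fun code :: "bitstring \<Rightarrow> nat" where
  "code [] = 1"
| "code (b # bs) = of_bool b + 2 * code bs"

lemma code_pos [simp]: "0 < code x"
  by (induction x) auto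

lemma bits_code: "bits (code x) = x @ [True]"
proof (induction x)
  case Nil
  then show ?case using bits_odd[of 0] by simp
next
  case (Cons b x)
  then show ?case using bits_odd[of "code x"] bits_even[of "code x"] by (cases b) auto
qed

lemma code_surj: "0 < n \<Longrightarrow> \<exists>x. code x = n"
proof (induction n rule: less_induct)
  case (less n)
  show ?case
  proof (cases "n = 1")
    case True
    then show ?thesis by (intro exI[of _ "[]"]) simp
  next
    case False
    then obtain x where "code x = n div 2" using less.IH[of "n div 2"] less.prems by auto
    then show ?thesis by (intro exI[of _ "odd n # x"]) (auto elim!: oddE)
  qed
qed

lemma code_inj: "code x = code y \<Longrightarrow> x = y"
  by (metis append_same_eq bits_code)

lemma code_less: "code x < 2 ^ n \<longleftrightarrow> length x < n"
proof (induction x arbitrary: n)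
  case Nil
  have "(1::nat) < 2 ^ n" if "0 < n" using that by (intro one_less_power) auto
  then show ?case by (cases n) auto
next
  case (Cons b x)
  have "code (b # x) < 2 ^ Suc m \<longleftrightarrow> code x < 2 ^ m" for m by (cases b) auto
  moreover have "\<not> code (b # x) < 2 ^ 0" using code_pos[of "b # x"] by (simp del: code.simps code_pos)
  ultimately show ?case using Cons by (cases n) (auto simp del: code.simps)
qed

definition Flush :: "nat \<Rightarrow> com" where
  "Flush r = While 0 nonempty (Branch 0 (top_eq True) (Seq (Pop 0) (Push r True)) (Seq (Pop 0) (Push r False)))"

lemma exec_Flush:
  assumes "r \<noteq> 0"
  shows "f 0 = zs \<Longrightarrow> length zs + length (f r) \<le> L \<Longrightarrow>
    exec L p y (Flush r) (f, i, j, z) (f(0 := [], r := rev zs @ f r), i, j, z)"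
proof (induction zs arbitrary: f)
  case Nil
  then have eq: "f(0 := [], r := rev [] @ f r) = f" by auto
  show ?case unfolding eq Flush_def by (rule exec.WhileF) (use Nil in auto)
next
  case (Cons b zs)
  let ?f = "f(0 := zs, r := b # f r)"
  have S: "exec L p y (Seq (Pop 0) (Push r b)) (f, i, j, z) (?f, i, j, z)"
    by (rule exec.Seq[OF exec_pop[OF _ refl] exec_push]) (use Cons.prems assms in auto)
  have A: "exec L p y (Branch 0 (top_eq True) (Seq (Pop 0) (Push r True)) (Seq (Pop 0) (Push r False)))
      (f, i, j, z) (?f, i, j, z)"
  proof (cases b)
    case True
    show ?thesis by (rule exec.IfT) (use True Cons.prems S in auto)
  next
    case False
    show ?thesis by (rule exec.IfF) (use False Cons.prems S in auto)
  qed
  have B: "exec L p y (Flush r) (?f, i, j, z) (?f(0 := [], r := rev zs @ ?f r), i, j, z)"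
    by (rule Cons.IH) (use Cons.prems assms in auto)
  have eq: "?f(0 := [], r := rev zs @ ?f r) = f(0 := [], r := rev (b # zs) @ f r)"
    using assms by (auto simp: fun_eq_iff)
  show ?case
    unfolding Flush_def by (rule exec.WhileT[OF _ A B[unfolded eq Flush_def]]) (use Cons.prems in simp)
qed

lemma exec_prog_bit:
  "input_sym p i = Bit b \<Longrightarrow> exec L p y (c b) (f, i, j, z) t \<Longrightarrow>
    exec L p y (Branch r (\<lambda>u v x. u = Bit True) (c True) (c False)) (f, i, j, z) t"
  by (cases b) (auto intro: exec.IfT exec.IfF)

lemma exec_cond_bit:
  "input_sym y j = Bit b \<Longrightarrow> exec L p y (c b) (f, i, j, z) t \<Longrightarrow>
    exec L p y (Branch r (\<lambda>u v x. v = Bit True) (c True) (c False)) (f, i, j, z) t"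
  by (cases b) (auto intro: exec.IfT exec.IfF)

text \<open>The inputs are pushed on the auxiliary stack 0 and thereby reversed; \<^const>\<open>Flush\<close> undoes this.\<close>

definition Collect_prog :: com where
  "Collect_prog = While 0 (\<lambda>u v x. u \<noteq> RightMarker)
     (Seq (Branch 0 (\<lambda>u v x. u = Bit True) (Push 0 True) (Push 0 False)) (MoveP MoveRight))"

definition Collect_cond :: com where
  "Collect_cond = While 0 (\<lambda>u v x. v \<noteq> RightMarker)
     (Seq (Branch 0 (\<lambda>u v x. v = Bit True) (Push 0 True) (Push 0 False)) (MoveC MoveRight))"

lemma exec_Collect_prog:
  "p = pre @ post \<Longrightarrow> i = Suc (length pre) \<Longrightarrow> length (f 0) + length post \<le> L \<Longrightarrow>
    exec L p y Collect_prog (f, i, j, z) (f(0 := rev post @ f 0), Suc (length p), j, z)"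
proof (induction post arbitrary: pre f i)
  case Nil
  then have eq: "f(0 := rev [] @ f 0) = f" "Suc (length p) = i" by auto
  show ?case unfolding eq Collect_prog_def by (rule exec.WhileF) (use Nil in \<open>simp add: input_sym_def\<close>)
next
  case (Cons b post)
  let ?f = "f(0 := b # f 0)"
  have sym: "input_sym p i = Bit b" using Cons.prems by (simp add: input_sym_def nth_append)
  have P: "exec L p y (Push 0 b) (f, i, j, z) (?f, i, j, z)" by (rule exec_push) (use Cons.prems in auto)
  note A1 = exec_prog_bit[where c = "Push 0", OF sym P]
  have "move_input p MoveRight i = Suc i" using Cons.prems by simp
  then have A2: "exec L p y (MoveP MoveRight) (?f, i, j, z) (?f, Suc i, j, z)"
    by (metis exec.MoveP)
  have B: "exec L p y Collect_prog (?f, Suc i, j, z) (?f(0 := rev post @ ?f 0), Suc (length p), j, z)"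
    by (rule Cons.IH[of "pre @ [b]"]) (use Cons.prems in auto)
  have eq: "?f(0 := rev post @ ?f 0) = f(0 := rev (b # post) @ f 0)" by auto
  show ?case unfolding Collect_prog_def
    by (rule exec.WhileT[OF _ exec.Seq[OF A1 A2] B[unfolded eq Collect_prog_def]]) (simp add: sym)
qed

lemma exec_Collect_cond:
  "y = pre @ post \<Longrightarrow> j = Suc (length pre) \<Longrightarrow> length (f 0) + length post \<le> L \<Longrightarrow>
    exec L p y Collect_cond (f, i, j, z) (f(0 := rev post @ f 0), i, Suc (length y), z)"
proof (induction post arbitrary: pre f j)
  case Nil
  then have eq: "f(0 := rev [] @ f 0) = f" "Suc (length y) = j" by auto
  show ?case unfolding eq Collect_cond_def by (rule exec.WhileF) (use Nil in \<open>simp add: input_sym_def\<close>)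
next
  case (Cons b post)
  let ?f = "f(0 := b # f 0)"
  have sym: "input_sym y j = Bit b" using Cons.prems by (simp add: input_sym_def nth_append)
  have P: "exec L p y (Push 0 b) (f, i, j, z) (?f, i, j, z)" by (rule exec_push) (use Cons.prems in auto)
  note A1 = exec_cond_bit[where c = "Push 0", OF sym P]
  have "move_input y MoveRight j = Suc j" using Cons.prems by simp
  then have A2: "exec L p y (MoveC MoveRight) (?f, i, j, z) (?f, i, Suc j, z)"
    by (metis exec.MoveC)
  have B: "exec L p y Collect_cond (?f, i, Suc j, z) (?f(0 := rev post @ ?f 0), i, Suc (length y), z)"
    by (rule Cons.IH[of "pre @ [b]"]) (use Cons.prems in auto)
  have eq: "?f(0 := rev post @ ?f 0) = f(0 := rev (b # post) @ f 0)" by auto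
  show ?case unfolding Collect_cond_def
    by (rule exec.WhileT[OF _ exec.Seq[OF A1 A2] B[unfolded eq Collect_cond_def]]) (simp add: sym)
qed

lemma exec_Finish:
  assumes "r \<noteq> 0" "f r = []" "length x < L"
  shows "exec L p y (Seq (Push r True) (Flush r)) (f(0 := rev x), i, j, z) (f(0 := [], r := bits (code x)), i, j, z)"
proof -
  let ?f2 = "f(0 := rev x, r := [True])"
  have 2: "exec L p y (Push r True) (f(0 := rev x), i, j, z) (?f2, i, j, z)"
    by (rule exec_push) (use assms in auto)
  have 3: "exec L p y (Flush r) (?f2, i, j, z) (?f2(0 := [], r := rev (rev x) @ ?f2 r), i, j, z)"
    by (rule exec_Flush) (use assms in auto)
  have eq: "?f2(0 := [], r := rev (rev x) @ ?f2 r) = f(0 := [], r := bits (code x))"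
    using assms by (auto simp: fun_eq_iff bits_code)
  show ?thesis using exec.Seq[OF 2 3] unfolding eq .
qed

definition Read_prog :: "nat \<Rightarrow> com" where
  "Read_prog r = Seq Collect_prog (Seq (Push r True) (Flush r))"

definition Read_cond :: "nat \<Rightarrow> com" where
  "Read_cond r = Seq Collect_cond (Seq (Push r True) (Flush r))"

lemma exec_Read_prog:
  assumes "r \<noteq> 0" "f 0 = []" "f r = []" "length p < L"
  shows "exec L p y (Read_prog r) (f, 1, j, z) (f(r := bits (code p)), Suc (length p), j, z)"
proof -
  have "exec L p y Collect_prog (f, 1, j, z) (f(0 := rev p), Suc (length p), j, z)"
    using exec_Collect_prog[of p "[]" p 1 f L] assms by simp
  moreover have "f(0 := [], r := bits (code p)) = f(r := bits (code p))" using assms by auto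
  ultimately show ?thesis
    unfolding Read_prog_def using exec.Seq exec_Finish[of r f p L] assms by metis
qed

lemma exec_Read_cond:
  assumes "r \<noteq> 0" "f 0 = []" "f r = []" "length b < L" "y = pre @ b" "j = Suc (length pre)"
  shows "exec L p y (Read_cond r) (f, i, j, z) (f(r := bits (code b)), i, Suc (length y), z)"
proof -
  have "exec L p y Collect_cond (f, i, j, z) (f(0 := rev b), i, Suc (length y), z)"
    using exec_Collect_cond[of y pre b j f L p i z] assms by simp
  moreover have "f(0 := [], r := bits (code b)) = f(r := bits (code b))" using assms by auto
  ultimately show ?thesis
    unfolding Read_cond_def using exec.Seq exec_Finish[of r f b L] assms by metis
qed

text \<open>Register \<open>s\<close> is a flag that is cleared when the separator 01 of the pair has been read.\<close>

definition pair_step :: "nat \<Rightarrow> com" where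
  "pair_step s = Branch 0 (\<lambda>u v x. v = Bit True)
     (Seq (MoveC MoveRight) (Seq (Push 0 True) (MoveC MoveRight)))
     (Seq (MoveC MoveRight)
       (Seq (Branch 0 (\<lambda>u v x. v = Bit True) (Pop s) (Push 0 False)) (MoveC MoveRight)))"

definition Collect_pair :: "nat \<Rightarrow> com" where
  "Collect_pair s = While s nonempty (pair_step s)"

lemma exec_moveC: "j' = move_input y d j \<Longrightarrow> exec L p y (MoveC d) (f, i, j, z) (f, i, j', z)"
  using exec.MoveC by simp

text \<open>Bits are consumed two at a time. Doubled bits are equal, so a zero followed by a one can
  only be the separator; the head is left just behind it.\<close>

lemma exec_Collect_pair:
  assumes s: "s \<noteq> 0"
  shows "y = pre @ encode_pair ps b \<Longrightarrow> j = Suc (length pre) \<Longrightarrow> f s = [True] \<Longrightarrow>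
    length (f 0) + length ps \<le> L \<Longrightarrow>
    exec L p y (Collect_pair s) (f, i, j, z)
      (f(0 := rev ps @ f 0, s := []), i, Suc (length y - length b), z)"
proof (induction ps arbitrary: pre f j)
  case Nil
  let ?f = "f(0 := rev [] @ f 0, s := [])"
  have y: "y = pre @ [False, True] @ b" using Nil by (simp add: encode_pair_def)
  have sym: "input_sym y j = Bit False" "input_sym y (Suc j) = Bit True"
    using y Nil by (simp_all add: input_sym_def nth_append)
  have 1: "exec L p y (MoveC MoveRight) (f, i, j, z) (f, i, Suc j, z)"
    by (rule exec_moveC) (use y Nil in simp)
  have 2: "exec L p y (Branch 0 (\<lambda>u v x. v = Bit True) (Pop s) (Push 0 False)) (f, i, Suc j, z) (?f, i, Suc j, z)"
    by (rule exec.IfT, use sym in simp, rule exec_pop) (use Nil in auto)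
  have 3: "exec L p y (MoveC MoveRight) (?f, i, Suc j, z) (?f, i, Suc (Suc j), z)"
    by (rule exec_moveC) (use y Nil in simp)
  have A: "exec L p y (pair_step s) (f, i, j, z) (?f, i, Suc (Suc j), z)"
    unfolding pair_step_def by (rule exec.IfF[OF _ exec.Seq[OF 1 exec.Seq[OF 2 3]]]) (use sym in simp)
  have B: "exec L p y (Collect_pair s) (?f, i, Suc (Suc j), z) (?f, i, Suc (Suc j), z)"
    unfolding Collect_pair_def by (rule exec.WhileF) simp
  have eq: "Suc (Suc j) = Suc (length y - length b)" using y Nil by simp
  show ?case unfolding Collect_pair_def eq[symmetric]
    by (rule exec.WhileT[OF _ A B[unfolded Collect_pair_def]]) (use Nil.prems(3) in simp)
next
  case (Cons a ps)
  let ?f = "f(0 := a # f 0)"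
  have y: "y = pre @ [a, a] @ encode_pair ps b" using Cons.prems by (simp add: encode_pair_def)
  have sym: "input_sym y j = Bit a" "input_sym y (Suc j) = Bit a"
    using y Cons.prems(2) by (simp_all add: input_sym_def nth_append)
  have 1: "exec L p y (MoveC MoveRight) (g, i, j, z) (g, i, Suc j, z)"
    "exec L p y (MoveC MoveRight) (g, i, Suc j, z) (g, i, Suc (Suc j), z)" for g
    by (rule exec_moveC, use y Cons.prems(2) in simp)+
  have P: "exec L p y (Push 0 a) (f, i, Suc j, z) (?f, i, Suc j, z)" by (rule exec_push) (use Cons.prems in auto)
  have A: "exec L p y (pair_step s) (f, i, j, z) (?f, i, Suc (Suc j), z)"
  proof (cases a)
    case True
    show ?thesis unfolding pair_step_def
      by (rule exec.IfT[OF _ exec.Seq[OF 1(1) exec.Seq[OF _ 1(2)]]]) (use True sym P in auto)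
  next
    case False
    have 2: "exec L p y (Branch 0 (\<lambda>u v x. v = Bit True) (Pop s) (Push 0 False)) (f, i, Suc j, z) (?f, i, Suc j, z)"
      by (rule exec.IfF) (use sym False P in auto)
    show ?thesis unfolding pair_step_def
      by (rule exec.IfF[OF _ exec.Seq[OF 1(1) exec.Seq[OF 2 1(2)]]]) (use False sym in auto)
  qed
  have B: "exec L p y (Collect_pair s) (?f, i, Suc (Suc j), z)
      (?f(0 := rev ps @ ?f 0, s := []), i, Suc (length y - length b), z)"
    by (rule Cons.IH[of "pre @ [a, a]"]) (use y Cons.prems s in auto)
  have eq: "?f(0 := rev ps @ ?f 0, s := []) = f(0 := rev (a # ps) @ f 0, s := [])"
    by (auto simp: fun_eq_iff)
  show ?case unfolding Collect_pair_def
    by (rule exec.WhileT[OF _ A B[unfolded eq Collect_pair_def]]) (use Cons.prems in simp)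
qed

definition Read_pair :: "nat \<Rightarrow> nat \<Rightarrow> com" where
  "Read_pair r s = Seq (Push s True) (Seq (Collect_pair s)
     (Seq (Seq (Push r True) (Flush r)) (Read_cond s)))"

lemma exec_Read_pair:
  assumes "r \<noteq> 0" "s \<noteq> 0" "r \<noteq> s" "f 0 = []" "f r = []" "f s = []"
    and "length ps < L" "length b < L" "y = encode_pair ps b"
  shows "exec L p y (Read_pair r s) (f, i, 1, z)
    (f(r := bits (code ps), s := bits (code b)), i, Suc (length y), z)"
proof -
  let ?j = "Suc (length y - length b)"
  let ?f1 = "f(s := [True])" and ?f2 = "f(0 := rev ps)"
  let ?f4 = "f(r := bits (code ps))"
  have 1: "exec L p y (Push s True) (f, i, 1, z) (?f1, i, 1, z)"
    by (rule exec_push) (use assms in auto)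
  have eq1: "?f1(0 := rev ps @ ?f1 0, s := []) = ?f2" using assms by (auto simp: fun_eq_iff)
  have "exec L p y (Collect_pair s) (?f1, i, 1, z) (?f1(0 := rev ps @ ?f1 0, s := []), i, ?j, z)"
    by (rule exec_Collect_pair[of s y "[]"]) (use assms in auto)
  then have 2: "exec L p y (Collect_pair s) (?f1, i, 1, z) (?f2, i, ?j, z)" unfolding eq1 .
  have "f(0 := [], r := bits (code ps)) = ?f4" using assms by auto
  then have 3: "exec L p y (Seq (Push r True) (Flush r)) (?f2, i, ?j, z) (?f4, i, ?j, z)"
    using exec_Finish[of r f ps L] assms by metis
  have 4: "exec L p y (Read_cond s) (?f4, i, ?j, z) (?f4(s := bits (code b)), i, Suc (length y), z)"
    by (rule exec_Read_cond[where pre = "concat (map (\<lambda>u. [u, u]) ps) @ [False, True]"])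
      (use assms in \<open>auto simp: encode_pair_def\<close>)
  show ?thesis unfolding Read_pair_def
    using exec.Seq[OF 1 exec.Seq[OF 2 exec.Seq[OF 3 4]]] .
qed

text \<open>The \<open>True\<close> at the bottom is the end marker of \<open>code\<close> and must
  not be emitted; hence the stack is tested again after a \<open>True\<close> has been
  popped.\<close>

definition Print :: "nat \<Rightarrow> com" where
  "Print r = While r nonempty
     (Branch r (top_eq True)
       (Seq (Pop r) (Branch r nonempty (Emit True) Skip))
       (Seq (Pop r) (Emit False)))"

lemma exec_Print:
  "f r = x @ [True] \<Longrightarrow> exec L p y (Print r) (f, i, j, z) (f(r := []), i, j, z @ x)"
proof (induction x arbitrary: f z)
  case Nil
  let ?f = "f(r := [])"
  have 1: "exec L p y (Pop r) (f, i, j, z) (?f, i, j, z)" by (rule exec_pop) (use Nil in auto)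
  have 2: "exec L p y (Branch r nonempty (Emit True) Skip) (?f, i, j, z) (?f, i, j, z)"
    by (rule exec.IfF[OF _ exec_Skip]) simp
  have A: "exec L p y (Branch r (top_eq True)
       (Seq (Pop r) (Branch r nonempty (Emit True) Skip))
       (Seq (Pop r) (Emit False))) (f, i, j, z) (?f, i, j, z)"
    by (rule exec.IfT[OF _ exec.Seq[OF 1 2]]) (use Nil in simp)
  have B: "exec L p y (Print r) (?f, i, j, z) (?f, i, j, z)"
    unfolding Print_def by (rule exec.WhileF) simp
  show ?case unfolding Print_def append_Nil2
    by (rule exec.WhileT[OF _ A B[unfolded Print_def]]) (use Nil in simp)
next
  case (Cons b x)
  let ?f = "f(r := x @ [True])"
  have 1: "exec L p y (Pop r) (f, i, j, z) (?f, i, j, z)" by (rule exec_pop) (use Cons in auto)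
  have A: "exec L p y (Branch r (top_eq True)
       (Seq (Pop r) (Branch r nonempty (Emit True) Skip))
       (Seq (Pop r) (Emit False))) (f, i, j, z) (?f, i, j, z @ [b])"
  proof (cases b)
    case True
    have 2: "exec L p y (Branch r nonempty (Emit True) Skip) (?f, i, j, z) (?f, i, j, z @ [b])"
      by (rule exec.IfT) (use exec.Emit True in auto)
    show ?thesis by (rule exec.IfT[OF _ exec.Seq[OF 1 2]]) (use Cons True in simp)
  next
    case False
    have 2: "exec L p y (Emit False) (?f, i, j, z) (?f, i, j, z @ [b])"
      using exec.Emit False by simp
    show ?thesis by (rule exec.IfF[OF _ exec.Seq[OF 1 2]]) (use Cons False in simp)
  qed
  have B: "exec L p y (Print r) (?f, i, j, z @ [b]) (?f(r := []), i, j, (z @ [b]) @ x)"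
    by (rule Cons.IH) simp
  have "exec L p y (Print r) (f, i, j, z) (?f(r := []), i, j, (z @ [b]) @ x)"
    unfolding Print_def by (rule exec.WhileT[OF _ A B[unfolded Print_def]]) (use Cons in simp)
  moreover have eq: "(z @ [b]) @ x = z @ b # x" by simp
  ultimately show ?case by (simp only: eq fun_upd_upd)
qed

definition run_ex :: "com \<Rightarrow> nat \<Rightarrow> ex \<Rightarrow> com" where
  "run_ex R d e = Seq R (Seq (compile_ex e d) (Print (Suc d)))"

lemma compute_run_ex:
  assumes R: "exec L p y R start (bits \<circ> \<rho>, i, j, [])"
    and \<rho>: "\<rho> 0 = 0" "\<And>r. r > d \<Longrightarrow> \<rho> r = 0" "\<And>r. \<rho> r \<le> B"
    and e: "B < 2 ^ L" "ok B e (env_of \<rho> d)" "eval e (env_of \<rho> d) = code x"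
  shows "computes_in_space (compiled (regs (run_ex R d e)) (run_ex R d e)) p y x (regs (run_ex R d e) * (L + 1))"
proof -
  let ?\<rho> = "\<rho>(Suc d := code x)"
  have "runs L (compile_ex e d) \<rho> ?\<rho>" using runs_comp[OF e(1) \<rho> e(2)] e(3) by simp
  then have 2: "exec L p y (compile_ex e d) (bits \<circ> \<rho>, i, j, []) (bits \<circ> ?\<rho>, i, j, [])"
    unfolding runs_def by blast
  have 3: "exec L p y (Print (Suc d)) (bits \<circ> ?\<rho>, i, j, []) ((bits \<circ> ?\<rho>)(Suc d := []), i, j, [] @ x)"
    by (rule exec_Print) (simp add: bits_code)
  show ?thesis
    using compiled(2)[OF wf_com_regs exec.Seq[OF R exec.Seq[OF 2 3], folded run_ex_def]] by simp
qed

definition cond_prog :: "ex \<Rightarrow> com" where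
  "cond_prog e = run_ex (Seq (Read_prog 1) (Read_cond 2)) 2 e"

definition pair_prog :: "ex \<Rightarrow> com" where
  "pair_prog e = run_ex (Seq (Read_prog 1) (Read_pair 2 3)) 3 e"

lemma length_code: "code x \<le> B \<Longrightarrow> B < 2 ^ L \<Longrightarrow> length x < L"
  using code_less[of x L] by simp

lemma compute_cond_prog:
  assumes "code p \<le> B" "code y \<le> B" "B < 2 ^ L"
    and e: "ok B e [code y, code p]" "eval e [code y, code p] = code x"
  shows "computes_in_space (compiled (regs (cond_prog e)) (cond_prog e)) p y x (regs (cond_prog e) * (L + 1))"
proof -
  let ?\<rho> = "(\<lambda>_. 0)(1 := code p, 2 := code y)"
  have 1: "exec L p y (Read_prog 1) start ((\<lambda>_. [])(1 := bits (code p)), Suc (length p), 1, [])"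
    unfolding start_def using length_code[OF assms(1,3)] by (intro exec_Read_prog) auto
  have 2: "exec L p y (Read_cond 2) ((\<lambda>_. [])(1 := bits (code p)), Suc (length p), 1, [])
      ((\<lambda>_. [])(1 := bits (code p), 2 := bits (code y)), Suc (length p), Suc (length y), [])"
    using length_code[OF assms(2,3)] by (intro exec_Read_cond[where pre = "[]"]) auto
  have \<rho>: "(\<lambda>_. [])(1 := bits (code p), 2 := bits (code y)) = bits \<circ> ?\<rho>" by auto
  have env: "env_of ?\<rho> 2 = [code y, code p]" by (simp add: numeral_2_eq_2)
  show ?thesis unfolding cond_prog_def
    by (rule compute_run_ex[OF exec.Seq[OF 1 2[unfolded \<rho>]] _ _ _ assms(3)])
      (use assms(1,2) e in \<open>simp_all only: env, auto\<close>)
qed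

lemma compute_pair_prog:
  assumes "code p \<le> B" "code q \<le> B" "code b \<le> B" "B < 2 ^ L"
    and e: "ok B e [code b, code q, code p]" "eval e [code b, code q, code p] = code x"
  shows "computes_in_space (compiled (regs (pair_prog e)) (pair_prog e)) p (encode_pair q b) x
    (regs (pair_prog e) * (L + 1))"
proof -
  let ?y = "encode_pair q b"
  let ?\<rho> = "(\<lambda>_. 0)(1 := code p, 2 := code q, 3 := code b)"
  have 1: "exec L p ?y (Read_prog 1) start ((\<lambda>_. [])(1 := bits (code p)), Suc (length p), 1, [])"
    unfolding start_def using length_code[OF assms(1,4)] by (intro exec_Read_prog) auto
  have 2: "exec L p ?y (Read_pair 2 3) ((\<lambda>_. [])(1 := bits (code p)), Suc (length p), 1, [])
      ((\<lambda>_. [])(1 := bits (code p), 2 := bits (code q), 3 := bits (code b)), Suc (length p), Suc (length ?y), [])"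
    using length_code[OF assms(2,4)] length_code[OF assms(3,4)] by (intro exec_Read_pair) auto
  have \<rho>: "(\<lambda>_. [])(1 := bits (code p), 2 := bits (code q), 3 := bits (code b)) = bits \<circ> ?\<rho>" by auto
  have env: "env_of ?\<rho> 3 = [code b, code q, code p]" by (simp add: numeral_3_eq_3 numeral_2_eq_2)
  show ?thesis unfolding pair_prog_def
    by (rule compute_run_ex[OF exec.Seq[OF 1 2[unfolded \<rho>]] _ _ _ assms(4)])
      (use assms(1-3) e in \<open>simp_all only: env, auto\<close>)
qed

text \<open>Prints its program without moving a work head, hence in one cell. Through optimality it
  bounds the complexity of any string by its length plus a constant, in constant space.\<close>

definition echo_prog :: com where
  "echo_prog = While 0 (\<lambda>u v x. u \<noteq> RightMarker)
     (Seq (Branch 0 (\<lambda>u v x. u = Bit True) (Emit True) (Emit False)) (MoveP MoveRight))"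

lemma exec_echo_prog:
  "p = pre @ post \<Longrightarrow> i = Suc (length pre) \<Longrightarrow>
    exec L p y echo_prog (f, i, j, z) (f, Suc (length p), j, z @ post)"
proof (induction post arbitrary: pre i z)
  case Nil
  then have eq: "Suc (length p) = i" by simp
  show ?case unfolding eq echo_prog_def append_Nil2
    by (rule exec.WhileF) (use Nil in \<open>simp add: input_sym_def\<close>)
next
  case (Cons b post)
  have sym: "input_sym p i = Bit b" using Cons.prems by (simp add: input_sym_def nth_append)
  note A1 = exec_prog_bit[where c = Emit, OF sym exec.Emit]
  have "move_input p MoveRight i = Suc i" using Cons.prems by simp
  then have A2: "exec L p y (MoveP MoveRight) (f, i, j, z @ [b]) (f, Suc i, j, z @ [b])"
    by (metis exec.MoveP)
  have B: "exec L p y echo_prog (f, Suc i, j, z @ [b]) (f, Suc (length p), j, (z @ [b]) @ post)"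
    by (rule Cons.IH[of "pre @ [b]"]) (use Cons.prems in auto)
  have "exec L p y echo_prog (f, i, j, z) (f, Suc (length p), j, (z @ [b]) @ post)"
    unfolding echo_prog_def
    by (rule exec.WhileT[OF _ exec.Seq[OF A1 A2] B[unfolded echo_prog_def]]) (simp add: sym)
  then show ?case by simp
qed

lemma compute_echo: "computes_in_space (compiled 1 echo_prog) p y p 1"
proof -
  have "exec 0 p y echo_prog start ((\<lambda>_. []), Suc (length p), 1, [] @ p)"
    unfolding start_def by (rule exec_echo_prog[of p "[]"]) auto
  from compiled(2)[OF _ this[unfolded append_Nil], of 1] show ?thesis by (simp add: echo_prog_def)
qed

lemma wf_echo: "wf_com 1 echo_prog"
  by (simp add: echo_prog_def)

section \<open>Functions with polynomially bounded values\<close>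

lemma nth0_Cons [simp]: "(v # env) $ 0 = v" "(v # env) $ Suc i = env $ i" "(v # env) $ 1 = env $ 0"
    "(v # env) $ numeral k = env $ pred_numeral k"
  by (simp_all add: nth0_def numeral_eq_Suc)

lemma nth0_tl [simp]: "tl env $ i = env $ Suc i"
  by (cases env) (simp_all add: nth0_def)

definition le_env :: "nat list \<Rightarrow> nat \<Rightarrow> bool" where
  "le_env env B \<longleftrightarrow> (\<forall>v\<in>set env. v \<le> B)"

lemma le_env_Cons [simp]: "le_env (v # env) B \<longleftrightarrow> v \<le> B \<and> le_env env B"
  by (auto simp: le_env_def)

lemma le_env_tl: "le_env env B \<Longrightarrow> le_env (tl env) B"
  by (cases env) (auto simp: le_env_def)

lemma le_env_mono: "le_env env B \<Longrightarrow> B \<le> B' \<Longrightarrow> le_env env B'"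
  by (auto simp: le_env_def)

lemma ok_mono: "ok B e env \<Longrightarrow> B \<le> B' \<Longrightarrow> ok B' e env"
proof (induction e arbitrary: env)
  case (For e b s)
  have "okloop (\<lambda>r acc. ok B s (acc # r # env)) f n a \<Longrightarrow> okloop (\<lambda>r acc. ok B' s (acc # r # env)) f n a" for f n a
    by (induction n arbitrary: a) (use For in auto)
  then show ?case using For by auto
qed (auto split: if_splits)

text \<open>Polynomially bounded intermediate values mean space linear in the bit length of the
  arguments. The base \<open>B + 2\<close> is at least 2, so constants can be absorbed into the
  exponent even when all arguments are 0.\<close>

definition E2 :: "(nat list \<Rightarrow> nat) \<Rightarrow> bool" where
  "E2 f \<longleftrightarrow> (\<exists>e c. \<forall>env. eval e env = f env \<and> (\<forall>B. le_env env B \<longrightarrow> ok ((B + 2) ^ c) e env))"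

text \<open>Bounds the value only, not the computation; it supplies the a priori bounds for
  loops.\<close>

definition PB :: "(nat list \<Rightarrow> nat) \<Rightarrow> bool" where
  "PB f \<longleftrightarrow> (\<exists>c. \<forall>env B. le_env env B \<longrightarrow> f env \<le> (B + 2) ^ c)"

lemma B_mono: "c \<le> d \<Longrightarrow> (B + 2) ^ c \<le> (B + 2 :: nat) ^ d"
  by (rule power_increasing) auto

lemma B_ge: "1 \<le> c \<Longrightarrow> B + 2 \<le> (B + 2 :: nat) ^ c"
  using B_mono[of 1 c B] by simp

lemma B_Suc: "(B + 2) ^ c + 2 \<le> (B + 2 :: nat) ^ Suc (Suc c)"
proof -
  have "1 \<le> (B + 2) ^ c" by simp
  then have "(B + 2) ^ c * 4 \<le> (B + 2) ^ c * ((B + 2) * (B + 2))"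
    by (intro mult_left_mono) (simp_all add: algebra_simps)
  moreover have "(B + 2) ^ Suc (Suc c) = (B + 2) ^ c * ((B + 2) * (B + 2))"
    by (simp only: power_Suc ac_simps)
  ultimately show ?thesis using \<open>1 \<le> (B + 2) ^ c\<close> by linarith
qed

text \<open>Substituting one polynomial bound into another multiplies exponents; two extra units pay
  for the shift by 2.\<close>

lemma B_comp: "((B + 2) ^ c + 2) ^ d \<le> (B + 2 :: nat) ^ (Suc (Suc c) * d)"
  unfolding power_mult by (rule power_mono[OF B_Suc]) simp

lemma E2D:
  assumes "E2 f"
  shows "\<exists>e c. (\<forall>env. eval e env = f env) \<and> (\<forall>env B. le_env env B \<longrightarrow> ok ((B + 2) ^ c) e env) \<and> 1 \<le> c"
proof -
  obtain e c where e: "\<And>env. eval e env = f env" "\<And>env B. le_env env B \<Longrightarrow> ok ((B + 2) ^ c) e env"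
    using assms unfolding E2_def by blast
  have "\<And>env B. le_env env B \<Longrightarrow> ok ((B + 2) ^ Suc c) e env"
    by (rule ok_mono[OF e(2)], assumption, rule B_mono) simp
  then show ?thesis using e(1) by (intro exI[of _ e] exI[of _ "Suc c"]) auto
qed

lemma E2I: "(\<And>env. eval e env = f env) \<Longrightarrow> (\<And>env B. le_env env B \<Longrightarrow> ok ((B + 2) ^ c) e env) \<Longrightarrow> E2 f"
  unfolding E2_def by blast

lemma ok_le': "ok B e env \<Longrightarrow> le_env env B \<Longrightarrow> eval e env \<le> B"
  by (rule ok_le) (auto simp: le_env_def)

lemma E2_PB: assumes "E2 f" shows "PB f"
proof -
  obtain e c where e: "\<And>env. eval e env = f env" "\<And>env B. le_env env B \<Longrightarrow> ok ((B + 2) ^ c) e env" "1 \<le> c"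
    using E2D[OF assms] by blast
  have "f env \<le> (B + 2) ^ c" if "le_env env B" for env B
    using ok_le'[OF e(2)[OF that]] le_env_mono[OF that, of "(B + 2) ^ c"] B_ge[OF e(3), of B] e(1)[of env] by simp
  then show ?thesis unfolding PB_def by blast
qed

lemma PB_add: assumes "PB f" "PB g" shows "PB (\<lambda>env. f env + g env)"
proof -
  obtain c d where c: "\<And>env B. le_env env B \<Longrightarrow> f env \<le> (B + 2) ^ c"
    and d: "\<And>env B. le_env env B \<Longrightarrow> g env \<le> (B + 2) ^ d" using assms unfolding PB_def by blast
  have "f env + g env \<le> (B + 2) ^ Suc (c + d)" if "le_env env B" for env B
  proof -
    have "f env \<le> (B + 2) ^ (c + d)" "g env \<le> (B + 2) ^ (c + d)"
      using le_trans[OF c[OF that] B_mono[of c "c + d" B]] le_trans[OF d[OF that] B_mono[of d "c + d" B]] by auto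
    moreover have "2 * (B + 2) ^ (c + d) \<le> (B + 2) * (B + 2) ^ (c + d)" by (intro mult_right_mono) auto
    ultimately show ?thesis by simp
  qed
  then show ?thesis unfolding PB_def by blast
qed

lemma PB_mult: assumes "PB f" "PB g" shows "PB (\<lambda>env. f env * g env)"
proof -
  obtain c d where c: "\<And>env B. le_env env B \<Longrightarrow> f env \<le> (B + 2) ^ c"
    and d: "\<And>env B. le_env env B \<Longrightarrow> g env \<le> (B + 2) ^ d" using assms unfolding PB_def by blast
  have "f env * g env \<le> (B + 2) ^ (c + d)" if "le_env env B" for env B
    unfolding power_add by (rule mult_le_mono[OF c[OF that] d[OF that]])
  then show ?thesis unfolding PB_def by blast
qed

lemma PB_power: "PB f \<Longrightarrow> PB (\<lambda>env. f env ^ k)"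
proof (induction k)
  case 0
  have "PB (\<lambda>env. 1)" unfolding PB_def by auto
  then show ?case by simp
next
  case (Suc k)
  then show ?case using PB_mult[of f "\<lambda>env. f env ^ k"] by simp
qed

named_theorems E2

lemma E2_var [E2]: "E2 (\<lambda>env. env $ i)"
  by (rule E2I[of "Var i"]) auto

lemma E2_Suc [E2]: assumes "E2 f" shows "E2 (\<lambda>env. Suc (f env))"
proof -
  obtain e c where e: "\<And>env. eval e env = f env" "\<And>env B. le_env env B \<Longrightarrow> ok ((B + 2) ^ c) e env" "1 \<le> c"
    using E2D[OF assms] by blast
  have k: "ok ((B + 2) ^ Suc (Suc c)) (Succ e) env" if "le_env env B" for env B
  proof -
    have "f env \<le> (B + 2) ^ c"
      using ok_le'[OF e(2)[OF that]] le_env_mono[OF that, of "(B + 2) ^ c"] B_ge[OF e(3), of B] e(1)[of env] by simp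
    then have "f env < (B + 2) ^ Suc (Suc c)" using B_Suc[of B c] by linarith
    then show ?thesis using ok_mono[OF e(2)[OF that] B_mono, of "Suc (Suc c)"] e(1) by simp
  qed
  show ?thesis by (rule E2I[of "Succ e", OF _ k]) (simp_all add: e(1))
qed

lemma E2_pred: assumes "E2 f" shows "E2 (\<lambda>env. f env - 1)"
proof -
  obtain e c where e: "\<And>env. eval e env = f env" "\<And>env B. le_env env B \<Longrightarrow> ok ((B + 2) ^ c) e env"
    using E2D[OF assms] by blast
  then show ?thesis by (intro E2I[of "Pred e"]) auto
qed

lemma E2_cond: assumes "E2 f" "E2 g" "E2 h" shows "E2 (\<lambda>env. if f env \<noteq> 0 then g env else h env)"
proof -
  obtain e c where e: "\<And>env. eval e env = f env" "\<And>env B. le_env env B \<Longrightarrow> ok ((B + 2) ^ c) e env"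
    using E2D[OF assms(1)] by blast
  obtain e' c' where e': "\<And>env. eval e' env = g env" "\<And>env B. le_env env B \<Longrightarrow> ok ((B + 2) ^ c') e' env"
    using E2D[OF assms(2)] by blast
  obtain e'' c'' where e'': "\<And>env. eval e'' env = h env" "\<And>env B. le_env env B \<Longrightarrow> ok ((B + 2) ^ c'') e'' env"
    using E2D[OF assms(3)] by blast
  let ?c = "c + c' + c''"
  have "ok ((B + 2) ^ ?c) e env" "ok ((B + 2) ^ ?c) e' env" "ok ((B + 2) ^ ?c) e'' env" if "le_env env B" for env B
    using ok_mono[OF e(2)[OF that] B_mono, of ?c] ok_mono[OF e'(2)[OF that] B_mono, of ?c]
      ok_mono[OF e''(2)[OF that] B_mono, of ?c] by auto
  then show ?thesis by (intro E2I[of "Cond e e' e''" _ ?c]) (auto simp: e e' e'')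
qed

lemma E2_zero: "E2 (\<lambda>env. 0)"
  by (rule E2I[of Zero]) auto

lemma E2_const [E2]: "E2 (\<lambda>env. k)"
  by (induction k) (auto intro: E2_zero E2_Suc)

definition lift :: "(nat \<Rightarrow> nat) \<Rightarrow> nat \<Rightarrow> nat" where
  "lift \<rho> i = (case i of 0 \<Rightarrow> 0 | Suc j \<Rightarrow> Suc (\<rho> j))"

fun ren :: "(nat \<Rightarrow> nat) \<Rightarrow> ex \<Rightarrow> ex" where
  "ren \<rho> (Var i) = Var (\<rho> i)"
| "ren \<rho> Zero = Zero"
| "ren \<rho> (Succ e) = Succ (ren \<rho> e)"
| "ren \<rho> (Pred e) = Pred (ren \<rho> e)"
| "ren \<rho> (Cond e a b) = Cond (ren \<rho> e) (ren \<rho> a) (ren \<rho> b)"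
| "ren \<rho> (LetIn e b) = LetIn (ren \<rho> e) (ren (lift \<rho>) b)"
| "ren \<rho> (For e b s) = For (ren \<rho> e) (ren (lift \<rho>) b) (ren (lift (lift \<rho>)) s)"

lemma lift_env: "(\<And>i. env' $ i = env $ \<rho> i) \<Longrightarrow> (v # env') $ i = (v # env) $ lift \<rho> i"
  by (cases i) (auto simp: lift_def)

lemma eval_ok_ren:
  "(\<And>i. env' $ i = env $ \<rho> i) \<Longrightarrow> eval (ren \<rho> e) env = eval e env' \<and> ok B (ren \<rho> e) env = ok B e env'"
proof (induction e arbitrary: \<rho> env env')
  case (Succ e)
  show ?case using Succ.IH[OF Succ.prems] by simp
next
  case (Pred e)
  show ?case using Pred.IH[OF Pred.prems] by simp
next
  case (Cond e a b)
  show ?case using Cond.IH(1)[OF Cond.prems] Cond.IH(2)[OF Cond.prems] Cond.IH(3)[OF Cond.prems] by simp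
next
  case (LetIn e b)
  show ?case using LetIn.IH(1)[OF LetIn.prems] LetIn.IH(2)[OF lift_env[OF LetIn.prems]] by simp
next
  case (For e b s)
  note 1 = For.IH(1)[OF For.prems]
  note 2 = For.IH(2)[OF lift_env[OF For.prems]]
  note 3 = For.IH(3)[OF lift_env[OF lift_env[OF For.prems]]]
  show ?case by (simp add: 1 2 3)
qed auto

text \<open>Under a binder the old environment reappears as \<open>tl env\<close>. Renaming
  variables in the expression turns such shifts into closure properties.\<close>

lemma E2_ren:
  assumes "E2 f" and \<rho>: "\<And>env i. \<phi> env $ i = env $ \<rho> i" and le: "\<And>env B. le_env env B \<Longrightarrow> le_env (\<phi> env) B"
  shows "E2 (\<lambda>env. f (\<phi> env))"
proof -
  obtain e c where e: "\<And>env. eval e env = f env" "\<And>env B. le_env env B \<Longrightarrow> ok ((B + 2) ^ c) e env"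
    using E2D[OF assms(1)] by blast
  show ?thesis
    by (rule E2I[of "ren \<rho> e" _ c]) (simp_all only: eval_ok_ren[OF \<rho>] e(1), blast intro: e(2) le)
qed

lemma E2_tl: "E2 f \<Longrightarrow> E2 (\<lambda>env. f (tl env))"
  by (rule E2_ren[of f tl Suc]) (auto intro: le_env_tl)

lemma le_env_nth0: "le_env env B \<Longrightarrow> env $ i \<le> B"
  by (auto simp: le_env_def nth0_def)

text \<open>Hides the loop counter from a body that depends on the accumulator only, as in the
  iteration of a function.\<close>

lemma E2_skip: assumes "E2 f" shows "E2 (\<lambda>env. f (env $ 0 # tl (tl env)))"
proof (rule E2_ren[of f _ "lift Suc", OF assms])
  show "(env $ 0 # tl (tl env)) $ i = env $ lift Suc i" for env i
    by (cases i) (auto simp: lift_def)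
qed (auto intro: le_env_tl le_env_nth0)

text \<open>Bounded recursion. Iterating a polynomially bounded step may grow too fast, so an
  invariant \<open>\<beta>\<close>, possibly depending on the counter, must keep the accumulator
  below a polynomially bounded \<open>\<gamma>\<close>.\<close>

lemma E2_For:
  assumes n: "E2 n" and b: "E2 b" and s: "E2 s" and "PB \<gamma>"
    and b0: "\<And>env. b (n env # env) \<le> \<beta> env (n env)"
    and st: "\<And>env r a. r < n env \<Longrightarrow> a \<le> \<beta> env (Suc r) \<Longrightarrow> s (a # r # env) \<le> \<beta> env r"
    and bd: "\<And>env r. r \<le> n env \<Longrightarrow> \<beta> env r \<le> \<gamma> env"
  shows "E2 (\<lambda>env. loop (\<lambda>r a. s (a # r # env)) (n env) (b (n env # env)))"
proof -
  obtain e1 c1 where e1: "\<And>env. eval e1 env = n env" "\<And>env B. le_env env B \<Longrightarrow> ok ((B + 2) ^ c1) e1 env" "1 \<le> c1"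
    using E2D[OF n] by blast
  obtain e2 c2 where e2: "\<And>env. eval e2 env = b env" "\<And>env B. le_env env B \<Longrightarrow> ok ((B + 2) ^ c2) e2 env" "1 \<le> c2"
    using E2D[OF b] by blast
  obtain e3 c3 where e3: "\<And>env. eval e3 env = s env" "\<And>env B. le_env env B \<Longrightarrow> ok ((B + 2) ^ c3) e3 env" "1 \<le> c3"
    using E2D[OF s] by blast
  obtain c4 where c4: "\<And>env B. le_env env B \<Longrightarrow> \<gamma> env \<le> (B + 2) ^ c4" using \<open>PB \<gamma>\<close> unfolding PB_def by blast
  \<comment> \<open>\<open>?d\<close> covers counter and accumulator. With \<open>?D\<close> in the
    role of \<open>B\<close>, initial value and body then cost the composed exponents
    \<open>Suc (Suc ?d) * c2\<close> and \<open>Suc (Suc ?d) * c3\<close>.\<close>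
  let ?d = "c1 + c4"
  let ?c = "?d + Suc (Suc ?d) * c2 + Suc (Suc ?d) * c3"
  have k: "ok ((B + 2) ^ ?c) (For e1 e2 e3) env" if env: "le_env env B" for env B
  proof -
    let ?D = "(B + 2) ^ ?d"
    have D: "le_env env ?D" using le_env_mono[OF env, of ?D] B_ge[of ?d B] e1(3) by simp
    have "le_env env ((B + 2) ^ c1)" using le_env_mono[OF env, of "(B + 2) ^ c1"] B_ge[OF e1(3), of B] by simp
    then have nD: "n env \<le> ?D"
      using ok_le'[OF e1(2)[OF env]] le_trans[OF _ B_mono[of c1 ?d B]] e1(1)[of env] by auto
    have \<gamma>D: "\<gamma> env \<le> ?D" using c4[OF env] by (rule le_trans) (rule B_mono, simp)
    have 1: "ok ((B + 2) ^ ?c) e1 env" using ok_mono[OF e1(2)[OF env] B_mono, of ?c] by simp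
    have "ok ((?D + 2) ^ c2) e2 (n env # env)" by (rule e2(2)) (use nD D in simp)
    then have 2: "ok ((B + 2) ^ ?c) e2 (n env # env)"
      by (rule ok_mono) (rule le_trans[OF B_comp B_mono], simp)
    have 3: "ok ((B + 2) ^ ?c) e3 (a # r # env)" if "a \<le> ?D" "r \<le> ?D" for a r
    proof -
      have "ok ((?D + 2) ^ c3) e3 (a # r # env)" by (rule e3(2)) (use that D in simp)
      then show ?thesis by (rule ok_mono) (rule le_trans[OF B_comp B_mono], simp)
    qed
    have "m \<le> n env \<Longrightarrow> a \<le> \<beta> env m \<Longrightarrow>
      okloop (\<lambda>r acc. ok ((B + 2) ^ ?c) e3 (acc # r # env)) (\<lambda>r acc. s (acc # r # env)) m a" for m a
    proof (induction m arbitrary: a)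
      case (Suc m)
      have "a \<le> ?D" using Suc.prems bd[OF Suc.prems(1)] \<gamma>D by linarith
      moreover have "m \<le> ?D" using Suc.prems nD by linarith
      ultimately show ?case using Suc 3 st[of m env a] by simp
    qed simp
    then show ?thesis using 1 2 b0[of env] by (simp add: e1(1) e2(1) e3(1))
  qed
  show ?thesis by (rule E2I[of "For e1 e2 e3", OF _ k]) (simp_all add: e1(1) e2(1) e3(1))
qed

lemma E2_cong: "E2 f \<Longrightarrow> (\<And>env. f env = g env) \<Longrightarrow> E2 g"
  by (simp add: E2_def)

lemma E2_add [E2]: assumes "E2 f" "E2 g" shows "E2 (\<lambda>env. f env + g env)"
proof -
  have l: "loop (\<lambda>r a. Suc a) n x = x + n" for n x by (induction n arbitrary: x) auto
  have "E2 (\<lambda>env. loop (\<lambda>r a. (\<lambda>env. Suc (env $ 0)) (a # r # env)) (g env) ((\<lambda>env. f (tl env)) (g env # env)))"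
    by (rule E2_For[OF assms(2) E2_tl[OF assms(1)] E2_Suc[OF E2_var] PB_add[OF E2_PB[OF assms(1)] E2_PB[OF assms(2)]],
          where \<beta> = "\<lambda>env r. f env + (g env - r)"]) auto
  then show ?thesis by (rule E2_cong) (simp add: l)
qed

lemma E2_diff [E2]: assumes "E2 f" "E2 g" shows "E2 (\<lambda>env. f env - g env)"
proof -
  have l: "loop (\<lambda>r a. a - 1) n x = x - n" for n x by (induction n arbitrary: x) auto
  have "E2 (\<lambda>env. loop (\<lambda>r a. (\<lambda>env. env $ 0 - 1) (a # r # env)) (g env) ((\<lambda>env. f (tl env)) (g env # env)))"
    by (rule E2_For[OF assms(2) E2_tl[OF assms(1)] E2_pred[OF E2_var] E2_PB[OF assms(1)],
          where \<beta> = "\<lambda>env r. f env"]) auto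
  then show ?thesis by (rule E2_cong) (use l in simp)
qed

lemma E2_mult [E2]: assumes "E2 f" "E2 g" shows "E2 (\<lambda>env. f env * g env)"
proof -
  have l: "loop (\<lambda>r a. a + k) n x = x + k * n" for n x k by (induction n arbitrary: x) (auto simp: algebra_simps)
  have "E2 (\<lambda>env. loop (\<lambda>r a. (\<lambda>env. env $ 0 + f (tl (tl env))) (a # r # env)) (g env) ((\<lambda>env. 0) (g env # env)))"
  proof (rule E2_For[OF assms(2) E2_zero E2_add[OF E2_var E2_tl[OF E2_tl[OF assms(1)]]]
        PB_mult[OF E2_PB[OF assms(1)] E2_PB[OF assms(2)]],
          where \<beta> = "\<lambda>env r. f env * (g env - r)"])
    fix env r a assume "r < g env" "a \<le> f env * (g env - Suc r)"
    moreover from this have "g env - r = Suc (g env - Suc r)" by simp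
    ultimately show "(a # r # env) $ 0 + f (tl (tl (a # r # env))) \<le> f env * (g env - r)" by simp
  qed auto
  then show ?thesis by (rule E2_cong) (simp add: l)
qed

definition P2 :: "(nat list \<Rightarrow> bool) \<Rightarrow> bool" where
  "P2 P \<longleftrightarrow> E2 (\<lambda>env. of_bool (P env))"

lemma E2_if [E2]: assumes "P2 P" "E2 f" "E2 g" shows "E2 (\<lambda>env. if P env then f env else g env)"
  using E2_cond[OF assms(1)[unfolded P2_def] assms(2,3)] by (rule E2_cong) auto

lemma P2_cong: "P2 P \<Longrightarrow> (\<And>env. P env = Q env) \<Longrightarrow> P2 Q"
  by (simp add: P2_def)

lemma P2_nonzero: assumes "E2 f" shows "P2 (\<lambda>env. f env \<noteq> 0)"
  unfolding P2_def by (rule E2_cong[OF E2_cond[OF assms E2_const[of 1] E2_zero]]) auto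

lemma P2_not [E2]: assumes "P2 P" shows "P2 (\<lambda>env. \<not> P env)"
  unfolding P2_def by (rule E2_cong[OF E2_if[OF assms E2_zero E2_const[of 1]]]) auto

lemma P2_conj [E2]: assumes "P2 P" "P2 Q" shows "P2 (\<lambda>env. P env \<and> Q env)"
  unfolding P2_def by (rule E2_cong[OF E2_mult[OF assms[unfolded P2_def]]]) auto

lemma P2_disj [E2]: assumes "P2 P" "P2 Q" shows "P2 (\<lambda>env. P env \<or> Q env)"
  by (rule P2_cong[OF P2_not[OF P2_conj[OF P2_not[OF assms(1)] P2_not[OF assms(2)]]]]) blast

lemma P2_less [E2]: assumes "E2 f" "E2 g" shows "P2 (\<lambda>env. f env < g env)"
  by (rule P2_cong[OF P2_nonzero[OF E2_diff[OF assms(2,1)]]]) auto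

lemma P2_le [E2]: assumes "E2 f" "E2 g" shows "P2 (\<lambda>env. f env \<le> g env)"
  by (rule P2_cong[OF P2_not[OF P2_less[OF assms(2,1)]]]) auto

lemma P2_eq [E2]: assumes "E2 f" "E2 g" shows "P2 (\<lambda>env. f env = (g env :: nat))"
  by (rule P2_cong[OF P2_conj[OF P2_le[OF assms] P2_le[OF assms(2,1)]]]) auto

lemma P2_tl: "P2 P \<Longrightarrow> P2 (\<lambda>env. P (tl env))"
  unfolding P2_def by (rule E2_tl)

lemma P2_bex [E2]:
  assumes "E2 n" "P2 (\<lambda>env. P (env $ 0) (tl env))"
  shows "P2 (\<lambda>env. \<exists>x<n env. P x env)"
proof -
  have l: "loop (\<lambda>r a. if Q r then Suc 0 else a) m x = (if \<exists>r<m. Q r then 1 else x)" for Q m x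
    by (induction m arbitrary: x) (auto simp: less_Suc_eq)
  have "E2 (\<lambda>env. loop (\<lambda>r a. (\<lambda>env. if P (tl env $ 0) (tl (tl env)) then 1 else env $ 0) (a # r # env)) (n env) ((\<lambda>env. 0) (n env # env)))"
    by (rule E2_For[OF assms(1) E2_zero E2_if[OF P2_tl[OF assms(2)] E2_const E2_var] E2_PB[OF E2_const[of 1]],
          where \<beta> = "\<lambda>env r. 1"]) auto
  then show ?thesis unfolding P2_def by (rule E2_cong) (simp add: l of_bool_def cong: if_cong)
qed

lemma P2_ball [E2]:
  assumes "E2 n" "P2 (\<lambda>env. P (env $ 0) (tl env))"
  shows "P2 (\<lambda>env. \<forall>x<n env. P x env)"
  by (rule P2_cong[OF P2_not[OF P2_bex[OF assms(1) P2_not[OF assms(2)]]]]) blast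

definition bleast :: "nat \<Rightarrow> (nat \<Rightarrow> bool) \<Rightarrow> nat" where
  "bleast n P = (if \<exists>x<n. P x then LEAST x. P x else n)"

lemma bleastI: "x < n \<Longrightarrow> P x \<Longrightarrow> P (bleast n P) \<and> bleast n P \<le> x"
  unfolding bleast_def by (auto intro: LeastI Least_le)

lemma bleast_equality: "x < n \<Longrightarrow> P x \<Longrightarrow> (\<And>z. z < n \<Longrightarrow> P z \<Longrightarrow> x \<le> z) \<Longrightarrow> bleast n P = x"
  using bleastI[of x n P] by (meson le_antisym le_less_trans)

text \<open>The counter runs downwards, so the last hit to overwrite the accumulator is the smallest
  one.\<close>

lemma loop_bleast: "loop (\<lambda>r a. if P r then r else a) n a = (if \<exists>r<n. P r then bleast n P else a)"
proof (induction n arbitrary: a)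
  case (Suc n)
  show ?case
  proof (cases "\<exists>r<n. P r")
    case True
    then have "bleast (Suc n) P = bleast n P" by (auto simp: bleast_def less_Suc_eq)
    then show ?thesis using True Suc by (auto simp: less_Suc_eq)
  next
    case False
    then have "P n \<Longrightarrow> bleast (Suc n) P = n" by (intro bleast_equality) (auto simp: not_less[symmetric])
    then show ?thesis using False Suc by (auto simp: less_Suc_eq)
  qed
qed simp

lemma E2_bleast [E2]:
  assumes "E2 n" "P2 (\<lambda>env. P (env $ 0) (tl env))"
  shows "E2 (\<lambda>env. bleast (n env) (\<lambda>x. P x env))"
proof -
  have "E2 (\<lambda>env. loop (\<lambda>r a. (\<lambda>env. if P (tl env $ 0) (tl (tl env)) then env $ 1 else env $ 0) (a # r # env))
      (n env) ((\<lambda>env. env $ 0) (n env # env)))"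
    by (rule E2_For[OF assms(1) E2_var E2_if[OF P2_tl[OF assms(2)] E2_var E2_var] E2_PB[OF assms(1)],
          where \<beta> = "\<lambda>env r. n env"]) auto
  then show ?thesis by (rule E2_cong) (simp add: loop_bleast bleast_def cong: if_cong)
qed

lemma E2_div [E2]: assumes "E2 f" "E2 g" shows "E2 (\<lambda>env. f env div g env)"
proof -
  have E: "E2 (\<lambda>env. if g env = 0 then 0 else bleast (Suc (f env)) (\<lambda>x. f env < Suc x * g env))"
    by (intro E2 assms E2_tl[OF assms(1)] E2_tl[OF assms(2)])
  have "bleast (Suc a) (\<lambda>x. a < Suc x * b) = a div b" if "b \<noteq> 0" for a b
  proof (rule bleast_equality)
    show "a div b < Suc a" by (simp add: le_imp_less_Suc)
    show "a < Suc (a div b) * b" using that by (simp add: dividend_less_div_times add.commute)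
    fix z assume "a < Suc z * b"
    then have "a div b < Suc z" using that by (simp add: less_mult_imp_div_less)
    then show "a div b \<le> z" by simp
  qed
  then have "(if b = 0 then 0 else bleast (Suc a) (\<lambda>x. a < Suc x * b)) = a div b" for a b by simp
  then show ?thesis by (intro E2_cong[OF E]) blast
qed

lemma E2_mod [E2]: assumes "E2 f" "E2 g" shows "E2 (\<lambda>env. f env mod g env)"
  using E2_diff[OF assms(1) E2_mult[OF E2_div[OF assms] assms(2)]]
  by (rule E2_cong) (simp add: minus_div_mult_eq_mod)

lemma E2_min [E2]: assumes "E2 f" "E2 g" shows "E2 (\<lambda>env. min (f env) (g env))"
  unfolding min_def by (intro E2 assms)

lemma E2_max [E2]: assumes "E2 f" "E2 g" shows "E2 (\<lambda>env. max (f env) (g env))"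
  unfolding max_def by (intro E2 assms)

lemma E2_power [E2]: assumes "E2 f" shows "E2 (\<lambda>env. f env ^ k)"
  by (induction k) (auto intro: E2 assms)

lemma loop_funpow: "loop (\<lambda>r. F) n a = (F ^^ n) a"
  by (induction n arbitrary: a) (auto simp: funpow_swap1)

lemma E2_funpow:
  assumes "E2 n" "E2 a" "E2 (\<lambda>env. F (env $ 0) (tl env))" "PB \<gamma>"
    and "\<And>env. a env \<le> \<gamma> env" "\<And>env x. x \<le> \<gamma> env \<Longrightarrow> F x env \<le> \<gamma> env"
  shows "E2 (\<lambda>env. ((\<lambda>x. F x env) ^^ n env) (a env))"
proof -
  have s: "E2 (\<lambda>env. F (env $ 0) (tl (tl env)))"
    using E2_skip[OF assms(3)] by simp
  have "E2 (\<lambda>env. loop (\<lambda>r x. (\<lambda>env. F (env $ 0) (tl (tl env))) (x # r # env)) (n env) ((\<lambda>env. a (tl env)) (n env # env)))"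
    by (rule E2_For[OF assms(1) E2_tl[OF assms(2)] s assms(4), where \<beta> = "\<lambda>env r. \<gamma> env"]) (use assms(5,6) in auto)
  then show ?thesis by (rule E2_cong) (simp add: loop_funpow)
qed

lemma E2_sum: "(\<And>v. E2 (h v)) \<Longrightarrow> E2 (\<lambda>env. \<Sum>v<(k::nat). h v env)"
  by (induction k) (auto intro: E2)

text \<open>Any function \<open>\<phi>\<close> whatsoever is admissible on arguments from a fixed
  finite range: it is a finite case distinction, written as a sum over the possible values. This is
  how the transition function of an arbitrary machine enters.\<close>

lemma E2_table:
  "(\<And>f. f \<in> set fs \<Longrightarrow> E2 f \<and> (\<forall>env. f env < k)) \<Longrightarrow> E2 (\<lambda>env. \<phi> (map (\<lambda>f. f env) fs))"
proof (induction fs arbitrary: \<phi>)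
  case Nil
  then show ?case by (simp add: E2)
next
  case (Cons f fs)
  have "E2 (\<lambda>env. \<Sum>v<k. if f env = v then \<phi> (v # map (\<lambda>f. f env) fs) else 0)"
    using Cons.prems by (intro E2 E2_sum Cons.IH[where \<phi> = "\<lambda>l. \<phi> (v # l)" for v]) auto
  moreover have "(\<Sum>v<k. if f env = v then \<phi> (v # map (\<lambda>f. f env) fs) else 0) = \<phi> (map (\<lambda>f. f env) (f # fs))" for env
    using Cons.prems by simp
  ultimately show ?case by (rule E2_cong)
qed

section \<open>Tuples as numerals in base N\<close>

text \<open>Entries are truncated at \<open>N - 1\<close>, so the code is at most
  \<open>N ^ length xs\<close> for arbitrary entries. This bounds the iterated step function in
  advance, even on configurations that overflow.\<close>

fun cmk :: "nat \<Rightarrow> nat list \<Rightarrow> nat" where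
  "cmk N [] = 0"
| "cmk N (x # xs) = min x (N - 1) + N * cmk N xs"

definition cget :: "nat \<Rightarrow> nat \<Rightarrow> nat \<Rightarrow> nat" where
  "cget N c j = (c div N ^ j) mod N"

lemma cget_cmk: "(\<And>x. x \<in> set xs \<Longrightarrow> x < N) \<Longrightarrow> j < length xs \<Longrightarrow> cget N (cmk N xs) j = xs ! j"
proof (induction xs arbitrary: j)
  case (Cons x xs)
  then have x: "x < N" by simp
  then have "cmk N (x # xs) div N = cmk N xs" "cmk N (x # xs) mod N = x" by (auto simp: min_def)
  then show ?case using Cons by (cases j) (auto simp: cget_def div_mult2_eq)
qed simp

lemma cmk_less: "0 < N \<Longrightarrow> cmk N xs < N ^ length xs"
proof (induction xs)
  case (Cons x xs)
  then have "cmk N xs + 1 \<le> N ^ length xs" by simp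
  then have "N * (cmk N xs + 1) \<le> N * N ^ length xs" by (rule mult_le_mono2)
  moreover have "min x (N - 1) < N" using Cons by simp
  ultimately show ?case by (simp add: cmk.simps)
qed (simp add: cmk.simps)

lemma cmk_le: "cmk N xs \<le> N ^ length xs"
proof (cases "N = 0")
  case True
  then show ?thesis by (cases xs) (auto simp: cmk.simps)
qed (auto intro: less_imp_le cmk_less)

lemma E2_cmk:
  "E2 N \<Longrightarrow> (\<And>f. f \<in> set fs \<Longrightarrow> E2 f) \<Longrightarrow> E2 (\<lambda>env. cmk (N env) (map (\<lambda>f. f env) fs))"
  by (induction fs) (auto intro!: E2 simp: cmk.simps)

lemma E2_cget [E2]: "E2 N \<Longrightarrow> E2 c \<Longrightarrow> E2 (\<lambda>env. cget (N env) (c env) j)"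
  unfolding cget_def by (intro E2)

text \<open>A power with variable exponent is not polynomially bounded. Capping it at
  \<open>N\<close> makes it admissible and keeps it exact as long as it is at most
  \<open>N\<close>.\<close>

definition pw :: "nat \<Rightarrow> nat \<Rightarrow> nat \<Rightarrow> nat" where
  "pw N g x = ((\<lambda>a. min (a * g) N) ^^ x) 1"

lemma pw_eq: "g ^ x \<le> N \<Longrightarrow> 0 < g \<Longrightarrow> pw N g x = g ^ x"
proof (induction x)
  case (Suc x)
  have "g ^ x \<le> g ^ Suc x" using Suc.prems(2) by (intro power_increasing) auto
  also have "\<dots> \<le> N" by (rule Suc.prems(1))
  finally show ?case using Suc by (simp add: pw_def mult.commute)
qed (simp add: pw_def)

lemma E2_pw [E2]: assumes "E2 N" "E2 x" shows "E2 (\<lambda>env. pw (N env) g (x env))"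
proof -
  have "E2 (\<lambda>env. ((\<lambda>a. min (a * g) (N env)) ^^ x env) 1)"
    by (rule E2_funpow[OF assms(2) E2_const _ E2_PB[OF E2_add[OF assms(1) E2_const[of 1]]]])
      (use assms in \<open>auto intro!: E2 E2_tl\<close>)
  then show ?thesis by (simp add: pw_def)
qed

section \<open>Arithmetization of a machine\<close>

definition dsym :: "nat \<Rightarrow> insym" where
  "dsym u = (if u = 0 then LeftMarker else if u = 1 then Bit False else if u = 2 then Bit True else RightMarker)"

text \<open>For \<open>P = 2 ^ i\<close> with \<open>i > 0\<close>, dividing a code by
  \<open>P div 2\<close> removes the first \<open>i - 1\<close> bits; the quotient is 1 exactly when
  only the end marker is left, that is, at the right end of the input.\<close>

definition esym :: "nat \<Rightarrow> nat \<Rightarrow> nat" where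
  "esym x P = (if P = 1 then 0 else if x div (P div 2) = 1 then 3 else 1 + (x div (P div 2)) mod 2)"

text \<open>The position \<open>i\<close> of an input head is represented by \<open>P = 2 ^ i\<close>, and an input \<open>x\<close> by \<^term>\<open>code x\<close>.\<close>

lemma code_div: "i \<le> length x \<Longrightarrow> code x div 2 ^ i = code (drop i x)"
proof (induction i arbitrary: x)
  case (Suc i)
  then obtain b xs where x: "x = b # xs" by (cases x) auto
  have "code x div 2 = code xs" by (simp add: x)
  then have "code x div 2 ^ Suc i = code xs div 2 ^ i" by (simp add: div_mult2_eq)
  then show ?case using Suc x by simp
qed simp

lemma code_eq_1: "code x = 1 \<longleftrightarrow> x = []"
  using code_inj[of x "[]"] by auto

lemma esym: "i \<le> length x + 1 \<Longrightarrow> dsym (esym (code x) (2 ^ i)) = input_sym x i"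
proof (cases i)
  case (Suc j)
  assume i: "i \<le> length x + 1"
  have P: "(2::nat) ^ i \<noteq> 1" "(2::nat) ^ i div 2 = 2 ^ j" using Suc by auto
  have d: "code x div 2 ^ j = code (drop j x)" using code_div i Suc by simp
  show ?thesis
  proof (cases "j = length x")
    case True
    then show ?thesis unfolding esym_def P(2) d using P(1) Suc by (simp add: dsym_def input_sym_def)
  next
    case False
    then have j: "j < length x" using i Suc by simp
    then have "drop j x = x ! j # drop (Suc j) x" by (simp add: Cons_nth_drop_Suc)
    then have "code (drop j x) mod 2 = of_bool (x ! j)" by (simp del: drop_Suc)
    moreover have "code (drop j x) \<noteq> 1" using code_eq_1[of "drop j x"] j by simp
    ultimately show ?thesis unfolding esym_def P(2) d using P(1) Suc j
      by (simp add: dsym_def input_sym_def)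
  qed
qed (simp add: esym_def dsym_def input_sym_def)

lemma esym_less: "esym x P < 4"
  by (auto simp: esym_def)

fun dcode :: "dir \<Rightarrow> nat" where
  "dcode MoveLeft = 0"
| "dcode Stay = 1"
| "dcode MoveRight = 2"

definition move_pos :: "nat \<Rightarrow> nat \<Rightarrow> nat \<Rightarrow> nat" where
  "move_pos x P d = (if d = 0 then max 1 (P div 2)
     else if d = 2 then (if x div (P div 2) = 1 then P else 2 * P) else P)"

lemma move_pos: "i \<le> length x + 1 \<Longrightarrow> move_pos (code x) (2 ^ i) (dcode d) = 2 ^ move_input x d i"
proof (cases d)
  case MoveLeft
  then show ?thesis by (cases i) (auto simp: move_pos_def max_def Suc_le_eq)
next
  case MoveRight
  assume i: "i \<le> length x + 1"
  show ?thesis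
  proof (cases i)
    case 0
    then show ?thesis using MoveRight by (simp add: move_pos_def)
  next
    case (Suc j)
    then have "code x div (2 ^ i div 2) = code (drop j x)" using code_div[of j x] i by simp
    moreover have "code (drop j x) = 1 \<longleftrightarrow> j = length x" using i Suc code_eq_1[of "drop j x"] by auto
    ultimately show ?thesis using MoveRight i Suc by (auto simp: move_pos_def min_def)
  qed
qed (simp add: move_pos_def)

context
  fixes U :: tm
begin

abbreviation "nt \<equiv> num_tapes U"
abbreviation "ns \<equiv> num_symbols U"

definition key_act :: "nat list \<Rightarrow> action option" where
  "key_act ks = trans U (ks ! 0) (dsym (ks ! 1)) (dsym (ks ! 2)) (drop 3 ks)"

text \<open>Layout of a configuration \<open>\<gamma>\<close>: entry 0 is the state, 1 and 2 are the
  input positions, 3 and 4 are \<open>2 ^ length\<close> and \<open>code\<close> of the output; from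
  5 on come the tapes as numerals in base \<open>ns\<close>, then for each head the place value of
  the scanned digit.\<close>

definition read_sq :: "(nat \<Rightarrow> nat) \<Rightarrow> nat \<Rightarrow> nat" where
  "read_sq \<gamma> i = (\<gamma> (5 + i) div \<gamma> (5 + nt + i)) mod ns"

text \<open>Everything the transition function looks at. Each entry is bounded by a constant of
  \<open>U\<close>, the state by force through \<open>min\<close>, so that \<open>E2_table\<close>
  applies to every function of the keys.\<close>

definition keys :: "nat \<Rightarrow> nat \<Rightarrow> (nat \<Rightarrow> nat) \<Rightarrow> nat list" where
  "keys x y \<gamma> = [min (\<gamma> 0) (num_states U), esym x (\<gamma> 1), esym y (\<gamma> 2)] @ map (read_sq \<gamma>) [0..<nt]"

text \<open>Here and in the next components the value chosen when there is no action reproduces the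
  old configuration, so that halting becomes reaching a fixed point.\<close>

definition k_state :: "nat list \<Rightarrow> nat" where
  "k_state ks = (case key_act ks of None \<Rightarrow> ks ! 0 | Some a \<Rightarrow> next_state a)"

definition k_prog :: "nat list \<Rightarrow> nat" where
  "k_prog ks = (case key_act ks of None \<Rightarrow> 1 | Some a \<Rightarrow> dcode (prog_dir a))"

definition k_cond :: "nat list \<Rightarrow> nat" where
  "k_cond ks = (case key_act ks of None \<Rightarrow> 1 | Some a \<Rightarrow> dcode (cond_dir a))"

definition k_write :: "nat \<Rightarrow> nat list \<Rightarrow> nat" where
  "k_write i ks = (case key_act ks of None \<Rightarrow> ks ! (3 + i) | Some a \<Rightarrow> fst (work_acts a ! i))"

definition k_dir :: "nat \<Rightarrow> nat list \<Rightarrow> nat" where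
  "k_dir i ks = (case key_act ks of None \<Rightarrow> 1 | Some a \<Rightarrow> dcode (snd (work_acts a ! i)))"

definition k_emit :: "nat list \<Rightarrow> nat" where
  "k_emit ks = (case key_act ks of None \<Rightarrow> 0 | Some a \<Rightarrow>
     (case emit a of None \<Rightarrow> 0 | Some b \<Rightarrow> 1 + of_bool b))"

text \<open>Exchanges one digit; the new one is added before the old one is subtracted, so that
  natural subtraction cuts nothing off.\<close>

definition new_tape :: "(nat \<Rightarrow> nat) \<Rightarrow> nat list \<Rightarrow> nat \<Rightarrow> nat" where
  "new_tape \<gamma> ks i = \<gamma> (5 + i) + k_write i ks * \<gamma> (5 + nt + i) - read_sq \<gamma> i * \<gamma> (5 + nt + i)"

definition new_head :: "(nat \<Rightarrow> nat) \<Rightarrow> nat list \<Rightarrow> nat \<Rightarrow> nat" where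
  "new_head \<gamma> ks i = (if k_dir i ks = 0 then \<gamma> (5 + nt + i) div ns
     else if k_dir i ks = 2 then \<gamma> (5 + nt + i) * ns else \<gamma> (5 + nt + i))"

definition stepv :: "nat \<Rightarrow> nat \<Rightarrow> (nat \<Rightarrow> nat) \<Rightarrow> nat list" where
  "stepv x y \<gamma> = (let ks = keys x y \<gamma> in
     [k_state ks, move_pos x (\<gamma> 1) (k_prog ks), move_pos y (\<gamma> 2) (k_cond ks),
      \<gamma> 3 * (if k_emit ks = 0 then 1 else 2), \<gamma> 4 + k_emit ks * \<gamma> 3]
     @ map (new_tape \<gamma> ks) [0..<nt] @ map (new_head \<gamma> ks) [0..<nt])"

lemma length_stepv [simp]: "length (stepv x y \<gamma>) = 5 + 2 * nt"
  by (simp add: stepv_def Let_def)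

lemma stepv_cong: "(\<And>j. j < 5 + 2 * nt \<Longrightarrow> \<gamma> j = \<delta> j) \<Longrightarrow> stepv x y \<gamma> = stepv x y \<delta>"
proof -
  assume a: "\<And>j. j < 5 + 2 * nt \<Longrightarrow> \<gamma> j = \<delta> j"
  have r: "read_sq \<gamma> i = read_sq \<delta> i" if "i < nt" for i using a that by (simp add: read_sq_def)
  then have k: "keys x y \<gamma> = keys x y \<delta>" using a by (simp add: keys_def)
  have t: "new_tape \<gamma> ks i = new_tape \<delta> ks i" "new_head \<gamma> ks i = new_head \<delta> ks i" if "i < nt" for i ks
    using a that r[OF that] by (simp_all add: new_tape_def new_head_def)
  show ?thesis by (simp add: stepv_def Let_def k a t cong: map_cong)
qed

definition stepc :: "nat \<Rightarrow> nat \<Rightarrow> nat \<Rightarrow> nat \<Rightarrow> nat" where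
  "stepc N x y c = cmk N (stepv x y (cget N c))"

text \<open>Both input heads start at position 1, hence the entries 2; the entries 1 are
  \<open>2 ^ 0\<close> and \<open>code []\<close>. Work tapes are represented on the window from
  \<open>-J\<close> to \<open>J\<close>, where cell 0 is digit number \<open>J\<close>.\<close>

definition initc :: "nat \<Rightarrow> nat \<Rightarrow> nat" where
  "initc N J = cmk N ([0, 2, 2, 1, 1] @ map (\<lambda>_. 0) [0..<nt] @ map (\<lambda>_. pw N ns J) [0..<nt])"

definition sim :: "nat \<Rightarrow> nat \<Rightarrow> nat \<Rightarrow> nat \<Rightarrow> nat" where
  "sim N J x y = cget N ((stepc N x y ^^ (N ^ (5 + 2 * nt))) (initc N J)) 4"

lemma E2_keys:
  assumes N: "E2 N" and x: "E2 x" and y: "E2 y" and c: "E2 c" and ns: "0 < ns"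
  shows "E2 (\<lambda>env. \<phi> (keys (x env) (y env) (cget (N env) (c env))))"
proof -
  let ?fs = "[\<lambda>env. min (cget (N env) (c env) 0) (num_states U),
      \<lambda>env. esym (x env) (cget (N env) (c env) 1), \<lambda>env. esym (y env) (cget (N env) (c env) 2)]
      @ map (\<lambda>i env. read_sq (cget (N env) (c env)) i) [0..<nt]"
  have "E2 (\<lambda>env. \<phi> (map (\<lambda>f. f env) ?fs))"
  proof (rule E2_table[where k = "num_states U + 4 + ns"])
    fix f assume "f \<in> set ?fs"
    moreover have "read_sq \<gamma> i < ns" for \<gamma> i using ns by (simp add: read_sq_def)
    moreover have "esym a b < num_states U + 4 + ns" for a b using esym_less[of a b] by simp
    moreover have "E2 (\<lambda>env. esym (x env) (cget (N env) (c env) 1))"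
      "E2 (\<lambda>env. esym (y env) (cget (N env) (c env) 2))"
      unfolding esym_def by (intro E2 assms)+
    moreover have "E2 (\<lambda>env. read_sq (cget (N env) (c env)) i)" for i
      unfolding read_sq_def by (intro E2 assms)
    ultimately show "E2 f \<and> (\<forall>env. f env < num_states U + 4 + ns)"
      by (auto intro!: E2 assms simp: min_def trans_less_add2)
  qed
  then show ?thesis by (rule E2_cong) (simp add: keys_def comp_def)
qed

lemma E2_stepc:
  assumes N: "E2 N" and x: "E2 x" and y: "E2 y" and c: "E2 c" and ns: "0 < ns"
  shows "E2 (\<lambda>env. stepc (N env) (x env) (y env) (c env))"
proof -
  note K = E2_keys[OF assms]
  let ?\<gamma> = "\<lambda>env. cget (N env) (c env)"
  let ?ks = "\<lambda>env. keys (x env) (y env) (?\<gamma> env)"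
  let ?fs = "[\<lambda>env. k_state (?ks env), \<lambda>env. move_pos (x env) (?\<gamma> env 1) (k_prog (?ks env)),
      \<lambda>env. move_pos (y env) (?\<gamma> env 2) (k_cond (?ks env)),
      \<lambda>env. ?\<gamma> env 3 * (if k_emit (?ks env) = 0 then 1 else 2),
      \<lambda>env. ?\<gamma> env 4 + k_emit (?ks env) * ?\<gamma> env 3]
      @ map (\<lambda>i env. new_tape (?\<gamma> env) (?ks env) i) [0..<nt] @ map (\<lambda>i env. new_head (?\<gamma> env) (?ks env) i) [0..<nt]"
  have "E2 (\<lambda>env. cmk (N env) (map (\<lambda>f. f env) ?fs))"
  proof (rule E2_cmk[OF N])
    fix f assume f: "f \<in> set ?fs"
    have "E2 (\<lambda>env. new_tape (?\<gamma> env) (?ks env) i)" for i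
      unfolding new_tape_def read_sq_def by (intro E2 K assms)
    moreover have "E2 (\<lambda>env. new_head (?\<gamma> env) (?ks env) i)" for i
      unfolding new_head_def by (intro E2 K assms)
    moreover have "E2 (\<lambda>env. move_pos (x env) (?\<gamma> env 1) (k_prog (?ks env)))"
      "E2 (\<lambda>env. move_pos (y env) (?\<gamma> env 2) (k_cond (?ks env)))"
      unfolding move_pos_def by (intro E2 K assms)+
    moreover have "E2 (\<lambda>env. k_state (?ks env))" by (rule K)
    moreover have "E2 (\<lambda>env. ?\<gamma> env 3 * (if k_emit (?ks env) = 0 then 1 else 2))"
      "E2 (\<lambda>env. ?\<gamma> env 4 + k_emit (?ks env) * ?\<gamma> env 3)" by (intro E2 K assms)+
    ultimately show "E2 f" using f by (auto simp del: One_nat_def)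
  qed
  then show ?thesis by (rule E2_cong) (simp add: stepc_def stepv_def Let_def comp_def)
qed

lemma E2_sim:
  assumes N: "E2 N" and J: "E2 J" and x: "E2 x" and y: "E2 y" and ns: "0 < ns"
  shows "E2 (\<lambda>env. sim (N env) (J env) (x env) (y env))"
proof -
  have "E2 (\<lambda>env. cmk (N env) (map (\<lambda>f. f env) ([\<lambda>_. 0, \<lambda>_. 2, \<lambda>_. 2, \<lambda>_. 1, \<lambda>_. 1] @ map (\<lambda>_ _. 0) [0..<nt]
     @ map (\<lambda>_ env. pw (N env) ns (J env)) [0..<nt])))"
    by (rule E2_cmk[OF N]) (use N J in \<open>auto intro!: E2\<close>)
  then have i: "E2 (\<lambda>env. initc (N env) (J env))"
    by (rule E2_cong) (simp add: initc_def comp_def)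
  have "E2 (\<lambda>env. ((\<lambda>c. stepc (N env) (x env) (y env) c) ^^ (N env ^ (5 + 2 * nt))) (initc (N env) (J env)))"
  proof (rule E2_funpow[OF _ i _ PB_power[OF E2_PB[OF N], of "5 + 2 * nt"]])
    show "E2 (\<lambda>env. N env ^ (5 + 2 * nt))" by (intro E2 N)
    show "E2 (\<lambda>env. stepc (N (tl env)) (x (tl env)) (y (tl env)) (env $ 0))"
      by (intro E2_stepc E2_tl assms E2)
    show "initc (N env) (J env) \<le> N env ^ (5 + 2 * nt)" for env
    proof -
      let ?xs = "[0, 2, 2, 1, 1] @ map (\<lambda>_. 0) [0..<nt] @ map (\<lambda>_. pw (N env) ns (J env)) [0..<nt]"
      have "length ?xs = 5 + 2 * nt" by simp
      then show ?thesis using cmk_le[of "N env" ?xs] unfolding initc_def by metis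
    qed
    show "stepc (N env) (x env) (y env) c \<le> N env ^ (5 + 2 * nt)" for env c
      using cmk_le[of "N env" "stepv (x env) (y env) (cget (N env) c)"] unfolding stepc_def length_stepv .
  qed
  then show ?thesis unfolding sim_def by (intro E2 N)
qed


section \<open>Faithfulness of the arithmetized simulation\<close>

lemma digit_sum_less: "(\<And>j. j < m \<Longrightarrow> f j < g) \<Longrightarrow> (\<Sum>j<m. f j * g ^ j) < (g::nat) ^ m"
proof (induction m)
  case (Suc m)
  have "(\<Sum>j<m. f j * g ^ j) < g ^ m" using Suc by simp
  moreover have "(f m + 1) * g ^ m \<le> g * g ^ m" using Suc.prems[of m] by (intro mult_le_mono1) simp
  ultimately show ?case by simp
qed simp

lemma digit_sum:
  "(\<And>j. j < m \<Longrightarrow> f j < g) \<Longrightarrow> i < m \<Longrightarrow> ((\<Sum>j<m. f j * g ^ j) div (g::nat) ^ i) mod g = f i"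
proof (induction m)
  case (Suc m)
  have g: "0 < g" using Suc.prems(1)[of 0] by simp
  show ?case
  proof (cases "i = m")
    case True
    have "(\<Sum>j<m. f j * g ^ j) < g ^ m" using digit_sum_less Suc.prems(1) by simp
    then show ?thesis using True Suc.prems g by simp
  next
    case False
    then have i: "i < m" using Suc.prems(2) by simp
    have e: "f m * g ^ m = (f m * g ^ (m - Suc i) * g) * g ^ i"
    proof -
      have "m = (m - Suc i) + 1 + i" using i by simp
      then have "g ^ m = g ^ (m - Suc i) * g * g ^ i" by (metis power_add power_one_right)
      then show ?thesis by simp
    qed
    have "((\<Sum>j<m. f j * g ^ j) + f m * g ^ m) div g ^ i = (\<Sum>j<m. f j * g ^ j) div g ^ i + f m * g ^ (m - Suc i) * g"
      unfolding e using g by simp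
    then show ?thesis using Suc.IH Suc.prems(1) i by simp
  qed
qed simp

lemma sum_upd:
  fixes f :: "nat \<Rightarrow> nat"
  assumes "i < m"
  shows "(\<Sum>j<m. (f(i := w)) j * g ^ j) = (\<Sum>j<m. f j * g ^ j) + w * g ^ i - f i * g ^ i"
proof -
  have "(\<Sum>j<m. h j * g ^ j) = h i * g ^ i + (\<Sum>j\<in>{..<m} - {i}. h j * g ^ j)" for h
    using assms by (simp add: sum.remove)
  note this[of f] this[of "f(i := w)"]
  moreover have "(\<Sum>j\<in>{..<m} - {i}. (f(i := w)) j * g ^ j) = (\<Sum>j\<in>{..<m} - {i}. f j * g ^ j)"
    by (rule sum.cong) auto
  ultimately show ?thesis by simp
qed

text \<open>The leading one at place \<open>length x\<close> gives way to \<open>b\<close> and moves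
  up one place. This is why a step adds \<open>k_emit ks * \<gamma> 3\<close> to the output, with
  \<open>k_emit\<close> equal to 1 plus the bit.\<close>

lemma code_append: "code (x @ [b]) = code x + (1 + of_bool b) * 2 ^ length x"
  by (induction x) auto

lemma code_less': "code x < 2 ^ Suc (length x)"
  using code_less[of x "Suc (length x)"] by simp

definition repv :: "nat \<Rightarrow> config \<Rightarrow> nat list" where
  "repv S c = [cur_state c, 2 ^ prog_pos c, 2 ^ cond_pos c, 2 ^ length (out_tape c), code (out_tape c)]
     @ map (\<lambda>i. \<Sum>j<2 * S + 1. tape c i (int j - int S) * ns ^ j) [0..<nt]
     @ map (\<lambda>i. ns ^ nat (head c i + int S)) [0..<nt]"

lemma length_repv [simp]: "length (repv S c) = 5 + 2 * nt"
  by (simp add: repv_def)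

lemma repv_nth:
  "repv S c ! 0 = cur_state c" "repv S c ! 1 = 2 ^ prog_pos c" "repv S c ! 2 = 2 ^ cond_pos c"
  "repv S c ! 3 = 2 ^ length (out_tape c)" "repv S c ! 4 = code (out_tape c)"
  "i < nt \<Longrightarrow> repv S c ! (5 + i) = (\<Sum>j<2 * S + 1. tape c i (int j - int S) * ns ^ j)"
  "i < nt \<Longrightarrow> repv S c ! (5 + nt + i) = ns ^ nat (head c i + int S)"
  by (simp_all add: repv_def nth_append numeral_eq_Suc)

definition valid :: "bitstring \<Rightarrow> bitstring \<Rightarrow> config \<Rightarrow> bool" where
  "valid p y c \<longleftrightarrow> cur_state c < num_states U \<and> prog_pos c \<le> length p + 1 \<and> cond_pos c \<le> length y + 1 \<and>
     (\<forall>i<nt. \<forall>z. tape c i z < ns)"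

lemma move_input_le: "i \<le> length x + 1 \<Longrightarrow> move_input x d i \<le> length x + 1"
  by (cases d) auto

lemma next_action_wf:
  assumes tm: "turing_machine U" and v: "valid p y c" and a: "next_action U p y c = Some a"
  shows "next_state a < num_states U" "length (work_acts a) = nt" "i < nt \<Longrightarrow> fst (work_acts a ! i) < ns"
proof -
  let ?ws = "map (\<lambda>i. tape c i (head c i)) [0..<nt]"
  have "cur_state c < num_states U" "set ?ws \<subseteq> {..<ns}" "length ?ws = nt"
    using v by (auto simp: valid_def)
  then have *: "next_state a < num_states U \<and> length (work_acts a) = nt \<and> (\<forall>(w, d)\<in>set (work_acts a). w < ns)"
    using tm a unfolding turing_machine_def next_action_def by blast
  then show "next_state a < num_states U" "length (work_acts a) = nt" by auto
  show "i < nt \<Longrightarrow> fst (work_acts a ! i) < ns" using * by (metis case_prod_beta nth_mem)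
qed

lemma valid_step: "turing_machine U \<Longrightarrow> valid p y c \<Longrightarrow> valid p y (step U p y c)"
proof (cases "next_action U p y c")
  case (Some a)
  assume "turing_machine U" "valid p y c"
  then show ?thesis
    using next_action_wf[OF _ _ Some] move_input_le unfolding step_def Some
    by (auto simp: valid_def perform_def)
qed (simp add: step_def)

lemma valid_init: "turing_machine U \<Longrightarrow> valid p y init_config"
  by (auto simp: turing_machine_def valid_def init_config_def)

lemma stepv_repv:
  assumes tm: "turing_machine U" and v: "valid p y c"
    and h: "\<And>i. i < nt \<Longrightarrow> \<bar>head c i\<bar> \<le> int S" and h': "\<And>i. i < nt \<Longrightarrow> \<bar>head (step U p y c) i\<bar> \<le> int S"
  shows "stepv (code p) (code y) ((!) (repv S c)) = repv S (step U p y c)"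
proof -
  let ?\<gamma> = "(!) (repv S c)"
  define ks where "ks = keys (code p) (code y) ?\<gamma>"
  have ns: "0 < ns" using tm by (auto simp: turing_machine_def)
  have hS: "nat (head c i + int S) < 2 * S + 1" "int (nat (head c i + int S)) - int S = head c i" if "i < nt" for i
    using h[OF that] by auto
  have r: "read_sq ?\<gamma> i = tape c i (head c i)" if i: "i < nt" for i
  proof -
    have "((\<Sum>j<2 * S + 1. tape c i (int j - int S) * ns ^ j) div ns ^ nat (head c i + int S)) mod ns
      = tape c i (int (nat (head c i + int S)) - int S)"
      by (rule digit_sum) (use v i hS in \<open>auto simp: valid_def\<close>)
    then show ?thesis unfolding read_sq_def repv_nth(6,7)[OF i] using hS[OF i] by simp
  qed
  have ks: "ks = [cur_state c, esym (code p) (2 ^ prog_pos c), esym (code y) (2 ^ cond_pos c)] @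
      map (\<lambda>i. tape c i (head c i)) [0..<nt]"
    unfolding ks_def keys_def repv_nth using v r by (auto simp: valid_def)
  have ks0: "ks ! 0 = cur_state c" and ks3: "i < nt \<Longrightarrow> ks ! (3 + i) = tape c i (head c i)" for i
    by (simp_all add: ks)
  have act: "key_act ks = next_action U p y c"
    using v by (simp add: key_act_def ks next_action_def esym valid_def del: upt_Suc)
  have st: "k_state ks = cur_state (step U p y c)"
    using ks0 by (simp add: k_state_def act step_def perform_def split: option.split)
  have pp: "move_pos (code p) (2 ^ prog_pos c) (k_prog ks) = 2 ^ prog_pos (step U p y c)"
  proof (cases "next_action U p y c")
    case None
    then show ?thesis by (simp add: k_prog_def act step_def move_pos_def)
  next
    case (Some a)
    then show ?thesis using move_pos[of "prog_pos c" p "prog_dir a"] v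
      by (simp add: k_prog_def act step_def perform_def valid_def)
  qed
  have cp: "move_pos (code y) (2 ^ cond_pos c) (k_cond ks) = 2 ^ cond_pos (step U p y c)"
  proof (cases "next_action U p y c")
    case None
    then show ?thesis by (simp add: k_cond_def act step_def move_pos_def)
  next
    case (Some a)
    then show ?thesis using move_pos[of "cond_pos c" y "cond_dir a"] v
      by (simp add: k_cond_def act step_def perform_def valid_def)
  qed
  have o1: "2 ^ length (out_tape c) * (if k_emit ks = 0 then 1 else 2) = (2::nat) ^ length (out_tape (step U p y c))"
    by (auto simp: k_emit_def act step_def perform_def split: option.split)
  have o2: "code (out_tape c) + k_emit ks * 2 ^ length (out_tape c) = code (out_tape (step U p y c))"
    by (auto simp: k_emit_def act step_def perform_def code_append split: option.split)
  have t: "new_tape ?\<gamma> ks i = (\<Sum>j<2 * S + 1. tape (step U p y c) i (int j - int S) * ns ^ j)" if i: "i < nt" for i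
  proof -
    let ?f = "\<lambda>j. tape c i (int j - int S)" and ?k = "nat (head c i + int S)"
    have fk: "?f ?k = tape c i (head c i)" using hS[OF i] by simp
    have w: "tape (step U p y c) i = (tape c i)(head c i := k_write i ks)"
      using i by (cases "next_action U p y c") (auto simp: k_write_def act step_def perform_def ks3 simp del: add_Suc)
    have "(\<lambda>j. tape (step U p y c) i (int j - int S)) = ?f(?k := k_write i ks)"
      unfolding w using h[OF i] by (auto simp: fun_eq_iff)
    then have "(\<Sum>j<2 * S + 1. tape (step U p y c) i (int j - int S) * ns ^ j)
      = (\<Sum>j<2 * S + 1. (?f(?k := k_write i ks)) j * ns ^ j)" by metis
    also have "\<dots> = (\<Sum>j<2 * S + 1. ?f j * ns ^ j) + k_write i ks * ns ^ ?k - ?f ?k * ns ^ ?k"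
      by (rule sum_upd) (rule hS(1)[OF i])
    finally show ?thesis unfolding new_tape_def repv_nth(6,7)[OF i] r[OF i] fk by simp
  qed
  have hd: "new_head ?\<gamma> ks i = ns ^ nat (head (step U p y c) i + int S)" if i: "i < nt" for i
  proof -
    obtain d where d: "k_dir i ks = dcode d" "head (step U p y c) i = move_work d (head c i)"
    proof (cases "next_action U p y c")
      case None
      then show ?thesis by (intro that[of Stay]) (auto simp: k_dir_def act step_def)
    next
      case (Some a)
      then show ?thesis using i by (intro that[of "snd (work_acts a ! i)"]) (auto simp: k_dir_def act step_def perform_def)
    qed
    show ?thesis
    proof (cases d)
      case MoveLeft
      \<comment> \<open>The head is still inside the window after the step, so the old place value
        has a factor \<open>ns\<close> and the division is exact.\<close>
      then have "nat (head c i + int S) = Suc (nat (head (step U p y c) i + int S))"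
        using d(2) h'[OF i] by auto
      then show ?thesis unfolding new_head_def repv_nth(7)[OF i] d(1) using MoveLeft ns by simp
    next
      case Stay
      then show ?thesis unfolding new_head_def repv_nth(7)[OF i] d by simp
    next
      case MoveRight
      then have "nat (head (step U p y c) i + int S) = Suc (nat (head c i + int S))"
        using d(2) h[OF i] by auto
      then show ?thesis unfolding new_head_def repv_nth(7)[OF i] d(1) using MoveRight by simp
    qed
  qed
  show ?thesis
    unfolding stepv_def Let_def ks_def[symmetric] unfolding repv_nth st pp cp o1 o2 repv_def[of S "step U p y c"]
    using t hd by (auto cong: map_cong)
qed

lemma head_step: "\<bar>head (step U p y c) i - head c i\<bar> \<le> 1"
proof (cases "next_action U p y c")
  case (Some a)
  have "\<bar>move_work d z - z\<bar> \<le> 1" for d z by (cases d) auto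
  then show ?thesis by (simp add: step_def Some perform_def)
qed (simp add: step_def)

lemma config_at_Suc: "config_at U p y (Suc t) = step U p y (config_at U p y t)"
  by (simp add: config_at_def)

text \<open>Discrete intermediate values: a head starts at 0 and moves by at most one cell at a
  time.\<close>

lemma visited_interval:
  "v \<in> {min 0 (head (config_at U p y t) i)..max 0 (head (config_at U p y t) i)} \<Longrightarrow>
    \<exists>t'\<le>t. head (config_at U p y t') i = v"
proof (induction t)
  case 0
  then show ?case by (auto simp: config_at_def init_config_def)
next
  case (Suc t)
  have "\<bar>head (config_at U p y (Suc t)) i - head (config_at U p y t) i\<bar> \<le> 1"
    unfolding config_at_Suc by (rule head_step)
  then have "v = head (config_at U p y (Suc t)) i \<or>
      v \<in> {min 0 (head (config_at U p y t) i)..max 0 (head (config_at U p y t) i)}"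
    using Suc.prems by auto
  then show ?case
  proof
    assume "v = head (config_at U p y (Suc t)) i"
    then show ?thesis by blast
  next
    assume "v \<in> {min 0 (head (config_at U p y t) i)..max 0 (head (config_at U p y t) i)}"
    then show ?thesis using Suc.IH le_SucI by blast
  qed
qed

text \<open>Few visited cells keep all heads near 0, so a window reaching as far as the space bound
  on either side captures the tapes.\<close>

lemma head_visited:
  assumes "i < nt" "t' \<le> t"
  shows "\<bar>head (config_at U p y t') i\<bar> < int (card (visited_cells U p y t))"
proof -
  let ?h = "head (config_at U p y t') i"
  have "visited_cells U p y t = (\<lambda>(i, t'). (i, head (config_at U p y t') i)) ` ({..<nt} \<times> {..t})"
    by (auto simp: visited_cells_def)
  then have fin: "finite (visited_cells U p y t)" by simp
  have "{i} \<times> {min 0 ?h..max 0 ?h} \<subseteq> visited_cells U p y t"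
    using visited_interval[of _ p y t' i] assms unfolding visited_cells_def by (auto, metis le_trans)
  then have "card ({i} \<times> {min 0 ?h..max 0 ?h}) \<le> card (visited_cells U p y t)"
    by (rule card_mono[OF fin])
  then show ?thesis by (auto simp: card_cartesian_product)
qed

lemma out_mono: "t \<le> t' \<Longrightarrow> length (out_tape (config_at U p y t)) \<le> length (out_tape (config_at U p y t'))"
proof (induction rule: dec_induct)
  case (step t')
  have "length (out_tape c) \<le> length (out_tape (step U p y c))" for c
    by (auto simp: step_def perform_def split: option.split)
  then show ?case using step.IH le_trans unfolding config_at_Suc by blast
qed simp

lemma funpow_stable: "F z = z \<Longrightarrow> (F ^^ n) z = z"
  by (induction n) auto

text \<open>Before the fixed point is first reached no value repeats, since a repetition would
  provide a shorter way to it. It is therefore reached within \<open>M\<close> steps, and the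
  iteration stays there.\<close>

lemma funpow_pigeonhole:
  fixes F :: "nat \<Rightarrow> nat"
  assumes less: "\<And>t. t \<le> T \<Longrightarrow> (F ^^ t) a < M" and fixed: "F ((F ^^ T) a) = (F ^^ T) a"
  shows "(F ^^ M) a = (F ^^ T) a"
proof -
  let ?z = "(F ^^ T) a"
  define T0 where "T0 = (LEAST t. (F ^^ t) a = ?z)"
  have T0: "(F ^^ T0) a = ?z" unfolding T0_def by (rule LeastI[of _ T]) simp
  have T0T: "T0 \<le> T" unfolding T0_def by (rule Least_le) simp
  have min: "(F ^^ t) a \<noteq> ?z" if "t < T0" for t using not_less_Least[of t] that by (simp add: T0_def)
  have "inj_on (\<lambda>t. (F ^^ t) a) {..T0}"
  proof (rule linorder_inj_onI)
    fix i j assume ij: "i < j" "i \<in> {..T0}" "j \<in> {..T0}"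
    show "(F ^^ i) a \<noteq> (F ^^ j) a"
    proof
      assume eq: "(F ^^ i) a = (F ^^ j) a"
      have "(F ^^ (T0 - j + i)) a = (F ^^ (T0 - j)) ((F ^^ j) a)" by (simp add: funpow_add eq)
      also have "\<dots> = (F ^^ (T0 - j + j)) a" unfolding funpow_add by simp
      also have "\<dots> = ?z" using ij T0 by simp
      finally have "(F ^^ (T0 - j + i)) a = ?z" .
      moreover have "T0 - j + i < T0" using ij unfolding atMost_iff by linarith
      ultimately show False using min by blast
    qed
  qed auto
  moreover have "(\<lambda>t. (F ^^ t) a) ` {..T0} \<subseteq> {..<M}" using less T0T by auto
  ultimately have "card {..T0} \<le> card {..<M}" by (intro card_inj_on_le) auto
  then have "M = (M - T0) + T0" by simp
  then have "(F ^^ M) a = (F ^^ (M - T0)) ((F ^^ T0) a)" by (metis funpow_add comp_apply)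
  then show ?thesis using funpow_stable[of F ?z] fixed by (simp add: T0)
qed

text \<open>The conditions on \<open>N\<close> make every entry of every configuration up to halting
  a proper digit in base \<open>N\<close>; nothing is truncated, and the numerical iteration follows
  the machine exactly.\<close>

theorem sim_correct:
  assumes tm: "turing_machine U" and comp: "computes_in_space U p y x s" and s: "s \<le> J"
    and N: "num_states U \<le> N" "2 ^ (length p + 1) < N" "2 ^ (length y + 1) < N" "2 ^ (length x + 1) < N"
      "ns ^ (2 * J + 1) < N"
  shows "sim N J (code p) (code y) = code x"
proof -
  obtain T where T: "halted U p y (config_at U p y T)" "out_tape (config_at U p y T) = x"
    "card (visited_cells U p y T) \<le> s" using comp unfolding computes_in_space_def by blast
  let ?c = "config_at U p y"
  have ns: "0 < ns" using tm by (auto simp: turing_machine_def)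
  have N0: "0 < N" using N(2) by simp
  have v: "valid p y (?c t)" for t
    by (induction t) (simp add: config_at_def valid_init[OF tm], simp only: config_at_Suc valid_step[OF tm])
  have h: "\<bar>head (?c t) i\<bar> \<le> int J" if "i < nt" "t \<le> T" for i t
    using head_visited[OF that, of p y] T(3) s by linarith
  have fx: "step U p y (?c T) = ?c T" using T(1) by (simp add: halted_def step_def)
  have less: "u < N" if t: "t \<le> T" and u: "u \<in> set (repv J (?c t))" for t u
  proof -
    have p2: "(2::nat) ^ i < N" if "i \<le> m" "(2::nat) ^ m < N" for i m
      by (rule le_less_trans[OF power_increasing that(2)]) (use that in auto)
    \<comment> \<open>The output only grows, so its final value bounds it at all earlier
      times.\<close>
    have "code (out_tape (?c t)) < 2 ^ (length x + 1)" "length (out_tape (?c t)) \<le> length x + 1"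
      using out_mono[OF t, of p y] T(2) code_less[of "out_tape (?c t)" "length x + 1"] by auto
    moreover have "cur_state (?c t) < N" "prog_pos (?c t) \<le> length p + 1" "cond_pos (?c t) \<le> length y + 1"
      using v[of t] N(1) by (auto simp: valid_def)
    moreover have "(\<Sum>j<2 * J + 1. tape (?c t) i (int j - int J) * ns ^ j) < N" if "i < nt" for i
    proof -
      have "(\<Sum>j<2 * J + 1. tape (?c t) i (int j - int J) * ns ^ j) < ns ^ (2 * J + 1)"
        by (rule digit_sum_less) (use v[of t] that in \<open>auto simp: valid_def\<close>)
      then show ?thesis using N(5) by linarith
    qed
    moreover have "ns ^ nat (head (?c t) i + int J) < N" if "i < nt" for i
    proof -
      have "nat (head (?c t) i + int J) \<le> 2 * J + 1" using h[OF that t] by auto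
      then have "ns ^ nat (head (?c t) i + int J) \<le> ns ^ (2 * J + 1)" using ns by (intro power_increasing) auto
      then show ?thesis using N(5) by linarith
    qed
    ultimately show ?thesis using u p2 N by (auto simp: repv_def simp del: sum.lessThan_Suc power_Suc)
  qed
  have get: "cget N (cmk N (repv J (?c t))) j = repv J (?c t) ! j" if "t \<le> T" "j < 5 + 2 * nt" for t j
    using less[OF that(1)] that(2) by (intro cget_cmk) auto
  have one: "stepc N (code p) (code y) (cmk N (repv J (?c t))) = cmk N (repv J (step U p y (?c t)))"
    if "t \<le> T" "\<And>i. i < nt \<Longrightarrow> \<bar>head (step U p y (?c t)) i\<bar> \<le> int J" for t
    unfolding stepc_def using stepv_cong[of "cget N (cmk N (repv J (?c t)))" "(!) (repv J (?c t))"] get[OF that(1)]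
      stepv_repv[OF tm v h[OF _ that(1)] that(2)] by simp
  have it: "t \<le> T \<Longrightarrow> (stepc N (code p) (code y) ^^ t) (initc N J) = cmk N (repv J (?c t))" for t
  proof (induction t)
    case 0
    have "ns ^ J < N"
      using N(5) power_increasing[of J "2 * J + 1" ns] ns by simp
    then have "pw N ns J = ns ^ J" using ns by (intro pw_eq) auto
    then show ?case by (simp add: config_at_def initc_def repv_def init_config_def)
  next
    case (Suc t)
    then have "\<And>i. i < nt \<Longrightarrow> \<bar>head (step U p y (?c t)) i\<bar> \<le> int J"
      using h[of _ "Suc t"] unfolding config_at_Suc by simp
    then show ?case using Suc one[of t] by (simp add: config_at_Suc)
  qed
  have "(stepc N (code p) (code y) ^^ (N ^ (5 + 2 * nt))) (initc N J) = (stepc N (code p) (code y) ^^ T) (initc N J)"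
  proof (rule funpow_pigeonhole)
    show "(stepc N (code p) (code y) ^^ t) (initc N J) < N ^ (5 + 2 * nt)" if "t \<le> T" for t
      unfolding it[OF that] using cmk_less[OF N0, of "repv J (?c t)"] by simp
    show "stepc N (code p) (code y) ((stepc N (code p) (code y) ^^ T) (initc N J)) = (stepc N (code p) (code y) ^^ T) (initc N J)"
      unfolding it[OF le_refl] using one[of T] h[of _ T] by (simp add: fx)
  qed
  then show ?thesis unfolding sim_def it[OF le_refl] using get[of T 4] by (simp add: repv_nth T(2))
qed

end

section \<open>Hashing\<close>

text \<open>Multiplicative hashing: the leading part of \<open>\<alpha> * a mod W\<close>, with
  about \<open>W div L\<close> possible values. The random choice is only the multiplier
  \<open>\<alpha>\<close>, which keeps seeds polynomially long.\<close>

definition hash :: "nat \<Rightarrow> nat \<Rightarrow> nat \<Rightarrow> nat \<Rightarrow> nat" where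
  "hash W L \<alpha> a = (\<alpha> * a mod W) div L"

text \<open>Consecutive multiples of \<open>d\<close> are \<open>d\<close> apart, and the interval
  around \<open>c\<close> has length \<open>2 * L\<close>.\<close>

lemma card_window:
  assumes "0 < (d::nat)"
  shows "card {\<alpha>. c < \<alpha> * d + L \<and> \<alpha> * d < c + L} \<le> 2 * L div d + 1" (is "card ?A \<le> _")
proof (cases "?A = {}")
  case True
  show ?thesis unfolding True by simp
next
  case False
  define \<beta> where "\<beta> = (LEAST \<alpha>. \<alpha> \<in> ?A)"
  have "\<exists>\<alpha>. \<alpha> \<in> ?A" using False by blast
  then have \<beta>: "\<beta> \<in> ?A" unfolding \<beta>_def by (rule LeastI_ex)
  have \<beta>_le: "\<beta> \<le> \<alpha>" if "\<alpha> \<in> ?A" for \<alpha> unfolding \<beta>_def using that by (rule Least_le)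
  have "?A \<subseteq> {\<beta>..\<beta> + 2 * L div d}"
  proof
    fix \<alpha> assume \<alpha>: "\<alpha> \<in> ?A"
    have "\<alpha> * d \<le> \<beta> * d + 2 * L" using \<alpha> \<beta> unfolding mem_Collect_eq by linarith
    then have "(\<alpha> - \<beta>) * d \<le> 2 * L" by (simp add: diff_mult_distrib)
    then have "\<alpha> - \<beta> \<le> 2 * L div d" using assms by (simp add: less_eq_div_iff_mult_less_eq)
    then show "\<alpha> \<in> {\<beta>..\<beta> + 2 * L div d}" using \<beta>_le[OF \<alpha>] by auto
  qed
  then have "card ?A \<le> card {\<beta>..\<beta> + 2 * L div d}" by (rule card_mono[rotated]) simp
  then show ?thesis by simp
qed

text \<open>As \<open>\<alpha>\<close> grows, \<open>\<alpha> d\<close> passes each multiple of \<open>W\<close> only once, so that few \<open>\<alpha>\<close> bring it close to one.\<close>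

lemma card_collisions_less:
  assumes "a' < a" "a < L" "L \<le> W"
  shows "card {\<alpha>. \<alpha> < W \<and> hash W L \<alpha> a = hash W L \<alpha> a'} \<le> 5 * L"
proof -
  define d where "d = a - a'"
  have d: "0 < d" "d + 1 \<le> L" using assms by (auto simp: d_def)
  let ?A = "\<lambda>l. {\<alpha>. l * W < \<alpha> * d + L \<and> \<alpha> * d < l * W + L}"
  have fin: "finite (?A l)" for l
  proof (rule finite_subset)
    show "?A l \<subseteq> {..l * W + L}"
    proof
      fix \<alpha> assume "\<alpha> \<in> ?A l"
      moreover have "\<alpha> * 1 \<le> \<alpha> * d" using d by (intro mult_le_mono2) simp
      ultimately show "\<alpha> \<in> {..l * W + L}" unfolding mem_Collect_eq atMost_iff by linarith
    qed
  qed simp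
  \<comment> \<open>A collision puts \<open>\<alpha> * d\<close> within distance \<open>L\<close> of
    some multiple \<open>l * W\<close>, and \<open>\<alpha> < W\<close> leaves only
    \<open>l \<le> d\<close>.\<close>
  have "{\<alpha>. \<alpha> < W \<and> hash W L \<alpha> a = hash W L \<alpha> a'} \<subseteq> (\<Union>l\<in>{..d}. ?A l)"
  proof
    fix \<alpha> assume "\<alpha> \<in> {\<alpha>. \<alpha> < W \<and> hash W L \<alpha> a = hash W L \<alpha> a'}"
    then have \<alpha>: "\<alpha> < W" and eq: "(\<alpha> * a mod W) div L = (\<alpha> * a' mod W) div L" by (auto simp: hash_def)
    define x u z v where "x = \<alpha> * a div W" "u = \<alpha> * a mod W" "z = \<alpha> * a' div W" "v = \<alpha> * a' mod W"
    note xuzv = x_u_z_v_def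
    have e1: "\<alpha> * a = x * W + u" "\<alpha> * a' = z * W + v" by (simp_all add: xuzv)
    have L: "0 < L" using assms by simp
    have "u = L * (u div L) + u mod L" "v = L * (u div L) + v mod L"
      using eq by (simp_all add: xuzv) (metis mult_div_mod_eq)
    moreover have "u mod L < L" "v mod L < L" using L by auto
    ultimately have uv: "u < v + L" "v < u + L" by linarith+
    have zx: "z \<le> x" using assms unfolding xuzv by (intro div_le_mono mult_le_mono) auto
    have "\<alpha> * d = \<alpha> * a - \<alpha> * a'" by (simp add: d_def diff_mult_distrib2)
    moreover have "\<alpha> * a' \<le> \<alpha> * a" using assms by simp
    ultimately have "\<alpha> * d + z * W + v = x * W + u" using e1 by simp
    moreover have "x * W = (x - z) * W + z * W" using zx by (metis add_mult_distrib le_add_diff_inverse2)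
    ultimately have e2: "\<alpha> * d + v = (x - z) * W + u" by simp
    have 1: "(x - z) * W < \<alpha> * d + L" "\<alpha> * d < (x - z) * W + L" using e2 uv by linarith+
    have "(\<alpha> + 1) * d \<le> W * d" using \<alpha> by (intro mult_le_mono1) simp
    then have "\<alpha> * d + L < (d + 1) * W + 0" using d assms by (simp add: algebra_simps)
    then have "(x - z) * W < (d + 1) * W" using 1 by linarith
    then have "x - z < d + 1" unfolding mult_less_cancel2 by blast
    then have "x - z \<le> d" by simp
    then show "\<alpha> \<in> (\<Union>l\<in>{..d}. ?A l)" using 1 by blast
  qed
  then have "card {\<alpha>. \<alpha> < W \<and> hash W L \<alpha> a = hash W L \<alpha> a'} \<le> card (\<Union>l\<in>{..d}. ?A l)"
    by (rule card_mono[rotated]) (use fin in auto)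
  also have "\<dots> \<le> (\<Sum>l\<in>{..d}. card (?A l))" by (rule card_UN_le) simp
  also have "\<dots> \<le> (\<Sum>l\<in>{..d}. 2 * L div d + 1)" by (rule sum_mono) (rule card_window[OF d(1)])
  \<comment> \<open>There are \<open>d + 1\<close> windows; the three summands are at most
    \<open>2 * L\<close>, \<open>2 * L\<close> and \<open>L\<close>.\<close>
  also have "\<dots> = d * (2 * L div d) + 2 * L div d + (d + 1)" by simp
  also have "\<dots> \<le> 2 * L + 2 * L + L" using d by (intro add_le_mono) auto
  finally show ?thesis by simp
qed

lemma card_collisions:
  assumes "a \<noteq> a'" "a < L" "a' < L" "L \<le> W"
  shows "card {\<alpha>. \<alpha> < W \<and> hash W L \<alpha> a = hash W L \<alpha> a'} \<le> 5 * L"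
proof (cases "a' < a")
  case False
  have "{\<alpha>. \<alpha> < W \<and> hash W L \<alpha> a = hash W L \<alpha> a'} = {\<alpha>. \<alpha> < W \<and> hash W L \<alpha> a' = hash W L \<alpha> a}" by auto
  then show ?thesis using card_collisions_less[of a a'] False assms by simp
qed (use card_collisions_less assms in simp)

text \<open>Digit \<open>i\<close> of the seed in base \<open>W\<close>. It is written as an
  iterated division because \<open>i\<close> is variable here, and \<open>W ^ i\<close> would not be
  polynomially bounded.\<close>

definition dig :: "nat \<Rightarrow> nat \<Rightarrow> nat \<Rightarrow> nat" where
  "dig W \<omega> i = ((\<lambda>x. x div W) ^^ i) \<omega> mod W"

lemma dig_0: "dig W \<omega> 0 = \<omega> mod W" and dig_Suc: "dig W \<omega> (Suc i) = dig W (\<omega> div W) i"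
  by (simp_all add: dig_def funpow_Suc_right del: funpow.simps(2))

text \<open>The digits of a random seed are independent: splitting off the lowest one maps the set
  injectively into a product with \<open>Q\<close>.\<close>

lemma card_digits:
  assumes "Q \<subseteq> {..<W}"
  shows "card {\<omega>. \<omega> < W ^ D \<and> (\<forall>i<D. dig W \<omega> i \<in> Q)} \<le> card Q ^ D"
proof (induction D)
  case 0
  have "{\<omega>. \<omega> < W ^ 0 \<and> (\<forall>i<0. dig W \<omega> i \<in> Q)} = {0}" by auto
  then show ?case by simp
next
  case (Suc D)
  let ?X = "\<lambda>D. {\<omega>. \<omega> < W ^ D \<and> (\<forall>i<D. dig W \<omega> i \<in> Q)}"
  have fin: "finite Q" using assms finite_subset by blast
  have "inj_on (\<lambda>\<omega>. (\<omega> mod W, \<omega> div W)) (?X (Suc D))"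
    by (rule inj_onI) (metis mult_div_mod_eq prod.inject)
  moreover have "(\<lambda>\<omega>. (\<omega> mod W, \<omega> div W)) ` ?X (Suc D) \<subseteq> Q \<times> ?X D"
  proof (rule image_subsetI)
    fix \<omega> assume \<omega>: "\<omega> \<in> ?X (Suc D)"
    then have "\<omega> mod W \<in> Q" using dig_0[of W \<omega>] by (metis (mono_tags, lifting) mem_Collect_eq zero_less_Suc)
    moreover have "\<omega> div W < W ^ D" using \<omega> by (simp add: less_mult_imp_div_less mult.commute)
    moreover have "dig W (\<omega> div W) i \<in> Q" if "i < D" for i using \<omega> that dig_Suc[of W \<omega> i] by auto
    ultimately show "(\<omega> mod W, \<omega> div W) \<in> Q \<times> ?X D" by auto
  qed
  ultimately have "card (?X (Suc D)) \<le> card (Q \<times> ?X D)"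
    by (rule card_inj_on_le) (simp add: fin)
  also have "\<dots> \<le> card Q * card Q ^ D" unfolding card_cartesian_product by (rule mult_le_mono2[OF Suc.IH])
  finally show ?case by simp
qed

text \<open>Other programs with the same output do no harm, since it is the output that has to be
  recovered.\<close>

definition isolates :: "(nat \<Rightarrow> nat) \<Rightarrow> (nat \<Rightarrow> nat) \<Rightarrow> nat \<Rightarrow> nat \<Rightarrow> bool" where
  "isolates h f K q \<longleftrightarrow> (\<forall>q'<K. f q = f q' \<or> h (f q) \<noteq> h (f q'))"

text \<open>Union bound. For fixed \<open>b\<close> and \<open>q\<close>, each of at most
  \<open>K\<close> other outputs collides under at most \<open>5 * L\<close> of the
  \<open>16 * K * L\<close> multipliers, so fewer than half of them are bad. All \<open>D\<close>
  digits are bad for at most a fraction \<open>1 / 2 ^ D\<close> of the seeds, and there are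
  \<open>A * K < 2 ^ D\<close> pairs.\<close>

lemma exists_good_seed:
  fixes out :: "nat \<Rightarrow> nat \<Rightarrow> nat"
  assumes out: "\<And>q b. out q b < L" and K: "0 < K" and W: "W = 16 * K * L" and D: "A * K < 2 ^ D"
  shows "\<exists>\<omega><W ^ D. \<forall>b<A. \<forall>q<K. \<exists>i<D. isolates (hash W L (dig W \<omega> i)) (\<lambda>q. out q b) K q"
proof (rule ccontr)
  assume neg: "\<not> ?thesis"
  have L: "0 < L" using out[of 0 0] by simp
  have LW: "L \<le> W" "0 < W" using K L by (auto simp: W)
  let ?Q = "\<lambda>b q. {\<alpha>. \<alpha> < W \<and> \<not> isolates (hash W L \<alpha>) (\<lambda>q. out q b) K q}"
  let ?X = "\<lambda>b q. {\<omega>. \<omega> < W ^ D \<and> (\<forall>i<D. dig W \<omega> i \<in> ?Q b q)}"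
  have Q: "2 * card (?Q b q) \<le> W" for b q
  proof -
    let ?C = "\<lambda>q'. {\<alpha>. \<alpha> < W \<and> out q b \<noteq> out q' b \<and> hash W L \<alpha> (out q b) = hash W L \<alpha> (out q' b)}"
    have "?Q b q \<subseteq> (\<Union>q'\<in>{..<K}. ?C q')" by (auto simp: isolates_def)
    then have "card (?Q b q) \<le> card (\<Union>q'\<in>{..<K}. ?C q')" by (rule card_mono[rotated]) auto
    also have "\<dots> \<le> (\<Sum>q'\<in>{..<K}. card (?C q'))" by (rule card_UN_le) simp
    also have "\<dots> \<le> (\<Sum>q'\<in>{..<K}. 5 * L)"
    proof (rule sum_mono)
      fix q' show "card (?C q') \<le> 5 * L"
        using card_collisions[OF _ out out LW(1), of q b q' b] by (cases "out q b = out q' b") auto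
    qed
    finally have "card (?Q b q) \<le> K * (5 * L)" by simp
    then show ?thesis unfolding W by simp
  qed
  have X: "2 ^ D * card (?X b q) \<le> W ^ D" for b q
  proof -
    have "2 ^ D * card (?X b q) \<le> 2 ^ D * card (?Q b q) ^ D" by (intro mult_le_mono2 card_digits) auto
    also have "\<dots> = (2 * card (?Q b q)) ^ D" by (simp add: power_mult_distrib)
    also have "\<dots> \<le> W ^ D" by (intro power_mono Q) simp
    finally show ?thesis .
  qed
  have "{..<W ^ D} \<subseteq> (\<Union>(b, q)\<in>{..<A} \<times> {..<K}. ?X b q)"
  proof
    fix \<omega> assume \<omega>: "\<omega> \<in> {..<W ^ D}"
    then obtain b q where bq: "b < A" "q < K" "\<forall>i<D. \<not> isolates (hash W L (dig W \<omega> i)) (\<lambda>q. out q b) K q"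
      using neg by auto
    have "dig W \<omega> i < W" for i using LW by (simp add: dig_def)
    then show "\<omega> \<in> (\<Union>(b, q)\<in>{..<A} \<times> {..<K}. ?X b q)" using bq \<omega> by auto
  qed
  then have "card {..<W ^ D} \<le> card (\<Union>(b, q)\<in>{..<A} \<times> {..<K}. ?X b q)" by (rule card_mono[rotated]) auto
  also have "\<dots> \<le> (\<Sum>(b, q)\<in>{..<A} \<times> {..<K}. card (?X b q))"
    using card_UN_le[of "{..<A} \<times> {..<K}" "\<lambda>(b, q). ?X b q"] by (simp add: case_prod_unfold)
  finally have "2 ^ D * W ^ D \<le> 2 ^ D * (\<Sum>(b, q)\<in>{..<A} \<times> {..<K}. card (?X b q))" by simp
  also have "\<dots> = (\<Sum>(b, q)\<in>{..<A} \<times> {..<K}. 2 ^ D * card (?X b q))"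
    by (simp add: sum_distrib_left case_prod_unfold)
  also have "\<dots> \<le> (\<Sum>(b, q)\<in>{..<A} \<times> {..<K}. W ^ D)" by (intro sum_mono) (use X in auto)
  also have "\<dots> = A * K * W ^ D" by (simp add: card_cartesian_product case_prod_unfold)
  finally have "2 ^ D * W ^ D \<le> A * K * W ^ D" .
  moreover have "0 < W ^ D" using LW by simp
  ultimately have "2 ^ D \<le> A * K" by (metis mult_le_cancel2)
  then show False using D by simp
qed

section \<open>The two decoding functions\<close>

text \<open>A pairing with polynomial values. It is injective because \<open>x \<le> x + y\<close>
  keeps the value below the next square, so that the square of \<open>x + y\<close> can be read off.
  The projections search up to the value itself.\<close>

definition pr :: "nat \<Rightarrow> nat \<Rightarrow> nat" where "pr x y = (x + y)\<^sup>2 + x"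
definition pr1 :: "nat \<Rightarrow> nat" where "pr1 u = bleast (Suc u) (\<lambda>x. \<exists>y<Suc u. pr x y = u)"
definition pr2 :: "nat \<Rightarrow> nat" where "pr2 u = bleast (Suc u) (\<lambda>y. \<exists>x<Suc u. pr x y = u)"

lemma pr_inj: "pr x y = pr x' y' \<Longrightarrow> x = x' \<and> y = y'"
proof -
  assume e: "pr x y = pr x' y'"
  have lt: "pr x y < pr x' y'" if "x + y < x' + y'" for x y x' y'
  proof -
    have "(x + y + 1)\<^sup>2 \<le> (x' + y')\<^sup>2" using that by (intro power_mono) auto
    then show ?thesis by (simp add: pr_def power2_eq_square algebra_simps)
  qed
  then have "x + y = x' + y'" using e by (metis less_irrefl linorder_less_linear)
  then show ?thesis using e by (simp add: pr_def)
qed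

lemma pr_ge: "x \<le> pr x y" "y \<le> pr x y" for x y
proof -
  have "x + y \<le> (x + y)\<^sup>2" by (cases "x + y") (auto simp: power2_eq_square)
  then show "x \<le> pr x y" "y \<le> pr x y" by (auto simp: pr_def)
qed

lemma pr1_pr [simp]: "pr1 (pr x y) = x"
  unfolding pr1_def
proof (rule bleast_equality)
  show "x < Suc (pr x y)" "\<exists>y'<Suc (pr x y). pr x y' = pr x y"
    by (simp add: pr_ge le_imp_less_Suc, intro exI[of _ y], simp add: pr_ge le_imp_less_Suc)
  show "x \<le> z" if "\<exists>y'<Suc (pr x y). pr z y' = pr x y" for z using that by (auto dest: pr_inj)
qed

lemma pr2_pr [simp]: "pr2 (pr x y) = y"
  unfolding pr2_def
proof (rule bleast_equality)
  show "y < Suc (pr x y)" "\<exists>x'<Suc (pr x y). pr x' y = pr x y"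
    by (simp add: pr_ge le_imp_less_Suc, intro exI[of _ x], simp add: pr_ge le_imp_less_Suc)
  show "y \<le> z" if "\<exists>x'<Suc (pr x y). pr x' z = pr x y" for z using that by (auto dest: pr_inj)
qed

lemma E2_pr1 [E2]: assumes "E2 f" shows "E2 (\<lambda>env. pr1 (f env))"
  unfolding pr1_def pr_def by (intro E2 E2_tl assms)

lemma E2_pr2 [E2]: assumes "E2 f" shows "E2 (\<lambda>env. pr2 (f env))"
  unfolding pr2_def pr_def by (intro E2 E2_tl assms)

lemma E2_dig [E2]:
  assumes "E2 W" "E2 w" "E2 i" shows "E2 (\<lambda>env. dig (W env) (w env) (i env))"
proof -
  have "E2 (\<lambda>env. ((\<lambda>x. x div W env) ^^ i env) (w env))"
    by (rule E2_funpow[OF assms(3,2) _ E2_PB[OF assms(2)]])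
      (use assms in \<open>auto intro!: E2 E2_tl intro: le_trans[OF div_le_dividend]\<close>)
  then show ?thesis unfolding dig_def by (intro E2 assms)
qed

lemma E2_hash [E2]:
  assumes "E2 W" "E2 L" "E2 x" "E2 a" shows "E2 (\<lambda>env. hash (W env) (L env) (x env) (a env))"
  unfolding hash_def by (intro E2 assms)

context
  fixes U :: tm
begin

text \<open>The reduction modulo \<open>2 ^ n\<close> gives every \<open>q\<close> and
  \<open>b\<close> an output in the range that is hashed, even where the simulation overflowed;
  outputs below \<open>2 ^ n\<close> are unaffected.\<close>

definition outp :: "nat \<Rightarrow> nat \<Rightarrow> nat \<Rightarrow> nat \<Rightarrow> nat \<Rightarrow> nat" where
  "outp N J n b q = sim U N J q b mod pw N 2 n"

definition width :: "nat \<Rightarrow> nat \<Rightarrow> nat \<Rightarrow> nat" where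
  "width N n k = 16 * pw N 2 k * pw N 2 n"

definition hsh :: "nat \<Rightarrow> nat \<Rightarrow> nat \<Rightarrow> nat \<Rightarrow> nat \<Rightarrow> nat \<Rightarrow> nat" where
  "hsh N n k \<omega> i a = hash (width N n k) (pw N 2 n) (dig (width N n k) \<omega> i) a"

text \<open>The index \<open>i\<close> may depend on \<open>b\<close> and \<open>q\<close>, the seed
  \<open>\<omega>\<close> may not. This is \<open>isolates\<close> for all pairs, written out with
  bounded quantifiers.\<close>

definition good :: "nat \<Rightarrow> nat \<Rightarrow> nat \<Rightarrow> nat \<Rightarrow> nat \<Rightarrow> bool" where
  "good N J n k \<omega> \<longleftrightarrow> (\<forall>b<pw N 2 n. \<forall>q<pw N 2 k. \<exists>i<n + k + 1. \<forall>q'<pw N 2 k.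
     outp N J n b q = outp N J n b q' \<or> \<not> hsh N n k \<omega> i (outp N J n b q) = hsh N n k \<omega> i (outp N J n b q'))"

text \<open>Determined by \<open>N\<close>, \<open>J\<close>, \<open>n\<close> and \<open>k\<close>
  alone, so the machine that knows \<open>a\<close> and the one that knows \<open>b\<close> find the
  same seed.\<close>

definition seed :: "nat \<Rightarrow> nat \<Rightarrow> nat \<Rightarrow> nat \<Rightarrow> nat" where
  "seed N J n k = bleast N (good N J n k)"

text \<open>The successor makes the value positive, hence the code of a string.\<close>

definition fingerprint :: "nat \<Rightarrow> nat \<Rightarrow> nat \<Rightarrow> nat \<Rightarrow> nat \<Rightarrow> nat \<Rightarrow> nat" where
  "fingerprint N J n k i a = Suc (hsh N n k (seed N J n k) i a)"

text \<open>Any program whose output has the fingerprint \<open>v\<close> will do; the first one is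
  taken.\<close>

definition recover :: "nat \<Rightarrow> nat \<Rightarrow> nat \<Rightarrow> nat \<Rightarrow> nat \<Rightarrow> nat \<Rightarrow> nat \<Rightarrow> nat" where
  "recover N J n k i b v =
     outp N J n b (bleast (pw N 2 k) (\<lambda>q. fingerprint N J n k i (outp N J n b q) = v))"

lemma E2_outp [E2]:
  assumes "E2 N" "E2 J" "E2 n" "E2 b" "E2 q" "0 < num_symbols U"
  shows "E2 (\<lambda>env. outp (N env) (J env) (n env) (b env) (q env))"
  unfolding outp_def by (intro E2 E2_sim assms)

lemma E2_width [E2]: "E2 N \<Longrightarrow> E2 n \<Longrightarrow> E2 k \<Longrightarrow> E2 (\<lambda>env. width (N env) (n env) (k env))"
  unfolding width_def by (intro E2)

lemma E2_hsh [E2]: "E2 N \<Longrightarrow> E2 n \<Longrightarrow> E2 k \<Longrightarrow> E2 w \<Longrightarrow> E2 i \<Longrightarrow> E2 a \<Longrightarrow>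
    E2 (\<lambda>env. hsh (N env) (n env) (k env) (w env) (i env) (a env))"
  unfolding hsh_def by (intro E2)

lemma P2_good:
  assumes "E2 N" "E2 J" "E2 n" "E2 k" "E2 w" "0 < num_symbols U"
  shows "P2 (\<lambda>env. good (N env) (J env) (n env) (k env) (w env))"
  unfolding good_def by (intro E2 E2_tl assms)

lemma E2_seed [E2]:
  assumes "E2 N" "E2 J" "E2 n" "E2 k" "0 < num_symbols U"
  shows "E2 (\<lambda>env. seed (N env) (J env) (n env) (k env))"
  unfolding seed_def by (intro E2_bleast P2_good E2_tl E2 assms)

lemma E2_fingerprint [E2]:
  assumes "E2 N" "E2 J" "E2 n" "E2 k" "E2 i" "E2 a" "0 < num_symbols U"
  shows "E2 (\<lambda>env. fingerprint (N env) (J env) (n env) (k env) (i env) (a env))"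
  unfolding fingerprint_def by (intro E2 assms)

lemma E2_recover [E2]:
  assumes "E2 N" "E2 J" "E2 n" "E2 k" "E2 i" "E2 b" "E2 v" "0 < num_symbols U"
  shows "E2 (\<lambda>env. recover (N env) (J env) (n env) (k env) (i env) (b env) (v env))"
  unfolding recover_def by (intro E2 E2_tl assms)

lemma recover_fingerprint:
  assumes tm: "turing_machine U" and comp: "computes_in_space U q b a s" and s: "s \<le> J"
    and len: "length a < n" "length b < n" "length q < k"
    and N: "num_states U \<le> N" "num_symbols U ^ (2 * J + 1) < N" "2 ^ ((n + k + 4) * (n + k + 1)) < N"
  shows "\<exists>i<n + k + 1. recover N J n k i (code b) (fingerprint N J n k i (code a)) = code a
    \<and> fingerprint N J n k i (code a) < 2 ^ (k + 5)"
proof -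
  \<comment> \<open>The bound is the logarithm of \<open>width N n k ^ (n + k + 1)\<close>, the
    number of seeds, and dominates the other exponents below.\<close>
  have p2: "(2::nat) ^ x < N" if "x \<le> (n + k + 4) * (n + k + 1)" for x
    by (rule le_less_trans[OF power_increasing N(3)]) (use that in auto)
  have le: "n + k + 4 \<le> (n + k + 4) * (n + k + 1)" by simp
  have K: "pw N 2 k = 2 ^ k" and A: "pw N 2 n = 2 ^ n"
    using p2[of k] p2[of n] le by (auto intro!: pw_eq less_imp_le)
  have W: "width N n k = 2 ^ (n + k + 4)" by (simp add: width_def K A power_add)
  have sim: "sim U N J (code q) (code b) = code a"
    by (rule sim_correct[OF tm comp s N(1) _ _ _ N(2)]) (rule p2, rule le_trans[OF _ le], use len in simp)+
  \<comment> \<open>There are \<open>2 ^ n * 2 ^ k\<close> pairs, fewer than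
    \<open>2 ^ (n + k + 1)\<close>; this fixes the number of hash functions.\<close>
  have "\<exists>\<omega><width N n k ^ (n + k + 1). \<forall>b<2 ^ n. \<forall>q<2 ^ k. \<exists>i<n + k + 1.
      isolates (hash (width N n k) (2 ^ n) (dig (width N n k) \<omega> i)) (\<lambda>q. outp N J n b q) (2 ^ k) q"
    by (rule exists_good_seed) (auto simp: outp_def A K width_def power_add)
  then obtain \<omega> where \<omega>: "\<omega> < width N n k ^ (n + k + 1)" "good N J n k \<omega>"
    unfolding good_def isolates_def hsh_def A K by metis
  have "width N n k ^ (n + k + 1) < N" unfolding W power_mult[symmetric] by (rule N(3))
  then have "good N J n k (seed N J n k)"
    using bleastI[of \<omega> N "good N J n k"] \<omega> by (simp add: seed_def)
  moreover have "code b < 2 ^ n" "code q < 2 ^ k" using len by (simp_all add: code_less)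
  ultimately obtain i where i: "i < n + k + 1" "\<And>q'. q' < 2 ^ k \<Longrightarrow>
     outp N J n (code b) (code q) = outp N J n (code b) q' \<or>
     hsh N n k (seed N J n k) i (outp N J n (code b) (code q)) \<noteq> hsh N n k (seed N J n k) i (outp N J n (code b) q')"
    unfolding good_def A K by blast
  have out: "outp N J n (code b) (code q) = code a"
    using len by (simp add: outp_def sim A code_less)
  let ?v = "fingerprint N J n k i (code a)"
  let ?q = "bleast (2 ^ k) (\<lambda>q. fingerprint N J n k i (outp N J n (code b) q) = ?v)"
  have q: "fingerprint N J n k i (outp N J n (code b) ?q) = ?v \<and> ?q \<le> code q"
    by (rule bleastI) (use \<open>code q < 2 ^ k\<close> out in auto)
  \<comment> \<open>The search may stop before \<open>code q\<close>, but by isolation the program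
    found has the same output.\<close>
  then have "outp N J n (code b) ?q = code a"
    using i(2)[of ?q] out \<open>code q < 2 ^ k\<close> unfolding fingerprint_def by auto
  then have "recover N J n k i (code b) ?v = code a" by (simp add: recover_def K)
  moreover have "?v < 2 ^ (k + 5)"
  proof -
    have "hsh N n k (seed N J n k) i (code a) < 2 ^ (k + 4)"
      unfolding hsh_def hash_def W A
    proof (rule less_mult_imp_div_less)
      have "(2::nat) ^ (k + 4) * 2 ^ n = 2 ^ (n + k + 4)" by (simp add: power_add)
      then show "dig (2 ^ (n + k + 4)) (seed N J n k) i * code a mod 2 ^ (n + k + 4) < 2 ^ (k + 4) * 2 ^ n"
        by simp
    qed
    then have "?v \<le> 2 ^ (k + 4)" by (simp add: fingerprint_def)
    also have "(2::nat) ^ (k + 4) < 2 ^ (k + 5)" by simp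
    finally show ?thesis .
  qed
  ultimately show ?thesis using i(1) by blast
qed

end

text \<open>
  The powers of two that serve as cut-offs are not polynomially bounded; \<open>h\<close> collects them.
\<close>

definition XC :: "(nat list \<Rightarrow> nat) \<Rightarrow> (nat list \<Rightarrow> nat) \<Rightarrow> bool" where
  "XC h f \<longleftrightarrow> (\<exists>e c. \<forall>env. eval e env = f env \<and>
     (\<forall>B. le_env env B \<longrightarrow> h env \<le> B \<longrightarrow> ok ((B + 2) ^ c) e env))"

lemma E2_XC: "E2 f \<Longrightarrow> XC h f"
  unfolding E2_def XC_def by blast

text \<open>Repeated doubling never exceeds its final value, which the hypothesis on
  \<open>B\<close> bounds.\<close>

lemma XC_let_power:
  assumes f: "E2 f" and g: "XC h g"
  shows "XC (\<lambda>env. max (2 ^ f env) (h (2 ^ f env # env))) (\<lambda>env. g (2 ^ f env # env))"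
proof -
  obtain e1 c1 where e1: "\<And>env. eval e1 env = f env" "\<And>env B. le_env env B \<Longrightarrow> ok ((B + 2) ^ c1) e1 env" "1 \<le> c1"
    using E2D[OF f] by blast
  obtain e2 c2 where e2: "\<And>env. eval e2 env = env $ 0 + env $ 0" "\<And>env B. le_env env B \<Longrightarrow> ok ((B + 2) ^ c2) e2 env"
    using E2D[OF E2_add[OF E2_var[of 0] E2_var[of 0]]] by blast
  obtain e3 c3 where e3: "\<And>env. eval e3 env = g env"
    "\<And>env B. le_env env B \<Longrightarrow> h env \<le> B \<Longrightarrow> ok ((B + 2) ^ c3) e3 env"
    using g unfolding XC_def by blast
  let ?e = "For e1 (Succ Zero) e2"
  have l: "loop (\<lambda>r a. a + a) n x = x * 2 ^ n" for n x by (induction n arbitrary: x) (auto simp: algebra_simps)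
  have ev: "eval ?e env = 2 ^ f env" for env by (simp add: e1(1) e2(1) l)
  let ?c = "Suc (Suc c1) * c2 + c1 + c3"
  have k: "ok ((B + 2) ^ ?c) (LetIn ?e e3) env"
    if env: "le_env env B" and m: "max (2 ^ f env) (h (2 ^ f env # env)) \<le> B" for env B
  proof -
    let ?D = "(B + 2) ^ c1"
    have BD: "B \<le> ?D" using B_ge[OF e1(3), of B] by simp
    have fB: "f env \<le> B" by (rule le_trans[OF less_imp_le[OF less_exp]]) (use m in simp)
    have 1: "ok ((B + 2) ^ ?c) e1 env" using ok_mono[OF e1(2)[OF env] B_mono, of ?c] by simp
    have 2: "1 < (B + 2) ^ ?c"
      using B_ge[of ?c B] e1(3) by linarith
    have 3: "ok ((B + 2) ^ ?c) e2 (a # r # env)" if "a \<le> B" "r \<le> B" for a r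
      by (rule ok_mono[OF e2(2)[of _ B] B_mono]) (use that env in auto)
    have "j \<le> f env \<Longrightarrow> a * 2 ^ j \<le> 2 ^ f env \<Longrightarrow>
      okloop (\<lambda>r acc. ok ((B + 2) ^ ?c) e2 (acc # r # env)) (\<lambda>r acc. acc + acc) j a" for j a
    proof (induction j arbitrary: a)
      case (Suc j)
      have "a * 1 \<le> a * 2 ^ Suc j" by (intro mult_le_mono2) simp
      also have "\<dots> \<le> B" using le_trans[OF Suc.prems(2)] m by simp
      finally have "a \<le> B" by simp
      moreover have "j \<le> B" using Suc.prems(1) fB by simp
      moreover have "(a + a) * 2 ^ j \<le> 2 ^ f env" using Suc.prems(2) by (simp add: algebra_simps)
      ultimately show ?case using Suc 3 by simp
    qed simp
    then have "ok ((B + 2) ^ ?c) ?e env" using 1 2 by (simp add: e1(1) e2(1))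
    moreover have "ok ((B + 2) ^ ?c) e3 (2 ^ f env # env)"
      by (rule ok_mono[OF e3(2)[of _ B] B_mono]) (use env m in auto)
    ultimately show ?thesis using ev by simp
  qed
  show ?thesis unfolding XC_def
    by (intro exI[of _ "LetIn ?e e3"] exI[of _ ?c] allI conjI impI k) (simp_all only: eval.simps(6) ev e3(1))
qed

section \<open>The theorem\<close>

lemma KS_le: "computes_in_space M p y x s \<Longrightarrow> KS M s x y \<le> enat (length p)"
  unfolding KS_def by (rule INF_lower) simp

lemma KS_less: "KS M s x y < enat k \<Longrightarrow> \<exists>p. length p < k \<and> computes_in_space M p y x s"
  unfolding KS_def by (auto simp: INF_less_iff)

lemma KS_antimono: "s \<le> s' \<Longrightarrow> KS M s' x y \<le> KS M s x y"
  unfolding KS_def computes_in_space_def by (intro INF_superset_mono) (auto dest: le_trans)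

text \<open>Exponent of the cut-off \<open>N\<close>. The term in \<open>2 ^ j\<close> makes room
  for tape contents, the square for seeds and for constants of the machine. Space is proportional to
  this exponent, hence O(s) + poly(n).\<close>

definition expo :: "nat \<Rightarrow> nat \<Rightarrow> nat \<Rightarrow> nat \<Rightarrow> nat" where
  "expo C n k j = C * 2 ^ j + (n + k + C)\<^sup>2"

definition pack :: "nat \<Rightarrow> nat \<Rightarrow> nat \<Rightarrow> nat \<Rightarrow> nat" where
  "pack i k n j = pr i (pr k (pr n j))"

lemma space_bound:
  assumes "1 \<le> b"
  shows "m * ((b + 2) * c + 1 + 1) \<le> m * (3 * c + 2) * (b :: nat)"
proof -
  have "(b + 2) * c \<le> (3 * b) * c" using assms by (intro mult_le_mono1) simp
  then have "(b + 2) * c + 1 + 1 \<le> (3 * c + 2) * b" using assms by (simp add: algebra_simps)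
  then have "m * ((b + 2) * c + 1 + 1) \<le> m * ((3 * c + 2) * b)" by (rule mult_le_mono2)
  then show ?thesis by (simp only: mult.assoc)
qed

lemma self_le_square: "x \<le> (x :: nat)\<^sup>2"
  by (cases x) (auto simp: power2_eq_square)

text \<open>A polynomial in \<open>2 ^ b\<close> has a number of bits linear in \<open>b\<close>:
  here the polynomial value bounds become linear space.\<close>

lemma power_bound: "(2 ^ b + 2) ^ c < (2 :: nat) ^ ((b + 2) * c + 1)"
proof -
  have "(2::nat) ^ (b + 2) = 4 * 2 ^ b" "1 \<le> (2::nat) ^ b" by (simp_all add: power_add)
  then have "(2::nat) ^ b + 2 \<le> 2 ^ (b + 2)" by linarith
  then have "((2::nat) ^ b + 2) ^ c \<le> 2 ^ ((b + 2) * c)" unfolding power_mult by (rule power_mono) simp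
  moreover have "(2::nat) ^ ((b + 2) * c + 1) = 2 * 2 ^ ((b + 2) * c)" "0 < (2::nat) ^ ((b + 2) * c)"
    by (simp_all only: power_add) simp_all
  ultimately show ?thesis by linarith
qed

lemma B_le: "1 \<le> c \<Longrightarrow> v \<le> B \<Longrightarrow> v \<le> (B + 2 :: nat) ^ c"
  using B_ge[of c B] by simp

lemma expo_ge: "n + k + C \<le> expo C n k j" "1 \<le> C \<Longrightarrow> 2 ^ j \<le> expo C n k j"
proof -
  have "n + k + C \<le> (n + k + C)\<^sup>2" by (rule self_le_square)
  then show "n + k + C \<le> expo C n k j" by (simp add: expo_def)
  assume "1 \<le> C"
  then have "1 * 2 ^ j \<le> C * 2 ^ j" by (rule mult_le_mono1)
  then show "2 ^ j \<le> expo C n k j" unfolding expo_def by linarith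
qed

lemma power_le_B:
  assumes "v \<le> 2 ^ l" "l \<le> b"
  shows "v \<le> (2 :: nat) ^ b"
  by (rule le_trans[OF assms(1) power_increasing[OF assms(2)]]) simp

context
  fixes U :: tm and C :: nat
  assumes ns: "0 < num_symbols U" and C: "5 \<le> C"
begin

lemma size_bounds:
  fixes v :: nat
  defines "b \<equiv> \<lambda>n k j p. expo C n k j + length p + 1"
  shows "code p \<le> 2 ^ b n k j p" "2 ^ j \<le> (2::nat) ^ b n k j p" "2 ^ expo C n k j \<le> (2::nat) ^ b n k j p"
    and "v < 2 ^ n \<Longrightarrow> v \<le> 2 ^ b n k j p" "v < 2 ^ (k + 5) \<Longrightarrow> v \<le> 2 ^ b n k j p"
proof -
  have "code p < 2 ^ (length p + 1)" using code_less'[of p] by simp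
  then show "code p \<le> 2 ^ b n k j p" by (rule power_le_B[OF less_imp_le]) (simp add: b_def)
  have "j \<le> b n k j p" using less_exp[of j] expo_ge(2)[of C j n k] C unfolding b_def by linarith
  then show "2 ^ j \<le> (2::nat) ^ b n k j p" by (intro power_increasing) auto
  show "2 ^ expo C n k j \<le> (2::nat) ^ b n k j p" by (intro power_increasing) (auto simp: b_def)
  have "n \<le> b n k j p" "k + 5 \<le> b n k j p" using expo_ge(1)[of n k C j] C by (auto simp: b_def)
  then show "v < 2 ^ n \<Longrightarrow> v \<le> 2 ^ b n k j p" "v < 2 ^ (k + 5) \<Longrightarrow> v \<le> 2 ^ b n k j p"
    using power_le_B[OF less_imp_le] by blast+
qed

text \<open>The machine behind (3). It unpacks its program and hashes its condition; the large
  numbers \<open>2 ^ j\<close> and \<open>2 ^ expo C n k j\<close> are recomputed and so cost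
  nothing in the description.\<close>

lemma cond_machine:
  "\<exists>V c. turing_machine V \<and> (\<forall>i k n j a x p. code p = pack i k n j \<longrightarrow> code a < 2 ^ n \<longrightarrow>
     code x = fingerprint U (2 ^ expo C n k j) (2 ^ j) n k i (code a) \<longrightarrow>
     KS V (c * (expo C n k j + length p + 1)) x a \<le> enat (length p))"
proof -
  \<comment> \<open>The environment is \<open>[code a, code p]\<close>. Each of the two powers is
    put in front when bound, which moves the program from index 1 to 2 and then to 3.\<close>
  let ?f = "\<lambda>env. pr2 (pr2 (pr2 (env $ 1)))"
  let ?g = "\<lambda>env. C * env $ 0 + (pr1 (pr2 (pr2 (env $ 2))) + pr1 (pr2 (env $ 2)) + C) ^ 2"
  let ?F = "\<lambda>env. fingerprint U (env $ 0) (env $ 1) (pr1 (pr2 (pr2 (env $ 3)))) (pr1 (pr2 (env $ 3)))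
     (pr1 (env $ 3)) (env $ 2)"
  have E: "E2 ?f" "E2 ?g" "E2 ?F" by (intro E2 ns)+
  obtain e c where ev: "\<And>env. eval e env = ?F (2 ^ ?g (2 ^ ?f env # env) # 2 ^ ?f env # env)"
    and ok: "\<And>env B. le_env env B \<Longrightarrow> max (2 ^ ?f env) (max (2 ^ ?g (2 ^ ?f env # env)) 0) \<le> B \<Longrightarrow> ok ((B + 2) ^ c) e env"
    using XC_let_power[OF E(1) XC_let_power[OF E(2) E2_XC[OF E(3), of "\<lambda>_. 0"]]] unfolding XC_def by metis
  define m where "m = regs (cond_prog e)"
  define V where "V = compiled m (cond_prog e)"
  have "KS V (m * (3 * Suc c + 2) * (expo C n k j + length p + 1)) x a \<le> enat (length p)"
    if p: "code p = pack i k n j" and a: "code a < 2 ^ n"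
      and x: "code x = fingerprint U (2 ^ expo C n k j) (2 ^ j) n k i (code a)" for i k n j a x p
  proof -
    let ?E = "expo C n k j"
    define b where "b = ?E + length p + 1"
    define L where "L = (b + 2) * Suc c + 1"
    let ?env = "[code a, code p]"
    have f: "?f ?env = j" by (simp add: p pack_def)
    have g: "?g (2 ^ j # ?env) = ?E" by (simp add: p pack_def expo_def)
    note bounds = size_bounds[where n = n and k = k and j = j and p = p, folded b_def]
    have cp: "code p \<le> 2 ^ b" and ca: "code a \<le> 2 ^ b" using bounds(1) bounds(4)[OF a] by auto
    have "ok ((2 ^ b + 2) ^ c) e ?env"
      by (rule ok) (simp_all only: f g, use cp ca bounds(2,3) in \<open>auto simp: le_env_def\<close>)
    then have o: "ok ((2 ^ b + 2) ^ Suc c) e ?env" by (rule ok_mono) (rule B_mono, simp)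
    have "eval e ?env = code x" unfolding ev f g x by (simp add: p pack_def)
    then have A: "computes_in_space V p a x (m * (L + 1))"
      unfolding V_def m_def L_def
      by (intro compute_cond_prog[OF _ _ power_bound o] B_le cp ca) auto
    have B: "m * (L + 1) \<le> m * (3 * Suc c + 2) * b"
      unfolding L_def by (rule space_bound) (simp add: b_def)
    show ?thesis by (rule order.trans[OF KS_antimono[OF B] KS_le[OF A], unfolded b_def])
  qed
  moreover have "turing_machine V" unfolding V_def m_def by (rule compiled(1)[OF wf_com_regs])
  ultimately show ?thesis by blast
qed

text \<open>The machine behind (1): the condition is the fingerprint paired with \<open>b\<close>,
  and \<open>a\<close> is found by search among the programs.\<close>

lemma pair_machine:
  "\<exists>V c. turing_machine V \<and> (\<forall>i k n j b v x p. code p = pack i k n j \<longrightarrow> code b < 2 ^ n \<longrightarrow> code v < 2 ^ (k + 5) \<longrightarrow>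
     code x = recover U (2 ^ expo C n k j) (2 ^ j) n k i (code b) (code v) \<longrightarrow>
     KS V (c * (expo C n k j + length p + 1)) x (encode_pair v b) \<le> enat (length p))"
proof -
  let ?f = "\<lambda>env. pr2 (pr2 (pr2 (env $ 2)))"
  let ?g = "\<lambda>env. C * env $ 0 + (pr1 (pr2 (pr2 (env $ 3))) + pr1 (pr2 (env $ 3)) + C) ^ 2"
  let ?F = "\<lambda>env. recover U (env $ 0) (env $ 1) (pr1 (pr2 (pr2 (env $ 4)))) (pr1 (pr2 (env $ 4)))
     (pr1 (env $ 4)) (env $ 2) (env $ 3)"
  have E: "E2 ?f" "E2 ?g" "E2 ?F" by (intro E2 ns)+
  obtain e c where ev: "\<And>env. eval e env = ?F (2 ^ ?g (2 ^ ?f env # env) # 2 ^ ?f env # env)"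
    and ok: "\<And>env B. le_env env B \<Longrightarrow> max (2 ^ ?f env) (max (2 ^ ?g (2 ^ ?f env # env)) 0) \<le> B \<Longrightarrow> ok ((B + 2) ^ c) e env"
    using XC_let_power[OF E(1) XC_let_power[OF E(2) E2_XC[OF E(3), of "\<lambda>_. 0"]]] unfolding XC_def by metis
  define m where "m = regs (pair_prog e)"
  define V where "V = compiled m (pair_prog e)"
  have "KS V (m * (3 * Suc c + 2) * (expo C n k j + length p + 1)) x (encode_pair v b') \<le> enat (length p)"
    if p: "code p = pack i k n j" and b': "code b' < 2 ^ n" and v: "code v < 2 ^ (k + 5)"
      and x: "code x = recover U (2 ^ expo C n k j) (2 ^ j) n k i (code b') (code v)" for i k n j b' v x p
  proof -
    let ?E = "expo C n k j"
    define b where "b = ?E + length p + 1"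
    define L where "L = (b + 2) * Suc c + 1"
    let ?env = "[code b', code v, code p]"
    have f: "?f ?env = j" by (simp add: p pack_def)
    have g: "?g (2 ^ j # ?env) = ?E" by (simp add: p pack_def expo_def)
    note bounds = size_bounds[where n = n and k = k and j = j and p = p, folded b_def]
    have cp: "code p \<le> 2 ^ b" and cb: "code b' \<le> 2 ^ b" and cv: "code v \<le> 2 ^ b"
      using bounds(1) bounds(4)[OF b'] bounds(5)[OF v] by auto
    have "ok ((2 ^ b + 2) ^ c) e ?env"
      by (rule ok) (simp_all only: f g, use cp cb cv bounds(2,3) in \<open>auto simp: le_env_def\<close>)
    then have o: "ok ((2 ^ b + 2) ^ Suc c) e ?env" by (rule ok_mono) (rule B_mono, simp)
    have "eval e ?env = code x" unfolding ev f g x by (simp add: p pack_def)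
    then have A: "computes_in_space V p (encode_pair v b') x (m * (L + 1))"
      unfolding V_def m_def L_def
      by (intro compute_pair_prog[OF _ _ _ power_bound o] B_le cp cb cv) auto
    have B: "m * (L + 1) \<le> m * (3 * Suc c + 2) * b"
      unfolding L_def by (rule space_bound) (simp add: b_def)
    show ?thesis by (rule order.trans[OF KS_antimono[OF B] KS_le[OF A], unfolded b_def])
  qed
  moreover have "turing_machine V" unfolding V_def m_def by (rule compiled(1)[OF wf_com_regs])
  ultimately show ?thesis by blast
qed

end

text \<open>Origin of the constant: one summand for the states, twice the alphabet size for the
  two-sided window of \<open>2 * 2 ^ j + 1\<close> cells, and 5 for the seeds.\<close>

lemma expo_bounds:
  assumes "num_states U + 2 * num_symbols U + 5 \<le> C"
  shows "num_states U \<le> 2 ^ expo C n k j"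
    and "num_symbols U ^ (2 * 2 ^ j + 1) < 2 ^ expo C n k j"
    and "2 ^ ((n + k + 4) * (n + k + 1)) < (2::nat) ^ expo C n k j"
proof -
  let ?E = "expo C n k j"
  have C: "C \<le> ?E" using expo_ge(1)[of n k C j] by simp
  have "num_states U \<le> C" using assms by simp
  also have "\<dots> \<le> ?E" by (rule C)
  also have "\<dots> \<le> 2 ^ ?E" using less_exp[of ?E] by simp
  finally show "num_states U \<le> 2 ^ ?E" .
  let ?g = "num_symbols U"
  have "?g ^ (2 * 2 ^ j + 1) \<le> (2 ^ ?g) ^ (2 * 2 ^ j + 1)"
    using less_exp[of ?g] by (intro power_mono) auto
  also have "\<dots> = 2 ^ (?g * (2 * 2 ^ j + 1))" by (simp only: power_mult)
  also have "\<dots> < 2 ^ ?E"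
  proof (rule power_strict_increasing)
    have "2 * ?g * 2 ^ j \<le> C * 2 ^ j" using assms by (intro mult_le_mono1) simp
    moreover have "?g < (n + k + C)\<^sup>2"
    proof -
      have "?g < C" using assms by simp
      also have "C \<le> (n + k + C)\<^sup>2" using self_le_square[of "n + k + C"] by linarith
      finally show ?thesis .
    qed
    moreover have "?g * (2 * 2 ^ j + 1) = 2 * ?g * 2 ^ j + ?g" by (simp add: algebra_simps)
    ultimately show "?g * (2 * 2 ^ j + 1) < ?E" unfolding expo_def by linarith
  qed simp
  finally show "?g ^ (2 * 2 ^ j + 1) < 2 ^ ?E" .
  show "2 ^ ((n + k + 4) * (n + k + 1)) < (2::nat) ^ ?E"
  proof (rule power_strict_increasing)
    have "(n + k + 4) * (n + k + 1) < (n + k + 5) * (n + k + 5)" by (simp add: algebra_simps)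
    also have "\<dots> \<le> (n + k + C) * (n + k + C)" using assms by (intro mult_le_mono) auto
    also have "\<dots> \<le> ?E" by (simp add: expo_def power2_eq_square)
    finally show "(n + k + 4) * (n + k + 1) < ?E" .
  qed simp
qed

lemma pr_le: "pr x y \<le> (x + y + 1)\<^sup>2"
  by (simp add: pr_def power2_eq_square algebra_simps)

text \<open>Pairing a number below \<open>m\<close> with one of at most \<open>m ^ d\<close> yields
  at most \<open>m ^ (2 * Suc d)\<close>; from 2 this gives 6 and then 14.\<close>

lemma pack_le: "pack i k n j \<le> (i + k + n + j + 2) ^ 14"
proof -
  define m where "m = i + k + n + j + 2"
  have m: "2 \<le> m" by (simp add: m_def)
  have step: "pr x y \<le> m ^ (2 * Suc d)" if "x + 1 \<le> m" "y \<le> m ^ d" "1 \<le> d" for x y d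
  proof -
    have "m ^ 1 \<le> m ^ d" using that(3) m by (intro power_increasing) auto
    then have "x + y + 1 \<le> 2 * m ^ d" using that by simp
    also have "\<dots> \<le> m * m ^ d" using m by (intro mult_le_mono1)
    finally have "(x + y + 1)\<^sup>2 \<le> (m ^ Suc d)\<^sup>2" by (intro power_mono) auto
    also have "\<dots> = m ^ (2 * Suc d)" by (simp only: power_mult[symmetric] mult.commute)
    finally show ?thesis using pr_le[of x y] by linarith
  qed
  have "(n + j + 1)\<^sup>2 \<le> m ^ 2" by (intro power_mono) (auto simp: m_def)
  then have "pr n j \<le> m ^ 2" using pr_le[of n j] by linarith
  then have "pr k (pr n j) \<le> m ^ 6" using step[of k "pr n j" 2] by (simp add: m_def)
  then have "pr i (pr k (pr n j)) \<le> m ^ 14" using step[of i "pr k (pr n j)" 6] by (simp add: m_def)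
  then show ?thesis by (simp add: pack_def m_def)
qed

lemma power_length_le_code: "2 ^ length p \<le> code p"
  using code_less[of p "length p"] by simp

lemma exists_log: "1 \<le> s \<Longrightarrow> \<exists>j. s \<le> 2 ^ j \<and> 2 ^ j \<le> 2 * (s::nat)"
proof -
  assume s: "1 \<le> s"
  define j where "j = (LEAST j. s \<le> 2 ^ j)"
  have "s \<le> 2 ^ s" using less_exp[of s] by simp
  then have j: "s \<le> 2 ^ j" unfolding j_def by (rule LeastI)
  have "2 ^ j \<le> 2 * s"
  proof (cases j)
    case 0
    then show ?thesis using s by simp
  next
    case (Suc i)
    then have "\<not> s \<le> 2 ^ i" using not_less_Least[of i "\<lambda>j. s \<le> 2 ^ j"] unfolding j_def by simp
    then show ?thesis using Suc by simp
  qed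
  with j show ?thesis by blast
qed

text \<open>There is a work tape, and its initial cell counts as visited. This allows constants to
  be absorbed into multiples of \<open>s\<close>.\<close>

lemma computes_pos:
  assumes "turing_machine U" "computes_in_space U p y x s" shows "1 \<le> s"
proof -
  have "0 < num_tapes U" using assms(1) by (auto simp: turing_machine_def)
  moreover obtain t where "card (visited_cells U p y t) \<le> s" using assms(2) by (auto simp: computes_in_space_def)
  ultimately show ?thesis using head_visited[of 0 U 0 t p y] by linarith
qed

lemma log2_le: "0 < x \<Longrightarrow> log 2 (real x) \<le> real x"
  using log2_of_power_le[of x x] less_exp[of x] by simp

text \<open>\<open>c\<close> is the additive constant in the description of a string by itself.\<close>

lemma program_bounds:
  fixes c C n k s i j :: nat
  assumes p: "code p = pack i k n j" and n: "1 \<le> n" and s: "1 \<le> s" and k: "k \<le> n + c" and i: "i \<le> n + k"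
    and j: "2 ^ j \<le> 2 * ((1 + c) * s)"
  shows "expo C n k j + length p + 1 \<le>
      (2 * (C + 14) * (1 + c) + (2 + c + C)\<^sup>2 + 14 * (6 + 2 * c) + 1) * (s + n\<^sup>2)" (is ?A)
    and "real (length p) \<le> 14 * (9 + 4 * real c) + 14 * (loglog s + log 2 (real n))" (is ?B)
proof -
  let ?m = "i + k + n + j + 2"
  have len: "2 ^ length p \<le> ?m ^ 14" using power_length_le_code[of p] pack_le[of i k n j] p by simp
  \<comment> \<open>A length linear in \<open>?m\<close> is good enough for the space estimate; the
    logarithmic bound is derived separately below.\<close>
  also have "\<dots> \<le> (2 ^ ?m) ^ 14" using less_exp[of ?m] by (intro power_mono) auto
  also have "\<dots> = 2 ^ (?m * 14)" by (simp only: power_mult)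
  finally have len1: "length p \<le> ?m * 14" by (rule power_le_imp_le_exp[rotated]) simp
  have m: "?m \<le> 4 * n + 2 * c + 2 + j" using i k by simp
  have n2: "n \<le> n\<^sup>2" "1 \<le> n\<^sup>2" using self_le_square[of n] n by linarith+
  have "j \<le> 2 ^ j" using less_exp[of j] by simp
  then have j': "j \<le> 2 * ((1 + c) * s)" using j by linarith
  have "(2 + 2 * c) * 1 \<le> (2 + 2 * c) * n\<^sup>2" using n2 by (intro mult_le_mono2)
  then have "?m \<le> (6 + 2 * c) * n\<^sup>2 + 2 * ((1 + c) * s)" using m j' n2 by (simp add: algebra_simps)
  then have "length p \<le> ((6 + 2 * c) * n\<^sup>2 + 2 * ((1 + c) * s)) * 14" by (rule le_trans[OF len1 mult_le_mono1])
  then have len2: "length p \<le> 14 * (6 + 2 * c) * n\<^sup>2 + 14 * (2 * ((1 + c) * s))"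
    by (simp only: algebra_simps)
  have "n + k + C \<le> 2 * n + c + C" using k by simp
  also have "\<dots> \<le> (2 + c + C) * n" using mult_le_mono2[OF n, of "c + C"] by (simp add: algebra_simps)
  finally have "(n + k + C)\<^sup>2 \<le> ((2 + c + C) * n)\<^sup>2" by (rule power_mono) simp
  then have e1: "(n + k + C)\<^sup>2 \<le> (2 + c + C)\<^sup>2 * n\<^sup>2" by (simp only: power_mult_distrib)
  have e2: "C * 2 ^ j \<le> C * (2 * ((1 + c) * s))" using j by (rule mult_le_mono2)
  let ?G1 = "2 * (C + 14) * (1 + c)" and ?G2 = "(2 + c + C)\<^sup>2 + 14 * (6 + 2 * c) + 1"
  have "expo C n k j + length p + 1 \<le> C * (2 * ((1 + c) * s)) + 14 * (2 * ((1 + c) * s)) +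
      ((2 + c + C)\<^sup>2 * n\<^sup>2 + 14 * (6 + 2 * c) * n\<^sup>2 + 1 * n\<^sup>2)"
    unfolding expo_def using e1 e2 len2 n2 by linarith
  also have "\<dots> = ?G1 * s + ?G2 * n\<^sup>2" by (simp only: algebra_simps)
  also have "\<dots> \<le> (?G1 + ?G2) * s + (?G1 + ?G2) * n\<^sup>2" by (rule add_le_mono; rule mult_le_mono1) simp_all
  finally show ?A by (simp only: distrib_left add.assoc)
  define l where "l = log 2 (real (max 2 s))"
  have l: "1 \<le> l" unfolding l_def by (simp add: le_log_iff)
  have "real j = log 2 (2 ^ j)" by simp
  also have "\<dots> \<le> log 2 (2 * (1 + real c) * real (max 2 s))"
  proof (rule log_mono)
    have "real (2 ^ j) \<le> real (2 * ((1 + c) * s))" using j by (rule of_nat_mono)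
    also have "\<dots> = 2 * (1 + real c) * real s" by (simp add: algebra_simps)
    also have "\<dots> \<le> 2 * (1 + real c) * real (max 2 s)" by (intro mult_left_mono) auto
    finally show "2 ^ j \<le> 2 * (1 + real c) * real (max 2 s)" by simp
  qed auto
  also have "\<dots> = log 2 (2 * (1 + real c)) + l" unfolding l_def by (subst log_mult) auto
  also have "log 2 (2 * (1 + real c)) \<le> 2 * (1 + real c)"
    using log2_le[of "2 * (1 + c)"] by simp
  finally have jl: "real j \<le> 2 * (1 + real c) + l" by simp
  \<comment> \<open>All summands of \<open>?m\<close> are bounded by multiples of the product
    \<open>real n * l\<close>, whose logarithm splits into \<open>log 2 (real n)\<close> and
    \<open>log 2 l\<close>, the latter being \<open>loglog s\<close>.\<close>
  have nl: "1 \<le> real n * l" "real n \<le> real n * l" "l \<le> real n * l"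
    using n l mult_mono[of 1 "real n" 1 l] mult_left_mono[of 1 l "real n"] mult_right_mono[of 1 "real n" l] by auto
  have "real ?m \<le> real (4 * n + 2 * c + 2 + j)" using m by (rule of_nat_mono)
  also have "\<dots> \<le> 4 * real n + (4 + 4 * real c) * 1 + l" using jl by simp
  also have "\<dots> \<le> 4 * (real n * l) + (4 + 4 * real c) * (real n * l) + real n * l"
    using nl by (intro add_mono mult_left_mono) auto
  also have "\<dots> = (9 + 4 * real c) * (real n * l)" by (simp add: algebra_simps)
  finally have ml: "real ?m \<le> (9 + 4 * real c) * (real n * l)" .
  have "real (length p) = log 2 (2 ^ length p)" by simp
  also have "\<dots> \<le> log 2 (real ?m ^ 14)"
  proof (rule log_mono)
    have "real (2 ^ length p) \<le> real (?m ^ 14)" using len by (rule of_nat_mono)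
    then show "2 ^ length p \<le> real ?m ^ 14" by simp
  qed auto
  also have "\<dots> = 14 * log 2 (real ?m)" by (subst log_nat_power) auto
  also have "log 2 (real ?m) \<le> log 2 ((9 + 4 * real c) * (real n * l))" by (rule log_mono) (use ml in auto)
  also have "\<dots> = log 2 (9 + 4 * real c) + (log 2 (real n) + log 2 l)"
    using n l by (simp add: log_mult)
  also have "log 2 (9 + 4 * real c) \<le> 9 + 4 * real c"
    using log2_le[of "9 + 4 * c"] by simp
  finally show ?B by (simp add: loglog_def l_def algebra_simps)
qed

theorem theorem6:
  fixes U :: tm
  assumes "optimal U"
  shows "\<exists>(c::nat) (q::nat poly). \<forall>(n::nat) (k::nat) (s::nat) (a::bitstring) (b::bitstring).
    length a < n \<longrightarrow> length b < n \<longrightarrow> KS U s a b < enat k \<longrightarrow>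
    (\<exists>p::bitstring.
       ereal_of_enat (KS U (c * s + poly q n) a (encode_pair p b))
         \<le> ereal (real c * (loglog s + log 2 (real n)) + real c) \<and>
       ereal_of_enat (KS_plain U (c * s) p)
         \<le> ereal (real k + real c * log 2 (real n) + real c) \<and>
       ereal_of_enat (KS U (c * s + poly q n) p a)
         \<le> ereal (real c * (loglog s + log 2 (real n)) + real c))"
proof -
  have tm: "turing_machine U" and opt: "\<And>V. turing_machine V \<Longrightarrow> \<exists>c. \<forall>x y s. KS U (c * s) x y \<le> KS V s x y + enat c"
    using assms by (auto simp: optimal_def)
  have ns: "0 < num_symbols U" using tm by (auto simp: turing_machine_def)
  obtain c0 where c0: "\<And>x y s. KS U (c0 * s) x y \<le> KS (compiled 1 echo_prog) s x y + enat c0"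
    using opt[OF compiled(1)[OF wf_echo]] by blast
  have self: "KS U c0 x y \<le> enat (length x + c0)" for x y
  proof -
    have "KS U (c0 * 1) x y \<le> KS (compiled 1 echo_prog) 1 x y + enat c0" by (rule c0)
    also have "\<dots> \<le> enat (length x) + enat c0" by (rule add_right_mono[OF KS_le[OF compute_echo]])
    finally show ?thesis by simp
  qed
  define C where "C = num_states U + 2 * num_symbols U + 5"
  have C: "5 \<le> C" by (simp add: C_def)
  obtain V1 c1 where V1: "turing_machine V1" "\<And>i k n j b v x p. code p = pack i k n j \<Longrightarrow> code b < 2 ^ n \<Longrightarrow>
      code v < 2 ^ (k + 5) \<Longrightarrow> code x = recover U (2 ^ expo C n k j) (2 ^ j) n k i (code b) (code v) \<Longrightarrow>
      KS V1 (c1 * (expo C n k j + length p + 1)) x (encode_pair v b) \<le> enat (length p)"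
    using pair_machine[OF ns C] by blast
  obtain V3 c3 where V3: "turing_machine V3" "\<And>i k n j a x p. code p = pack i k n j \<Longrightarrow> code a < 2 ^ n \<Longrightarrow>
      code x = fingerprint U (2 ^ expo C n k j) (2 ^ j) n k i (code a) \<Longrightarrow>
      KS V3 (c3 * (expo C n k j + length p + 1)) x a \<le> enat (length p)"
    using cond_machine[OF ns C] by blast
  obtain d1 where d1: "\<And>x y s. KS U (d1 * s) x y \<le> KS V1 s x y + enat d1" using opt[OF V1(1)] by blast
  obtain d3 where d3: "\<And>x y s. KS U (d3 * s) x y \<le> KS V3 s x y + enat d3" using opt[OF V3(1)] by blast
  define G where "G = 2 * (C + 14) * (1 + c0) + (2 + c0 + C)\<^sup>2 + 14 * (6 + 2 * c0) + 1"
  \<comment> \<open>\<open>c\<close> collects the length of the packed program, the overheads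
    \<open>d1\<close> and \<open>d3\<close> of optimality, the cost \<open>c0\<close> of a
    self-description, the 5 surplus bits of a fingerprint, and both space factors.\<close>
  define c where "c = 14 * (9 + 4 * c0) + d1 + d3 + c0 + 5 + d1 * c1 * G + d3 * c3 * G"
  have "\<exists>p. ereal_of_enat (KS U (c * s + poly (monom c 2) n) a (encode_pair p b))
         \<le> ereal (real c * (loglog s + log 2 (real n)) + real c) \<and>
       ereal_of_enat (KS_plain U (c * s) p)
         \<le> ereal (real k + real c * log 2 (real n) + real c) \<and>
       ereal_of_enat (KS U (c * s + poly (monom c 2) n) p a)
         \<le> ereal (real c * (loglog s + log 2 (real n)) + real c)"
    if a: "length a < n" and b: "length b < n" and ks: "KS U s a b < enat k" for n k s a b
  proof -
    have n: "1 \<le> n" using a by simp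
    have s: "1 \<le> s" using KS_less[OF ks] computes_pos[OF tm] by blast
    \<comment> \<open>Every string has a program of length at most its own plus \<open>c0\<close>,
      so larger \<open>k\<close> carry no information. The cap makes \<open>k'\<close> linear in
      \<open>n\<close>: it can be described in O(log n) bits, and the seeds have length
      poly(n).\<close>
    define k' where "k' = min k (n + c0)"
    have k': "k' \<le> k" "k' \<le> n + c0" by (simp_all add: k'_def)
    \<comment> \<open>The self-description, used when \<open>k\<close> is large, may take
      \<open>c0\<close> cells, hence the maximum.\<close>
    have "KS U (max s c0) a b < enat k'"
    proof (cases "k \<le> n + c0")
      case True
      then show ?thesis using KS_antimono[of s "max s c0" U a b] ks by (simp add: k'_def)
    next
      case False
      have "KS U (max s c0) a b \<le> enat (length a + c0)"
        using KS_antimono[of c0 "max s c0" U a b] self[of a b] by simp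
      also have "\<dots> < enat (n + c0)" using a by simp
      finally show ?thesis using False by (simp add: k'_def)
    qed
    then obtain q where q: "length q < k'" "computes_in_space U q b a (max s c0)" using KS_less by blast
    obtain j where j: "max s c0 \<le> 2 ^ j" "2 ^ j \<le> 2 * max s c0" using exists_log[OF max.coboundedI1[OF s]] by blast
    have "max s c0 \<le> (1 + c0) * s" using s by (cases s) auto
    then have j2: "2 ^ j \<le> 2 * ((1 + c0) * s)" using j(2) by linarith
    let ?E = "expo C n k' j"
    obtain i where i: "i < n + k' + 1"
      "recover U (2 ^ ?E) (2 ^ j) n k' i (code b) (fingerprint U (2 ^ ?E) (2 ^ j) n k' i (code a)) = code a"
      "fingerprint U (2 ^ ?E) (2 ^ j) n k' i (code a) < 2 ^ (k' + 5)"
      using recover_fingerprint[OF tm q(2) j(1) a b q(1)] expo_bounds[of U C] C_def by blast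
    obtain v where v: "code v = fingerprint U (2 ^ ?E) (2 ^ j) n k' i (code a)"
      using code_surj by (metis fingerprint_def zero_less_Suc)
    \<comment> \<open>Only positive numbers are codes of strings; here \<open>n \<ge> 1\<close>
      ensures this.\<close>
    have "0 < pack i k' n j"
      using n pr_ge(1)[of n j] pr_ge(2)[of "pr n j" k'] pr_ge(2)[of "pr k' (pr n j)" i] unfolding pack_def by linarith
    then obtain r where r: "code r = pack i k' n j" using code_surj by blast
    have E: "?E + length r + 1 \<le> G * (s + n\<^sup>2)"
      and len: "real (length r) \<le> 14 * (9 + 4 * real c0) + 14 * (loglog s + log 2 (real n))"
      using program_bounds[OF r n s k'(2) _ j2] i(1) unfolding G_def by auto
    have logs: "0 \<le> loglog s" "0 \<le> log 2 (real n)"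
      using n by (auto simp: loglog_def le_log_iff zero_le_log_cancel_iff)
    \<comment> \<open>\<open>d\<close> is the factor from optimality and \<open>e\<close> the one
      from the decoding machine.\<close>
    have space: "d * (e * (?E + length r + 1)) \<le> c * s + poly (monom c 2) n" if "d * e * G \<le> c" for d e
    proof -
      have "d * (e * (?E + length r + 1)) \<le> d * (e * (G * (s + n\<^sup>2)))" by (intro mult_le_mono2 E)
      also have "\<dots> = d * e * G * (s + n\<^sup>2)" by simp
      also have "\<dots> \<le> c * (s + n\<^sup>2)" using that by (rule mult_le_mono1)
      finally show ?thesis by (simp add: poly_monom algebra_simps)
    qed
    have fin: "ereal_of_enat (KS U (c * s + poly (monom c 2) n) x y)
        \<le> ereal (real c * (loglog s + log 2 (real n)) + real c)"
      if "KS U (d * (e * (?E + length r + 1))) x y \<le> enat (length r) + enat d" "d * e * G \<le> c"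
        "14 * (9 + 4 * c0) + d \<le> c" for d e x y
    proof -
      have "KS U (c * s + poly (monom c 2) n) x y \<le> enat (length r + d)"
        using order.trans[OF KS_antimono[OF space[OF that(2)]] that(1)] by simp
      then have "ereal_of_enat (KS U (c * s + poly (monom c 2) n) x y) \<le> ereal (real (length r + d))"
        by (metis ereal_of_enat_le_iff ereal_of_enat_simps(1))
      also have "real (length r + d) \<le> 14 * (loglog s + log 2 (real n)) + real (14 * (9 + 4 * c0) + d)"
        using len by simp
      also have "\<dots> \<le> real c * (loglog s + log 2 (real n)) + real c"
      proof (intro add_mono mult_right_mono)
        show "14 \<le> real c" by (simp add: c_def)
        show "real (14 * (9 + 4 * c0) + d) \<le> real c" using that(3) by (rule of_nat_mono)
      qed (use logs in simp)
      finally show ?thesis by simp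
    qed
    have 1: "KS U (d1 * (c1 * (?E + length r + 1))) a (encode_pair v b) \<le> enat (length r) + enat d1"
      by (rule order.trans[OF d1 add_right_mono[OF V1(2)[OF r]]]) (use b i v in \<open>auto simp: code_less\<close>)
    have 3: "KS U (d3 * (c3 * (?E + length r + 1))) v a \<le> enat (length r) + enat d3"
      by (rule order.trans[OF d3 add_right_mono[OF V3(2)[OF r]]]) (use a v in \<open>auto simp: code_less\<close>)
    \<comment> \<open>For (2) the fingerprint is described by itself; its surplus over
      \<open>k\<close> is even a constant.\<close>
    have "length v < k' + 5" using i(3) v by (simp add: code_less[symmetric])
    have "c0 \<le> c * s" using s by (cases s) (auto simp: c_def)
    then have "KS_plain U (c * s) v \<le> enat (length v + c0)"
      unfolding KS_plain_def using KS_antimono self order.trans by blast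
    then have "ereal_of_enat (KS_plain U (c * s) v) \<le> ereal (real (length v + c0))"
      by (metis ereal_of_enat_le_iff ereal_of_enat_simps(1))
    also have "real (length v + c0) \<le> real k + real c"
    proof -
      have "length v + c0 \<le> k + c" using \<open>length v < k' + 5\<close> k' by (simp add: c_def)
      then show ?thesis by linarith
    qed
    also have "\<dots> \<le> real k + real c * log 2 (real n) + real c" using logs by simp
    finally have 2: "ereal_of_enat (KS_plain U (c * s) v) \<le> ereal (real k + real c * log 2 (real n) + real c)"
      by simp
    show ?thesis
      using fin[OF 1] fin[OF 3] 2 by (intro exI[of _ v]) (simp add: c_def)
  qed
  then show ?thesis by blast
qed

end
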